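(* Let $n$ be a positive integer and let $\mathcal{N}\to\mathcal{B}_2$ be an $n$-fold covering over $\mathcal{B}_2$. If $n$ is odd then $\mathcal{N}$ is homeomorphic to $\mathcal{B}_2$. If $n$ is even then $\mathcal{N}$ is homeomorphic to $\mathcal{G}_1$ or $\mathcal{B}_1$ or $\mathcal{B}_2$. The corresponding numbers of non-equivalent $n$-fold coverings (with $\mathcal{N}$ homeomorphic to $\mathcal{G}_1$, $\mathcal{B}_2$, $\mathcal{B}_1$ in (i), (ii), (iii) respectively) are given by $$\text{(i)}\quad c_{\mathbb{Z}^3,\pi_1(\mathcal{B}_2)}(n)=\frac12\sum_{2l\mid n}\ \sum_{m\mid\frac n{2l}}\Big(l^2+\frac32+\frac12(-1)^l+(-1)^{\frac n{2lm}}+(-1)^{l+\frac n{2lm}}\Big)m,$$ $$\text{(ii)}\quad c_{\pi_1(\mathcal{B}_2),\pi_1(\mathcal{B}_2)}(n)=\begin{cases}\displaystyle\sum_{4k\mid n}\Big(\sigma_1\!\left(\frac n{2k}\right)-\sigma_1\!\left(\frac n{4k}\right)\Big)&\text{if } n\text{ is even},\\[2ex]\displaystyle\sum_{l\mid n}\sigma_1\!\left(\frac nl\right)&\text{if } n\text{ is odd},\end{cases}$$ $$\text{(iii)}\quad c_{\pi_1(\mathcal{B}_1),\pi_1(\mathcal{B}_2)}(n)=2\Big(\sum_{2k\mid n}\sigma_1\!\left(\frac n{2k}\right)-\sum_{4k\mid n}\sigma_1\!\left(\frac n{4k}\right)\Big).$$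
   Context: $\mathcal{G}_1$ is the 3-torus, with $\pi_1(\mathcal{G}_1)=\mathbb{Z}^3$. $\mathcal{B}_1$ and $\mathcal{B}_2$ (first and second amphicosm) are the closed flat non-orientable 3-manifolds with fundamental groups $\pi_1(\mathcal{B}_1)=\langle a,b,c : cac^{-1}a^{-1}=cbc^{-1}b^{-1}=1,\ aba^{-1}b=1\rangle$ and $\pi_1(\mathcal{B}_2)=\langle \alpha,\beta,\gamma : \gamma\beta\gamma^{-1}=\alpha\gamma\alpha^{-1}\gamma^{-1}=\beta,\ \alpha\beta\alpha^{-1}=\beta^{-1}\rangle$. Coverings are by connected manifolds; two coverings $\rho:\mathcal{N}\to\mathcal{M}$, $\rho':\mathcal{N}'\to\mathcal{M}$ are equivalent if there is a homeomorphism $\eta:\mathcal{N}\to\mathcal{N}'$ with $\rho=\rho'\circ\eta$. Equivalence classes of $n$-fold coverings of $\mathcal{M}$ correspond to conjugacy classes of index-$n$ subgroups of $\pi_1(\mathcal{M})$. $c_{H,G}(n)$ denotes the number of conjugacy classes (in $G$) of subgroups of index $n$ in $G$ that are isomorphic to $H$. $\sigma_1(m)$ is the sum of the positive divisors of the positive integer $m$. A sum $\sum_{jl\mid n}$ ($j$ a fixed integer) runs over all positive integers $l$ such that $jl$ divides $n$, and equals $0$ if there are none. *)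

theory Defs
  imports "HOL-Analysis.Analysis" "HOL-Algebra.Coset" "HOL-Algebra.Bij"
    "HOL-Algebra.Elementary_Groups"
begin

section \<open>Groups given by generators and relations\<close>

text \<open>A word is a list of letters \<open>(x, s)\<close>, standing for \<open>x\<close> if \<open>s\<close> is true and for the
  inverse of \<open>x\<close> otherwise. A pair \<open>(l, r)\<close> of words in \<open>R\<close> is the defining relation \<open>l = r\<close>.\<close>

type_synonym 'g word = "('g \<times> bool) list"

definition gen :: "'g \<Rightarrow> 'g word" where "gen x = [(x, True)]"

definition gen_inv :: "'g \<Rightarrow> 'g word" where "gen_inv x = [(x, False)]"

inductive word_eq :: "('g word \<times> 'g word) set \<Rightarrow> 'g word \<Rightarrow> 'g word \<Rightarrow> bool"
  for R :: "('g word \<times> 'g word) set" where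
  word_eq_refl: "word_eq R u u"
| word_eq_sym: "word_eq R u v \<Longrightarrow> word_eq R v u"
| word_eq_trans: "word_eq R u v \<Longrightarrow> word_eq R v w \<Longrightarrow> word_eq R u w"
| word_eq_cancel: "word_eq R (u @ [(x, s), (x, \<not> s)] @ v) (u @ v)"
| word_eq_rel: "(l, r) \<in> R \<Longrightarrow> word_eq R (u @ l @ v) (u @ r @ v)"

definition presented_group :: "('g word \<times> 'g word) set \<Rightarrow> 'g word set monoid" where
  "presented_group R =
    \<lparr>carrier = UNIV // {(u, v). word_eq R u v},
     monoid.mult = (\<lambda>A B. {w. \<exists>u\<in>A. \<exists>v\<in>B. word_eq R (u @ v) w}),
     one = {w. word_eq R [] w}\<rparr>"

lemma word_eq_append_left: "word_eq R u v \<Longrightarrow> word_eq R (w @ u) (w @ v)"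
proof (induction rule: word_eq.induct)
  case (word_eq_cancel u x s v)
  show ?case using word_eq.word_eq_cancel[of R "w @ u" x s v] by simp
next
  case (word_eq_rel l r u v)
  then show ?case using word_eq.word_eq_rel[of l r R "w @ u" v] by simp
qed (auto intro: word_eq.intros)

lemma word_eq_append_right: "word_eq R u v \<Longrightarrow> word_eq R (u @ w) (v @ w)"
proof (induction rule: word_eq.induct)
  case (word_eq_cancel u x s v)
  show ?case using word_eq.word_eq_cancel[of R u x s "v @ w"] by simp
next
  case (word_eq_rel l r u v)
  then show ?case using word_eq.word_eq_rel[of l r R u "v @ w"] by simp
qed (auto intro: word_eq.intros)

lemma word_eq_append: "word_eq R u u' \<Longrightarrow> word_eq R v v' \<Longrightarrow> word_eq R (u @ v) (u' @ v')"
  by (meson word_eq_append_left word_eq_append_right word_eq_trans)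

definition word_inv :: "'g word \<Rightarrow> 'g word" where
  "word_inv w = rev (map (\<lambda>(x, s). (x, \<not> s)) w)"

lemma word_eq_inv_left: "word_eq R (word_inv w @ w) []"
proof (induction w)
  case Nil
  show ?case by (simp add: word_inv_def word_eq_refl)
next
  case (Cons y w)
  obtain x s where y: "y = (x, s)" by fastforce
  have "word_eq R (word_inv w @ [(x, \<not> s), (x, \<not> \<not> s)] @ w) (word_inv w @ w)"
    by (rule word_eq_cancel)
  then show ?case
    using Cons word_eq_trans by (fastforce simp: y word_inv_def)
qed

lemma carrier_presented_group:
  "carrier (presented_group R) = range (\<lambda>u. {w. word_eq R u w})"
  by (auto simp: presented_group_def quotient_def)

lemma mult_presented_group:
  "{w. word_eq R u w} \<otimes>\<^bsub>presented_group R\<^esub> {w. word_eq R v w} = {w. word_eq R (u @ v) w}"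
  unfolding presented_group_def
  by (auto intro: word_eq_refl) (meson word_eq_append word_eq_trans)

lemma one_presented_group: "\<one>\<^bsub>presented_group R\<^esub> = {w. word_eq R [] w}"
  by (simp add: presented_group_def)

lemma word_class_eq_iff: "{w. word_eq R u w} = {w. word_eq R v w} \<longleftrightarrow> word_eq R u v"
  by (auto intro: word_eq_refl) (meson word_eq_refl word_eq_sym word_eq_trans mem_Collect_eq)+

lemma group_presented_group: "group (presented_group R)"
proof (rule groupI)
  fix x assume "x \<in> carrier (presented_group R)"
  then obtain u where u: "x = {w. word_eq R u w}" by (auto simp: carrier_presented_group)
  show "\<exists>y\<in>carrier (presented_group R). y \<otimes>\<^bsub>presented_group R\<^esub> x = \<one>\<^bsub>presented_group R\<^esub>"
    using word_eq_inv_left[of R u]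
    by (intro bexI[of _ "{w. word_eq R (word_inv u) w}"])
      (auto simp: u mult_presented_group one_presented_group carrier_presented_group
        word_class_eq_iff)
qed (auto simp: carrier_presented_group mult_presented_group one_presented_group)

section \<open>The fundamental groups\<close>

datatype gen_B1 = Gen_a | Gen_b | Gen_c

definition pi1_B1 :: "gen_B1 word set monoid" where
  "pi1_B1 = presented_group
    {(gen Gen_c @ gen Gen_a @ gen_inv Gen_c @ gen_inv Gen_a, gen Gen_c @ gen Gen_b @ gen_inv Gen_c @ gen_inv Gen_b),
     (gen Gen_c @ gen Gen_b @ gen_inv Gen_c @ gen_inv Gen_b, []),
     (gen Gen_a @ gen Gen_b @ gen_inv Gen_a @ gen Gen_b, [])}"

datatype gen_B2 = Gen_alpha | Gen_beta | Gen_gamma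

definition pi1_B2 :: "gen_B2 word set monoid" where
  "pi1_B2 = presented_group
    {(gen Gen_gamma @ gen Gen_beta @ gen_inv Gen_gamma,
        gen Gen_alpha @ gen Gen_gamma @ gen_inv Gen_alpha @ gen_inv Gen_gamma),
     (gen Gen_alpha @ gen Gen_gamma @ gen_inv Gen_alpha @ gen_inv Gen_gamma, gen Gen_beta),
     (gen Gen_alpha @ gen Gen_beta @ gen_inv Gen_alpha, gen_inv Gen_beta)}"

definition Z3 :: "(int \<times> int \<times> int) monoid" where
  "Z3 = integer_group \<times>\<times> (integer_group \<times>\<times> integer_group)"

section \<open>Conjugacy classes of subgroups\<close>

text \<open>For \<open>n = 0\<close> the cardinality below would also admit subgroups of infinite index;
  the definitions are used for positive \<open>n\<close> only.\<close>

definition subgroup_classes ::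
    "('h, 'p) monoid_scheme \<Rightarrow> ('g, 'q) monoid_scheme \<Rightarrow> nat \<Rightarrow> 'g set set set" where
  "subgroup_classes H G n =
    {K. subgroup K G \<and> card (rcosets\<^bsub>G\<^esub> K) = n \<and> G\<lparr>carrier := K\<rparr> \<cong> H} //
    {(K, L). \<exists>g\<in>carrier G. L = g <#\<^bsub>G\<^esub> K #>\<^bsub>G\<^esub> inv\<^bsub>G\<^esub> g}"

definition c_classes :: "('h, 'p) monoid_scheme \<Rightarrow> ('g, 'q) monoid_scheme \<Rightarrow> nat \<Rightarrow> nat" where
  "c_classes H G n = card (subgroup_classes H G n)"

section \<open>The flat manifolds as quotients of Euclidean space\<close>

type_synonym E3 = "real \<times> real \<times> real"

definition orbit_of :: "(E3 \<Rightarrow> E3) set \<Rightarrow> E3 \<Rightarrow> E3 set" where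
  "orbit_of \<Gamma> v = (\<lambda>g. g v) ` \<Gamma>"

definition orbit_space :: "(E3 \<Rightarrow> E3) set \<Rightarrow> E3 set topology" where
  "orbit_space \<Gamma> = topology (\<lambda>U. U \<subseteq> range (orbit_of \<Gamma>) \<and> open (orbit_of \<Gamma> -` U))"

lemma openin_orbit_space:
  "openin (orbit_space \<Gamma>) U \<longleftrightarrow> U \<subseteq> range (orbit_of \<Gamma>) \<and> open (orbit_of \<Gamma> -` U)"
proof -
  have "istopology (\<lambda>U. U \<subseteq> range (orbit_of \<Gamma>) \<and> open (orbit_of \<Gamma> -` U))"
    unfolding istopology_def by (auto simp: vimage_Union)
  then show ?thesis unfolding orbit_space_def by (simp add: topology_inverse')
qed

lemma topspace_orbit_space: "topspace (orbit_space \<Gamma>) = range (orbit_of \<Gamma>)"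
proof
  have "orbit_of \<Gamma> -` range (orbit_of \<Gamma>) = UNIV" by auto
  then have "openin (orbit_space \<Gamma>) (range (orbit_of \<Gamma>))"
    by (simp add: openin_orbit_space)
  then show "range (orbit_of \<Gamma>) \<subseteq> topspace (orbit_space \<Gamma>)"
    by (rule openin_subset)
  show "topspace (orbit_space \<Gamma>) \<subseteq> range (orbit_of \<Gamma>)"
    using openin_topspace openin_orbit_space by blast
qed

lemma quotient_map_orbit_space: "quotient_map euclidean (orbit_space \<Gamma>) (orbit_of \<Gamma>)"
  unfolding quotient_map_def
  by (auto simp: topspace_orbit_space openin_orbit_space vimage_def)

text \<open>The generators below are isometries of Euclidean 3-space, and each of the groups they generate
  acts freely and properly discontinuously with compact quotient, so it is the
  fundamental group of its orbit space. The relations of the presentations above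
  are verified in the lemmas below.\<close>

definition G1 :: "E3 set topology" where
  "G1 = orbit_space (generate (BijGroup UNIV)
    {\<lambda>(x, y, z). (x + 1, y, z), \<lambda>(x, y, z). (x, y + 1, z), \<lambda>(x, y, z). (x, y, z + 1)})"

definition B1_a :: "E3 \<Rightarrow> E3" where "B1_a = (\<lambda>(x, y, z). (x + 1, - y, z))"
definition B1_b :: "E3 \<Rightarrow> E3" where "B1_b = (\<lambda>(x, y, z). (x, y + 1, z))"
definition B1_c :: "E3 \<Rightarrow> E3" where "B1_c = (\<lambda>(x, y, z). (x, y, z + 1))"

definition B1 :: "E3 set topology" where
  "B1 = orbit_space (generate (BijGroup UNIV) {B1_a, B1_b, B1_c})"

definition B2_alpha :: "E3 \<Rightarrow> E3" where "B2_alpha = (\<lambda>(x, y, z). (x + 1, - y, z))"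
definition B2_beta :: "E3 \<Rightarrow> E3" where "B2_beta = (\<lambda>(x, y, z). (x, y + 1, z))"
definition B2_gamma :: "E3 \<Rightarrow> E3" where "B2_gamma = (\<lambda>(x, y, z). (x, y - 1 / 2, z + 1))"

definition B2 :: "E3 set topology" where
  "B2 = orbit_space (generate (BijGroup UNIV) {B2_alpha, B2_beta, B2_gamma})"

lemma B1_relations:
  "B1_c \<circ> B1_a = B1_a \<circ> B1_c" "B1_c \<circ> B1_b = B1_b \<circ> B1_c" "B1_a \<circ> B1_b = inv_into UNIV B1_b \<circ> B1_a"
proof -
  have "inv_into UNIV B1_b = (\<lambda>(x, y, z). (x, y - 1, z))"
    by (rule inv_equality) (auto simp: B1_b_def)
  then show "B1_a \<circ> B1_b = inv_into UNIV B1_b \<circ> B1_a"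
    by (auto simp: B1_a_def B1_b_def fun_eq_iff)
qed (auto simp: B1_a_def B1_b_def B1_c_def fun_eq_iff)

lemma B2_relations:
  "B2_gamma \<circ> B2_beta = B2_beta \<circ> B2_gamma"
  "B2_alpha \<circ> B2_gamma = B2_beta \<circ> B2_gamma \<circ> B2_alpha"
  "B2_alpha \<circ> B2_beta = inv_into UNIV B2_beta \<circ> B2_alpha"
proof -
  have "inv_into UNIV B2_beta = (\<lambda>(x, y, z). (x, y - 1, z))"
    by (rule inv_equality) (auto simp: B2_beta_def)
  then show "B2_alpha \<circ> B2_beta = inv_into UNIV B2_beta \<circ> B2_alpha"
    by (auto simp: B2_alpha_def B2_beta_def fun_eq_iff)
qed (auto simp: B2_alpha_def B2_beta_def B2_gamma_def fun_eq_iff)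

lemma isometries:
  "dist (B1_a v) (B1_a w) = dist v w" "dist (B1_b v) (B1_b w) = dist v w"
  "dist (B1_c v) (B1_c w) = dist v w" "dist (B2_alpha v) (B2_alpha w) = dist v w"
  "dist (B2_beta v) (B2_beta w) = dist v w" "dist (B2_gamma v) (B2_gamma w) = dist v w"
proof -
  have "(- a - - b)\<^sup>2 = (a - b)\<^sup>2" for a b :: real
    by (simp add: power2_eq_square algebra_simps)
  then show "dist (B1_a v) (B1_a w) = dist v w" "dist (B2_alpha v) (B2_alpha w) = dist v w"
    by (cases v; cases w; simp add: B1_a_def B2_alpha_def dist_prod_def dist_real_def
        del: minus_diff_minus diff_minus_eq_add)+
qed (auto simp: B1_b_def B1_c_def B2_beta_def B2_gamma_def
      dist_prod_def dist_real_def split: prod.splits)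

section \<open>Coverings\<close>

definition covering_map :: "'a topology \<Rightarrow> 'b topology \<Rightarrow> ('a \<Rightarrow> 'b) \<Rightarrow> bool" where
  "covering_map N M p \<longleftrightarrow>
    continuous_map N M p \<and> p ` topspace N = topspace M \<and>
    (\<forall>y\<in>topspace M. \<exists>T. y \<in> T \<and> openin M T \<and>
      (\<exists>V. \<Union>V = {x \<in> topspace N. p x \<in> T} \<and>
           (\<forall>u\<in>V. openin N u) \<and> pairwise disjnt V \<and>
           (\<forall>u\<in>V. homeomorphic_map (subtopology N u) (subtopology M T) p)))"

lemma covering_map_top_of_set:
  "covering_map (top_of_set N) (top_of_set M) p \<longleftrightarrow> covering_space N p M"
proof -
  have **: "homeomorphic_map (top_of_set u) (top_of_set T) p \<longleftrightarrow> (\<exists>q. homeomorphism u T p q)" for u T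
  proof -
    have "homeomorphic_maps (top_of_set u) (top_of_set T) p q \<longleftrightarrow> homeomorphism u T p q" for q
    proof
      assume "homeomorphic_maps (top_of_set u) (top_of_set T) p q"
      then have "continuous_on u p" "continuous_on T q" "p ` u \<subseteq> T" "q ` T \<subseteq> u"
          "\<forall>x\<in>u. q (p x) = x" "\<forall>y\<in>T. p (q y) = y"
        by (auto simp: homeomorphic_maps_def)
      then show "homeomorphism u T p q"
        by (intro homeomorphismI) auto
    next
      assume "homeomorphism u T p q"
      then show "homeomorphic_maps (top_of_set u) (top_of_set T) p q"
        by (auto simp: homeomorphic_maps_def homeomorphism_def)
    qed
    then show ?thesis by (simp add: homeomorphic_map_maps)
  qed
  have *: "homeomorphic_map (subtopology (top_of_set N) u) (subtopology (top_of_set M) T) p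
      \<longleftrightarrow> (\<exists>q. homeomorphism u T p q)"
    if "openin (top_of_set N) u" "openin (top_of_set M) T" for u T
    using openin_imp_subset[OF that(1)] openin_imp_subset[OF that(2)]
    by (simp add: ** subtopology_subtopology Int_absorb1)
  have pre: "{x \<in> N. p x \<in> T} = N \<inter> p -` T" for T by auto
  have sheets: "(\<exists>V. \<Union>V = N \<inter> p -` T \<and> (\<forall>u\<in>V. openin (top_of_set N) u) \<and> pairwise disjnt V \<and>
          (\<forall>u\<in>V. homeomorphic_map (subtopology (top_of_set N) u) (subtopology (top_of_set M) T) p))
      \<longleftrightarrow> (\<exists>V. \<Union>V = N \<inter> p -` T \<and> (\<forall>u\<in>V. openin (top_of_set N) u) \<and> pairwise disjnt V \<and>
          (\<forall>u\<in>V. \<exists>q. homeomorphism u T p q))"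
    if "openin (top_of_set M) T" for T
    by (metis (no_types, lifting) * that)
  have "continuous_map (top_of_set N) (top_of_set M) p \<and> p ` N = M
      \<longleftrightarrow> continuous_on N p \<and> p ` N = M"
    by auto
  then show ?thesis
    unfolding covering_map_def covering_space_def topspace_euclidean_subtopology pre
    using sheets by (smt (verit))
qed

text \<open>The total space of a covering is required to be connected. A covering space of a
  manifold is automatically a manifold, so no further condition is imposed on it.\<close>

definition nfold_covering :: "nat \<Rightarrow> 'a topology \<Rightarrow> 'b topology \<Rightarrow> ('a \<Rightarrow> 'b) \<Rightarrow> bool" where
  "nfold_covering n N M p \<longleftrightarrow>
    connected_space N \<and> covering_map N M p \<and>
    (\<forall>y\<in>topspace M. finite {x \<in> topspace N. p x = y} \<and> card {x \<in> topspace N. p x = y} = n)"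

definition covering_equiv :: "'a topology \<times> ('a \<Rightarrow> 'b) \<Rightarrow> 'a topology \<times> ('a \<Rightarrow> 'b) \<Rightarrow> bool" where
  "covering_equiv = (\<lambda>(N, p) (N', p').
    \<exists>\<eta>. homeomorphic_map N N' \<eta> \<and> (\<forall>x\<in>topspace N. p x = p' (\<eta> x)))"

text \<open>Equivalence classes of \<open>n\<close>-fold coverings of \<open>M\<close> whose total space is homeomorphic to \<open>X\<close>.
  To form a set of classes, the points of the total spaces are taken from the type \<open>E3 set\<close>.
  This loses nothing: \<open>X\<close> is a space on that type, so every such covering, on whatever type,
  is equivalent to one whose total space is \<open>X\<close> itself.\<close>

definition covering_classes ::
    "nat \<Rightarrow> E3 set topology \<Rightarrow> E3 set topology \<Rightarrow> (E3 set topology \<times> (E3 set \<Rightarrow> E3 set)) set set" where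
  "covering_classes n M X =
    {(N, p). nfold_covering n N M p \<and> N homeomorphic_space X} // {(C, D). covering_equiv C D}"

section \<open>Sum of divisors\<close>

definition sigma1 :: "nat \<Rightarrow> nat" where
  "sigma1 m = (\<Sum>d | d dvd m. d)"

end

theory Submission
  imports Defs "HOL-Algebra.Generated_Groups"
begin

text \<open>Maps from Euclidean space lift uniquely through coverings, so the connected coverings of a
  quotient of Euclidean space by a free properly discontinuous group are the quotients by its
  subgroups, equivalent coverings correspond to conjugate subgroups, and homeomorphic quotients
  have isomorphic groups.

  The group of the second amphicosm is \<open>\<int> \<ltimes> \<int>\<^sup>2\<close>, the generator of \<open>\<int>\<close> acting by an involution
  \<open>\<sigma>\<close> of the lattice. A subgroup \<open>K\<close> of index \<open>n\<close> consists of its image \<open>A\<int>\<close> in \<open>\<int>\<close>, the lattice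
  \<open>L = K \<inter> \<int>\<^sup>2\<close> of index \<open>n / A\<close>, and a translation part \<open>t\<close> modulo \<open>L\<close> of a lift of \<open>A\<close>.
  If \<open>A\<close> is even, then \<open>K\<close> is free abelian and conjugation acts on the pairs \<open>(L, t)\<close> through the
  involution \<open>\<sigma>\<close>, whose orbits are counted by means of its fixed points. If \<open>A\<close> is odd, then \<open>L\<close> is
  invariant under \<open>\<sigma>\<close>, which is diagonal in a basis of \<open>L\<close> (then \<open>K\<close> belongs to the first
  amphicosm) or exchanges two basis vectors (then it belongs to the second one), and conjugation
  changes \<open>t\<close> by \<open>(\<sigma> - 1) \<int>\<^sup>2\<close>. The formulas follow by summing over the Hermite normal forms
  of \<open>L\<close>.\<close>

section \<open>Lifting maps through coverings\<close>

text \<open>In coordinates the involution is \<sigma> (b, c) = (c - b, c), so (1 - \<sigma>) (y, z)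
  = (2 y - z, 0) runs through the whole line c = 0. With \<open>d\<close> and \<open>e\<close> the
  diagonal entries of L, this lets conjugation remove the first coordinate of t when A is odd, while
  the second one survives modulo \<open>e\<close>: an admissible diagonal contributes
  \<open>e\<close> classes. When A is even, there are d * d * e pairs (L, t), and the orbit count
  for an involution gives the factor 1/2 in (i): the term l^2 m counts all subgroups, the other
  terms count the fixed ones. Two counts have to be reconciled, one of subgroups up to isomorphism
  and one of total spaces up to homeomorphism. They are tied together by explicit parametrisations:
  an injective homomorphism from a model group onto K, or onto a conjugate of K, is accompanied by
  an equivariant affine map of space, so group and quotient space are identified at once. That the
  three models differ is shown for the groups, and carried over to the spaces by lifting a
  homeomorphism of quotients to Euclidean space.\<close>

definition evenly_covered :: "'a topology \<Rightarrow> 'b topology \<Rightarrow> ('a \<Rightarrow> 'b) \<Rightarrow> 'b set \<Rightarrow> bool" where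
  "evenly_covered N M p T \<longleftrightarrow> openin M T \<and>
     (\<exists>V. \<Union>V = {x \<in> topspace N. p x \<in> T} \<and> (\<forall>u\<in>V. openin N u) \<and> pairwise disjnt V \<and>
           (\<forall>u\<in>V. homeomorphic_map (subtopology N u) (subtopology M T) p))"

lemma covering_map_iff_evenly_covered:
  "covering_map N M p \<longleftrightarrow> continuous_map N M p \<and> p ` topspace N = topspace M \<and>
     (\<forall>y\<in>topspace M. \<exists>T. y \<in> T \<and> evenly_covered N M p T)"
  unfolding covering_map_def evenly_covered_def by (rule refl)

lemma evenly_covered_sheet:
  assumes "evenly_covered N M p T" "x \<in> topspace N" "p x \<in> T"
  obtains u s where "openin N u" "x \<in> u" "homeomorphic_maps (subtopology N u) (subtopology M T) p s"
proof -
  obtain V where V: "\<Union>V = {x \<in> topspace N. p x \<in> T}" "\<forall>u\<in>V. openin N u"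
      "\<forall>u\<in>V. homeomorphic_map (subtopology N u) (subtopology M T) p"
    using assms(1) unfolding evenly_covered_def by auto
  have "x \<in> \<Union>V" using V(1) assms by simp
  then obtain u where u: "u \<in> V" "x \<in> u" by blast
  then obtain s where "homeomorphic_maps (subtopology N u) (subtopology M T) p s"
    using V(3) unfolding homeomorphic_map_maps by blast
  then show ?thesis using that u V(2) by blast
qed

text \<open>Over an evenly covered neighbourhood the values of \<open>f\<close> and \<open>g\<close>
  lie either in one sheet, where \<open>p\<close> is injective and equal projections force equal
  values, or in two disjoint sheets. Thus agreement and disagreement are both open conditions, and
  connectedness decides.\<close>

lemma covering_map_lift_unique:
  assumes cov: "covering_map N M p" and con: "connected_space Z"
    and f: "continuous_map Z N f" and g: "continuous_map Z N g"
    and eq: "\<And>z. z \<in> topspace Z \<Longrightarrow> p (f z) = p (g z)"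
    and z0: "z0 \<in> topspace Z" "f z0 = g z0" and z: "z \<in> topspace Z"
  shows "f z = g z"
proof -
  have fN: "f w \<in> topspace N" and gN: "g w \<in> topspace N" if "w \<in> topspace Z" for w
    using f g that by (auto simp: continuous_map_def)
  have *: "\<exists>W. openin Z W \<and> w \<in> W \<and> (\<forall>v\<in>W. (f v = g v) = (f w = g w))" if w: "w \<in> topspace Z" for w
  proof -
    have "p (f w) \<in> topspace M"
      using cov fN[OF w] by (auto simp: covering_map_def)
    then obtain T V where T: "p (f w) \<in> T" and V: "\<Union>V = {x \<in> topspace N. p x \<in> T}"
        "\<forall>u\<in>V. openin N u" "pairwise disjnt V"
        "\<forall>u\<in>V. homeomorphic_map (subtopology N u) (subtopology M T) p"
      using cov unfolding covering_map_def by meson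
    obtain u where u: "u \<in> V" "f w \<in> u" using V(1) T fN[OF w] by blast
    obtain u' where u': "u' \<in> V" "g w \<in> u'" using V(1) T gN[OF w] eq[OF w] by auto
    have inj: "inj_on p k" if "k \<in> V" for k
    proof -
      have "k \<subseteq> topspace N" using V(2) that openin_subset by auto
      then show ?thesis
        using V(4) that homeomorphic_imp_injective_map by (fastforce simp: Int_absorb1)
    qed
    define W where "W = {v \<in> topspace Z. f v \<in> u} \<inter> {v \<in> topspace Z. g v \<in> u'}"
    have "openin Z W" unfolding W_def
      using f g V(2) u(1) u'(1) by (auto intro!: openin_Int openin_continuous_map_preimage)
    moreover have "w \<in> W" using w u u' by (auto simp: W_def)
    moreover have "(f v = g v) = (f w = g w)" if v: "v \<in> W" for v
    proof (cases "u = u'")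
      case True
      then have "f w = g w" "f v = g v"
        using inj[OF u(1)] u u' v w eq by (auto simp: W_def inj_on_def)
      then show ?thesis by simp
    next
      case False
      then have "u \<inter> u' = {}" using V(3) u u' by (auto simp: pairwise_def disjnt_def)
      then show ?thesis using u u' v by (auto simp: W_def)
    qed
    ultimately show ?thesis by blast
  qed
  have **: "openin Z {w \<in> topspace Z. (f w = g w) = b}" for b
    unfolding openin_subopen[of Z "{w \<in> topspace Z. (f w = g w) = b}"]
  proof
    fix w assume "w \<in> {w \<in> topspace Z. (f w = g w) = b}"
    then obtain W where "openin Z W" "w \<in> W" "\<forall>v\<in>W. (f v = g v) = b"
      using *[of w] by auto
    then show "\<exists>T. openin Z T \<and> w \<in> T \<and> T \<subseteq> {w \<in> topspace Z. (f w = g w) = b}"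
      by (intro exI[of _ W]) (auto dest: openin_subset)
  qed
  let ?E = "\<lambda>b. {w \<in> topspace Z. (f w = g w) = b}"
  have sep: "topspace Z \<subseteq> ?E True \<union> ?E False" "?E True \<inter> ?E False = {}" "?E True \<noteq> {}"
    using z0 by auto
  have "?E False = {}"
  proof (rule ccontr)
    assume "?E False \<noteq> {}"
    with sep **[of True] **[of False] con show False
      unfolding connected_space_def by (metis (no_types))
  qed
  then show ?thesis using z by auto
qed

text \<open>A partial lift with its domain \<open>U\<close> as a parameter: a lift over the whole
  space is assembled from lifts over growing balls.\<close>

definition lifts_on ::
  "'v::topological_space set \<Rightarrow> 'a topology \<Rightarrow> ('a \<Rightarrow> 'b) \<Rightarrow> ('v \<Rightarrow> 'b) \<Rightarrow> ('v \<Rightarrow> 'a) \<Rightarrow> bool" where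
  "lifts_on U N p \<phi> f \<longleftrightarrow> continuous_map (top_of_set U) N f \<and> (\<forall>w\<in>U. p (f w) = \<phi> w)"

lemma lifts_on_continuous: "lifts_on U N p \<phi> f \<Longrightarrow> continuous_map (top_of_set U) N f"
  by (simp add: lifts_on_def)

lemma lifts_on_eq: "lifts_on U N p \<phi> f \<Longrightarrow> w \<in> U \<Longrightarrow> p (f w) = \<phi> w"
  by (simp add: lifts_on_def)

lemma lifts_on_UNIV_I:
  "continuous_map euclidean N f \<Longrightarrow> (\<And>w. p (f w) = \<phi> w) \<Longrightarrow> lifts_on UNIV N p \<phi> f"
  by (simp add: lifts_on_def)

lemma lifts_on_subset: "lifts_on U N p \<phi> f \<Longrightarrow> V \<subseteq> U \<Longrightarrow> lifts_on V N p \<phi> f"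
  unfolding lifts_on_def using continuous_map_from_subtopology_mono by blast

lemma lifts_on_unique:
  assumes "covering_map N M p" "connected U" "lifts_on U N p \<phi> f" "lifts_on U N p \<phi> g"
    "v \<in> U" "f v = g v" "w \<in> U"
  shows "f w = g w"
proof (rule covering_map_lift_unique[OF assms(1), where Z = "top_of_set U" and f = f and g = g])
  show "connected_space (top_of_set U)"
    using assms(2) connectedin_iff_connected[of U] unfolding connectedin_def by simp
  show "continuous_map (top_of_set U) N f" "continuous_map (top_of_set U) N g"
    using assms(3,4) by (simp_all add: lifts_on_def)
qed (use assms in \<open>simp_all add: lifts_on_def\<close>)

text \<open>The sheet through \<open>x\<close> has a continuous section \<open>s\<close>, and
  \<open>s \<circ> \<phi>\<close> is the lift.\<close>

lemma lifts_on_evenly_covered: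
  assumes "evenly_covered N M p T" "continuous_map (top_of_set U) M \<phi>" "\<phi> ` U \<subseteq> T"
    "v \<in> U" "x \<in> topspace N" "p x = \<phi> v"
  obtains f where "lifts_on U N p \<phi> f" "f v = x"
proof -
  obtain u s where u: "openin N u" "x \<in> u"
    and s: "homeomorphic_maps (subtopology N u) (subtopology M T) p s"
    using evenly_covered_sheet[OF assms(1), of x] assms by blast
  have T: "T \<subseteq> topspace M"
    using assms(1) by (simp add: evenly_covered_def openin_subset)
  have "continuous_map (top_of_set U) (subtopology M T) \<phi>"
    using assms by (auto simp: continuous_map_in_subtopology)
  moreover have "continuous_map (subtopology M T) N s"
    using s by (simp add: homeomorphic_maps_def continuous_map_in_subtopology)
  ultimately have "continuous_map (top_of_set U) N (s \<circ> \<phi>)"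
    by (rule continuous_map_compose)
  moreover have "p (s y) = y" if "y \<in> T" for y
    using s that T by (auto simp: homeomorphic_maps_def)
  moreover have "s (\<phi> v) = x"
    using s u assms by (force simp: homeomorphic_maps_def)
  ultimately show ?thesis
    using assms by (intro that[of "s \<circ> \<phi>"]) (auto simp: lifts_on_def)
qed

text \<open>The radius is the same at all points of \<open>U\<close>, so each ball carries a local
  lift and these can be glued. Convexity keeps the intersection of a ball with \<open>U\<close>
  connected, which makes the local lift agree with \<open>f\<close> there.\<close>

lemma lifts_on_extend:
  fixes \<phi> :: "'v::real_normed_vector \<Rightarrow> 'b"
  assumes cov: "covering_map N M p" and \<phi>: "continuous_map euclidean M \<phi>"
    and U: "convex U" and f: "lifts_on U N p \<phi> f"
    and ev: "\<And>v. v \<in> U \<Longrightarrow> \<exists>T. evenly_covered N M p T \<and> \<phi> ` ball v \<epsilon> \<subseteq> T"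
    and \<epsilon>: "\<epsilon> > 0"
  obtains g where "lifts_on (\<Union>v\<in>U. ball v \<epsilon>) N p \<phi> g" "\<And>v. v \<in> U \<Longrightarrow> g v = f v"
proof -
  have "\<exists>l. lifts_on (ball v \<epsilon>) N p \<phi> l \<and> l v = f v" if v: "v \<in> U" for v
  proof -
    obtain T where T: "evenly_covered N M p T" "\<phi> ` ball v \<epsilon> \<subseteq> T" using ev[OF v] by blast
    show ?thesis
      by (rule lifts_on_evenly_covered[OF T(1) _ T(2), of v "f v"])
        (use f \<epsilon> v continuous_map_from_subtopology[OF \<phi>] continuous_map_image_subset_topspace in
          \<open>fastforce simp: lifts_on_def\<close>)+
  qed
  then obtain l where l: "\<And>v. v \<in> U \<Longrightarrow> lifts_on (ball v \<epsilon>) N p \<phi> (l v)"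
      "\<And>v. v \<in> U \<Longrightarrow> l v v = f v" by metis
  have lf: "l v w = f w" if "v \<in> U" "w \<in> U" "w \<in> ball v \<epsilon>" for v w
    by (rule lifts_on_unique[OF cov, of "ball v \<epsilon> \<inter> U" \<phi> _ _ v])
      (use that \<epsilon> l U f in \<open>auto intro!: convex_connected convex_Int intro: lifts_on_subset\<close>)
  \<comment> \<open>If two balls meet, then the midpoint of their centres lies in both of them and in the
    convex set \<open>U\<close>, where both local lifts agree with \<open>f\<close>.\<close>
  have agree: "l v w = l v' w" if v: "v \<in> U" "v' \<in> U" and w: "w \<in> ball v \<epsilon>" "w \<in> ball v' \<epsilon>"
      for v v' w
  proof (rule lifts_on_unique[OF cov, of "ball v \<epsilon> \<inter> ball v' \<epsilon>" \<phi>])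
    let ?m = "midpoint v v'"
    have "dist v v' < 2 * \<epsilon>"
      using w dist_triangle[of v v' w] by (simp add: dist_commute)
    then have m: "?m \<in> ball v \<epsilon>" "?m \<in> ball v' \<epsilon>"
      by (auto simp: dist_midpoint)
    have "?m \<in> U" using U v by (meson convex_contains_segment midpoint_in_closed_segment subsetD)
    then show "l v ?m = l v' ?m" using lf v m by simp
    show "?m \<in> ball v \<epsilon> \<inter> ball v' \<epsilon>" using m by simp
  qed (use v w l in \<open>auto intro!: convex_connected convex_Int intro: lifts_on_subset\<close>)
  let ?X = "\<Union>v\<in>U. ball v \<epsilon>"
  have X: "topspace (top_of_set ?X) \<subseteq> (\<Union>v\<in>U. ball v \<epsilon>)" by simp
  have op: "openin (top_of_set ?X) (ball i \<epsilon>)" if "i \<in> U" for i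
    by (rule open_subset) (use that in auto)
  have cont: "continuous_map (subtopology (top_of_set ?X) (ball i \<epsilon>)) N (l i)" if "i \<in> U" for i
    using l(1)[OF that]
    by (auto simp: lifts_on_def subtopology_subtopology intro: continuous_map_from_subtopology_mono)
  have eq: "l i x = l j x"
    if "i \<in> U" "j \<in> U" "x \<in> topspace (top_of_set ?X) \<inter> ball i \<epsilon> \<inter> ball j \<epsilon>" for i j x
    using agree[OF that(1,2)] that(3) by blast
  obtain g where g: "continuous_map (top_of_set ?X) N g"
    "\<And>x i. \<lbrakk>i \<in> U; x \<in> topspace (top_of_set ?X) \<inter> ball i \<epsilon>\<rbrakk> \<Longrightarrow> g x = l i x"
    using pasting_lemma_exists[OF X op cont eq] by blast
  have gl: "g w = l v w" if "v \<in> U" "w \<in> ball v \<epsilon>" for v w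
    using g(2)[of v w] that by auto
  show ?thesis
  proof (rule that[of g])
    show "lifts_on ?X N p \<phi> g"
      unfolding lifts_on_def
    proof (intro conjI ballI g(1))
      fix w assume "w \<in> ?X"
      then obtain v where v: "v \<in> U" "w \<in> ball v \<epsilon>" by blast
      then show "p (g w) = \<phi> w" using gl[OF v] l(1)[OF v(1)] by (simp add: lifts_on_def)
    qed
    show "g v = f v" if "v \<in> U" for v
      using gl[of v v] l(2)[OF that] that \<epsilon> by simp
  qed
qed

text \<open>A Lebesgue number \<open>\<epsilon>\<close> of the compact ball lets the lift grow by
  \<open>\<epsilon>\<close> in radius at each step; the minimum with \<open>r\<close> keeps the
  centres where \<open>\<epsilon>\<close> is valid.\<close>

lemma lifts_on_ball:
  fixes \<phi> :: "'v::{real_normed_vector,heine_borel} \<Rightarrow> 'b"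
  assumes cov: "covering_map N M p" and \<phi>: "continuous_map euclidean M \<phi>"
    and x: "x \<in> topspace N" "p x = \<phi> v" and r: "r > 0"
  obtains f where "lifts_on (ball v r) N p \<phi> f" "f v = x"
proof -
  let ?G = "{\<phi> -` T | T. evenly_covered N M p T}"
  have "cball v r \<subseteq> \<Union>?G"
  proof
    fix w
    have "\<phi> w \<in> topspace M" using continuous_map_image_subset_topspace[OF \<phi>] by auto
    then show "w \<in> \<Union>?G" using cov unfolding covering_map_iff_evenly_covered by blast
  qed
  moreover have "open G" if "G \<in> ?G" for G
    using that \<phi> by (auto simp: evenly_covered_def continuous_map_def vimage_def)
  ultimately obtain \<epsilon> where \<epsilon>: "\<epsilon> > 0" "\<And>w. w \<in> cball v r \<Longrightarrow> \<exists>G\<in>?G. ball w \<epsilon> \<subseteq> G"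
    by (rule Heine_Borel_lemma[OF compact_cball, of v r ?G]) auto
  have ev: "\<exists>T. evenly_covered N M p T \<and> \<phi> ` ball w \<epsilon> \<subseteq> T" if "w \<in> cball v r" for w
    using \<epsilon>(2)[OF that] by blast
  have "\<exists>f. lifts_on (ball v (min r (real (Suc k) * \<epsilon>))) N p \<phi> f \<and> f v = x" for k
  proof (induction k)
    case 0
    have "v \<in> cball v r" using r by simp
    then obtain T where T: "evenly_covered N M p T" "\<phi> ` ball v \<epsilon> \<subseteq> T" using ev by blast
    obtain f where f: "lifts_on (ball v \<epsilon>) N p \<phi> f" "f v = x"
      by (rule lifts_on_evenly_covered[OF T(1) continuous_map_from_subtopology[OF \<phi>] T(2) _ x])
        (use \<epsilon>(1) in auto)
    have "ball v (min r (real (Suc 0) * \<epsilon>)) \<subseteq> ball v \<epsilon>" by auto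
    from lifts_on_subset[OF f(1) this] f(2) show ?case by blast
  next
    case (Suc k)
    let ?U = "ball v (min r (real (Suc k) * \<epsilon>))"
    obtain f where f: "lifts_on ?U N p \<phi> f" "f v = x" using Suc by blast
    have "\<exists>T. evenly_covered N M p T \<and> \<phi> ` ball w \<epsilon> \<subseteq> T" if "w \<in> ?U" for w
      by (rule ev) (use that in auto)
    then obtain g where g: "lifts_on (\<Union>w\<in>?U. ball w \<epsilon>) N p \<phi> g" "\<And>w. w \<in> ?U \<Longrightarrow> g w = f w"
      using lifts_on_extend[OF cov \<phi> convex_ball f(1) _ \<epsilon>(1)] by blast
    have "ball v (min r (real (Suc (Suc k)) * \<epsilon>)) \<subseteq> (\<Union>w\<in>?U. ball w \<epsilon>)"
    proof
      fix w assume w: "w \<in> ball v (min r (real (Suc (Suc k)) * \<epsilon>))"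
      \<comment> \<open>Shrinking \<open>w\<close> towards \<open>v\<close> by the factor (k + 1) /
        (k + 2) brings it into the previous ball and moves it by less than
        \<open>\<epsilon>\<close>.\<close>
      define t :: real where "t = real (Suc k) / real (Suc (Suc k))"
      let ?w = "v + t *\<^sub>R (w - v)"
      have t: "0 < t" "t < 1" "t * real (Suc (Suc k)) = real (Suc k)"
          "1 - t = 1 / real (Suc (Suc k))"
        by (auto simp: t_def field_simps)
      have d: "dist v w < r" "dist v w < real (Suc (Suc k)) * \<epsilon>" using w by auto
      have dv: "dist v ?w = t * dist v w"
        using t(1) by (simp add: dist_norm norm_minus_commute)
      have "?w - w = (1 - t) *\<^sub>R (v - w)" by (simp add: algebra_simps)
      then have dw: "dist ?w w = (1 - t) * dist v w"
        using t(2) by (simp add: dist_norm)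
      have "t * dist v w \<le> 1 * dist v w" using t by (intro mult_right_mono) auto
      then have "t * dist v w < r" using d by simp
      moreover have "t * dist v w < t * (real (Suc (Suc k)) * \<epsilon>)"
        using t d by (intro mult_strict_left_mono) auto
      then have "t * dist v w < real (Suc k) * \<epsilon>" by (simp only: t(3) flip: mult.assoc)
      moreover have "(1 - t) * dist v w < (1 - t) * (real (Suc (Suc k)) * \<epsilon>)"
        using t d by (intro mult_strict_left_mono) auto
      then have "(1 - t) * dist v w < \<epsilon>" by (simp add: t(4) del: of_nat_Suc)
      ultimately have "?w \<in> ?U" "w \<in> ball ?w \<epsilon>"
        unfolding mem_ball dv dw by auto
      then show "w \<in> (\<Union>w\<in>?U. ball w \<epsilon>)" by blast
    qed
    from lifts_on_subset[OF g(1) this]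
    have "lifts_on (ball v (min r (real (Suc (Suc k)) * \<epsilon>))) N p \<phi> g" .
    moreover have "v \<in> ?U" using \<epsilon>(1) r by auto
    ultimately show ?case using g(2) f(2) by auto
  qed
  then obtain l where l: "\<And>k. lifts_on (ball v (min r (real (Suc k) * \<epsilon>))) N p \<phi> (l k)"
      "\<And>k. l k v = x"
    by metis
  obtain k where "r < real k * \<epsilon>"
    using reals_Archimedean3[OF \<epsilon>(1)] by blast
  then have "min r (real (Suc k) * \<epsilon>) = r"
    using \<epsilon>(1) by (simp add: algebra_simps)
  then show ?thesis
    using that[of "l k"] l[of k] by simp
qed

text \<open>All the lifts over balls take the value \<open>x\<close> at the common centre
  \<open>v\<close>, so they agree on overlaps and glue to one map.\<close>

lemma lift_exists:
  fixes \<phi> :: "'v::{real_normed_vector,heine_borel} \<Rightarrow> 'b"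
  assumes cov: "covering_map N M p" and \<phi>: "continuous_map euclidean M \<phi>"
    and x: "x \<in> topspace N" "p x = \<phi> v"
  obtains f where "lifts_on UNIV N p \<phi> f" "f v = x"
proof -
  have "\<exists>f. lifts_on (ball v (real (Suc n))) N p \<phi> f \<and> f v = x" for n
    using lifts_on_ball[OF assms, of "real (Suc n)"] by auto
  then obtain l where l: "\<And>n. lifts_on (ball v (real (Suc n))) N p \<phi> (l n)" "\<And>n. l n v = x" by metis
  obtain g where g: "continuous_map euclidean N g"
    "\<And>w n. \<lbrakk>n \<in> UNIV; w \<in> topspace euclidean \<inter> ball v (real (Suc n))\<rbrakk> \<Longrightarrow> g w = l n w"
  proof (rule pasting_lemma_exists[where X = euclidean and I = UNIV
      and T = "\<lambda>n. ball v (real (Suc n))" and f = l and Y = N])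
    show "topspace euclidean \<subseteq> (\<Union>n. ball v (real (Suc n)))"
    proof
      fix w
      obtain n where "dist v w < real n" using reals_Archimedean2 by blast
      then have "w \<in> ball v (real (Suc n))" by simp
      then show "w \<in> (\<Union>n. ball v (real (Suc n)))" by blast
    qed
    show "l i w = l j w" if w: "w \<in> topspace euclidean \<inter> ball v (real (Suc i)) \<inter> ball v (real
        (Suc j))" for i j w
      by (rule lifts_on_unique[OF cov, of "ball v (real (Suc i)) \<inter> ball v (real (Suc j))" \<phi> _ _ v])
        (use w l in \<open>auto intro!: convex_connected convex_Int intro: lifts_on_subset
          simp del: of_nat_Suc\<close>)
  qed (use l in \<open>auto simp: lifts_on_def\<close>)
  have eq: "g w = l n w" if "w \<in> ball v (real (Suc n))" for w n using g(2) that by simp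
  have "p (g w) = \<phi> w" for w
  proof -
    obtain n where "dist v w < real n" using reals_Archimedean2 by blast
    then have "w \<in> ball v (real (Suc n))" by simp
    then show ?thesis using eq l(1) by (simp add: lifts_on_def)
  qed
  moreover have "g v = x" using eq[of v 1] l(2) by simp
  ultimately show ?thesis using g(1) by (intro that[of g]) (auto simp: lifts_on_def)
qed

section \<open>Free properly discontinuous actions\<close>

lemma quotient_maps_same_fibres:
  assumes f: "quotient_map X Y f" and g: "quotient_map X Z g"
    and fib: "\<And>x y. \<lbrakk>x \<in> topspace X; y \<in> topspace X\<rbrakk> \<Longrightarrow> f x = f y \<longleftrightarrow> g x = g y"
  obtains \<eta> where "homeomorphic_map Y Z \<eta>" "\<And>x. x \<in> topspace X \<Longrightarrow> \<eta> (f x) = g x"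
proof -
  obtain h where h: "continuous_map Y Z h" "\<And>x. x \<in> topspace X \<Longrightarrow> h (f x) = g x"
    using quotient_map_lift_exists[OF f quotient_imp_continuous_map[OF g]] fib by metis
  obtain k where k: "continuous_map Z Y k" "\<And>x. x \<in> topspace X \<Longrightarrow> k (g x) = f x"
    using quotient_map_lift_exists[OF g quotient_imp_continuous_map[OF f]] fib by metis
  have "homeomorphic_maps Y Z h k"
    unfolding homeomorphic_maps_def
    using h k quotient_imp_surjective_map[OF f] quotient_imp_surjective_map[OF g] by force
  then show ?thesis using that h(2) by (auto simp: homeomorphic_map_maps)
qed

section \<open>The conjugacy relation on subgroups\<close>

definition conj_rel :: "('g, 'm) monoid_scheme \<Rightarrow> ('g set \<times> 'g set) set" where
  "conj_rel G = {(K, L). \<exists>g\<in>carrier G. L = g <#\<^bsub>G\<^esub> K #>\<^bsub>G\<^esub> inv\<^bsub>G\<^esub> g}"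

context group
begin

lemma conj_set: "g <# K #> inv g = {g \<otimes> k \<otimes> inv g | k. k \<in> K}"
  by (auto simp: l_coset_def r_coset_def)

lemma conj_rel_iff:
  "(K, L) \<in> conj_rel G \<longleftrightarrow> (\<exists>g\<in>carrier G. L = (\<lambda>k. g \<otimes> k \<otimes> inv g) ` K)"
  by (auto simp: conj_rel_def conj_set setcompr_eq_image)

text \<open>The group laws that make conjugation reflexive, symmetric and transitive are available
  for subsets of the carrier, so equality of classes is characterised there.\<close>

lemma conj_rel_class_eq_iff:
  assumes "K \<subseteq> carrier G" "L \<subseteq> carrier G"
  shows "conj_rel G `` {K} = conj_rel G `` {L} \<longleftrightarrow> (K, L) \<in> conj_rel G"
proof -
  have refl: "(K, K) \<in> conj_rel G" if "K \<subseteq> carrier G" for K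
    unfolding conj_rel_iff
    by (rule bexI[of _ \<one>]) (use that in \<open>auto simp: image_iff subset_eq\<close>)
  have sym: "(L, K) \<in> conj_rel G" if K: "K \<subseteq> carrier G" and KL: "(K, L) \<in> conj_rel G" for K L
  proof -
    obtain g where g: "g \<in> carrier G" "L = (\<lambda>k. g \<otimes> k \<otimes> inv g) ` K"
      using KL unfolding conj_rel_iff by blast
    have "inv g \<otimes> (g \<otimes> k \<otimes> inv g) \<otimes> inv (inv g) = k" if "k \<in> K" for k
    proof -
      have "k \<in> carrier G" using K that by blast
      then show ?thesis using g(1) by (simp add: m_assoc) (simp flip: m_assoc)
    qed
    then have "K = (\<lambda>k. inv g \<otimes> k \<otimes> inv (inv g)) ` L"
      unfolding g(2) image_image by simp
    then show ?thesis unfolding conj_rel_iff using g(1) by blast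
  qed
  have trans: "(K, M) \<in> conj_rel G"
    if K: "K \<subseteq> carrier G" and KL: "(K, L) \<in> conj_rel G" and LM: "(L, M) \<in> conj_rel G" for K L M
  proof -
    obtain g h where g: "g \<in> carrier G" "L = (\<lambda>k. g \<otimes> k \<otimes> inv g) ` K"
      and h: "h \<in> carrier G" "M = (\<lambda>k. h \<otimes> k \<otimes> inv h) ` L"
      using KL LM unfolding conj_rel_iff by blast
    have "h \<otimes> (g \<otimes> k \<otimes> inv g) \<otimes> inv h = (h \<otimes> g) \<otimes> k \<otimes> inv (h \<otimes> g)" if "k \<in> K" for k
    proof -
      have "k \<in> carrier G" using K that by blast
      then show ?thesis using g(1) h(1) by (simp add: m_assoc inv_mult_group)
    qed
    then have "M = (\<lambda>k. (h \<otimes> g) \<otimes> k \<otimes> inv (h \<otimes> g)) ` K"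
      unfolding h(2) g(2) image_image by (intro image_cong) simp_all
    then show ?thesis unfolding conj_rel_iff using g(1) h(1) by blast
  qed
  show ?thesis
  proof
    assume "conj_rel G `` {K} = conj_rel G `` {L}"
    then show "(K, L) \<in> conj_rel G" using refl[OF assms(2)] by blast
  next
    assume KL: "(K, L) \<in> conj_rel G"
    show "conj_rel G `` {K} = conj_rel G `` {L}"
      using trans[OF assms(1) KL] trans[OF assms(2) sym[OF assms(1) KL]] by blast
  qed
qed

end

text \<open>\<open>act_discontinuous\<close> gives every point a ball that each element except the
  identity moves off itself. This contains freeness, and the images of such balls are the evenly
  covered sets of the quotients.\<close>

locale free_action = group G for G :: "('g, 'm) monoid_scheme" (structure) +
  fixes act :: "'g \<Rightarrow> E3 \<Rightarrow> E3"
  assumes act_mult: "\<lbrakk>g \<in> carrier G; h \<in> carrier G\<rbrakk> \<Longrightarrow> act (g \<otimes> h) v = act g (act h v)"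
    and act_one: "act \<one> v = v"
    and act_continuous: "g \<in> carrier G \<Longrightarrow> continuous_on UNIV (act g)"
    and act_discontinuous:
      "\<exists>\<epsilon>>0. \<forall>g\<in>carrier G. \<forall>w\<in>ball v \<epsilon>. act g w \<in> ball v \<epsilon> \<longrightarrow> g = \<one>"
begin

abbreviation orb :: "'g set \<Rightarrow> E3 \<Rightarrow> E3 set" where "orb K \<equiv> orbit_of (act ` K)"

abbreviation quot :: "'g set \<Rightarrow> E3 set topology" where "quot K \<equiv> orbit_space (act ` K)"

text \<open>No subgroup occurs in the formula: filling up a \<open>K\<close>-orbit to an orbit of
  the whole group is the same operation for every \<open>K\<close>, so one map serves as the
  projection of all intermediate quotients.\<close>

definition proj :: "E3 set \<Rightarrow> E3 set" where "proj A = (\<Union>g\<in>carrier G. act g ` A)"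

lemma act_inv: "g \<in> carrier G \<Longrightarrow> act (inv g) (act g v) = v"
    "g \<in> carrier G \<Longrightarrow> act g (act (inv g) v) = v"
  by (simp_all flip: act_mult add: act_one)

lemma act_free: "\<lbrakk>g \<in> carrier G; act g v = v\<rbrakk> \<Longrightarrow> g = \<one>"
  using act_discontinuous[of v] centre_in_ball by metis

lemma act_inj: "\<lbrakk>g \<in> carrier G; h \<in> carrier G; act g v = act h v\<rbrakk> \<Longrightarrow> g = h"
  using act_free[of "inv h \<otimes> g" v] act_inv[of h v]
  by (metis act_mult inv_closed inv_equality inv_inv m_closed)

lemma act_image_vimage:
  assumes "g \<in> carrier G"
  shows "act g ` W = act (inv g) -` W"
proof (intro equalityI subsetI)
  fix v assume "v \<in> act (inv g) -` W"
  then show "v \<in> act g ` W" using act_inv(2)[OF assms, of v] by (metis imageI vimageD)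
qed (use act_inv(1)[OF assms] in auto)

lemma open_act_image: "g \<in> carrier G \<Longrightarrow> open W \<Longrightarrow> open (act g ` W)"
  using act_continuous[of "inv g"] by (simp add: act_image_vimage continuous_on_open_vimage)

lemma orb_altdef: "orb K v = {act k v | k. k \<in> K}"
  by (auto simp: orbit_of_def)

lemma orb_eq_iff:
  assumes K: "subgroup K G"
  shows "orb K v = orb K w \<longleftrightarrow> (\<exists>k\<in>K. w = act k v)"
proof
  assume "orb K v = orb K w"
  moreover have "w \<in> orb K w"
    using subgroup.one_closed[OF K] act_one[of w] by (force simp: orb_altdef)
  ultimately show "\<exists>k\<in>K. w = act k v" by (auto simp: orb_altdef)
next
  assume "\<exists>k\<in>K. w = act k v"
  then obtain k where k: "k \<in> K" "w = act k v" by blast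
  have C: "h \<in> carrier G" if "h \<in> K" for h using subgroup.mem_carrier[OF K that] .
  have 1: "act h w = act (h \<otimes> k) v" "act h v = act (h \<otimes> inv k) w" if "h \<in> K" for h
    using that k C by (simp_all add: act_mult act_inv)
  have 2: "h \<otimes> k \<in> K" "h \<otimes> inv k \<in> K" if "h \<in> K" for h
    using that k subgroup.m_closed[OF K] subgroup.m_inv_closed[OF K] by auto
  show "orb K v = orb K w"
    unfolding orb_altdef using 1 2 by blast
qed

lemma orb_carrier_act [simp]: "g \<in> carrier G \<Longrightarrow> orb (carrier G) (act g v) = orb (carrier G) v"
  using orb_eq_iff[OF subgroup_self] by metis

lemma proj_orb:
  assumes K: "subgroup K G"
  shows "proj (orb K v) = orb (carrier G) v"
proof -
  have C: "h \<in> carrier G" if "h \<in> K" for h using subgroup.mem_carrier[OF K that] .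
  show ?thesis
  proof
    show "proj (orb K v) \<subseteq> orb (carrier G) v"
      using C by (auto simp: proj_def orb_altdef simp flip: act_mult)
    show "orb (carrier G) v \<subseteq> proj (orb K v)"
    proof
      fix w assume "w \<in> orb (carrier G) v"
      then obtain g where "g \<in> carrier G" "w = act g (act \<one> v)" by (auto simp: orb_altdef act_one)
      then show "w \<in> proj (orb K v)"
        using subgroup.one_closed[OF K] unfolding proj_def orb_altdef by blast
    qed
  qed
qed

lemma continuous_orb: "continuous_map euclidean (quot K) (orb K)"
  by (rule quotient_imp_continuous_map[OF quotient_map_orbit_space])

lemma topspace_quot: "topspace (quot K) = range (orb K)"
  by (rule topspace_orbit_space)

lemma orb_in_topspace [simp]: "orb K v \<in> topspace (quot K)"
  by (simp add: topspace_quot)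

lemma openin_orb_image:
  assumes K: "subgroup K G" and W: "open W"
  shows "openin (quot K) (orb K ` W)"
proof -
  have "orb K -` (orb K ` W) = (\<Union>k\<in>K. act k ` W)"
  proof
    show "orb K -` (orb K ` W) \<subseteq> (\<Union>k\<in>K. act k ` W)"
    proof
      fix v assume "v \<in> orb K -` (orb K ` W)"
      then obtain w where "w \<in> W" "orb K w = orb K v" by auto
      then show "v \<in> (\<Union>k\<in>K. act k ` W)" using orb_eq_iff[OF K] by blast
    qed
    show "(\<Union>k\<in>K. act k ` W) \<subseteq> orb K -` (orb K ` W)"
    proof
      fix v assume "v \<in> (\<Union>k\<in>K. act k ` W)"
      then obtain k w where "k \<in> K" "w \<in> W" "v = act k w" by blast
      then have "orb K w = orb K v" "w \<in> W" using orb_eq_iff[OF K] by blast+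
      then show "v \<in> orb K -` (orb K ` W)" by (metis imageI vimageI)
    qed
  qed
  then show ?thesis
    using W subgroup.mem_carrier[OF K] by (auto simp: openin_orbit_space intro!: open_act_image)
qed

text \<open>The sheets over the image of a small ball are the images under \<open>s\<close> of its
  translates. Two sheets that meet coincide, because the translating elements then differ by a
  factor in \<open>K\<close>. Keeping \<open>s\<close> abstract admits both the orbit map of
  \<open>K\<close> and, for the trivial subgroup, the identity of the space.\<close>

lemma covering_map_quotient:
  assumes K: "subgroup K G"
    and s: "continuous_map euclidean Z s" "open_map euclidean Z s" "range s = topspace Z"
    and fib: "\<And>v w. s v = s w \<longleftrightarrow> orb K v = orb K w"
    and \<pi>: "\<And>v. \<pi> (s v) = orb (carrier G) v"
  shows "covering_map Z (quot (carrier G)) \<pi>"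
proof -
  let ?M = "quot (carrier G)"
  note C = subgroup_self
  have KC: "k \<in> carrier G" if "k \<in> K" for k using subgroup.mem_carrier[OF K that] .
  have sq: "quotient_map euclidean Z s"
    using continuous_open_imp_quotient_map[OF s(1,2)] s(3) by simp
  have "continuous_map euclidean ?M (\<pi> \<circ> s)"
    using continuous_orb[of "carrier G"] \<pi> by (simp add: comp_def)
  then have cont: "continuous_map Z ?M \<pi>" by (rule continuous_compose_quotient_map[OF sq])
  have surj: "\<pi> ` topspace Z = topspace ?M"
    by (auto simp: s(3)[symmetric] topspace_quot \<pi> image_image)
  have open\<pi>: "openin ?M (\<pi> ` A)" if "openin Z A" for A
  proof -
    have "\<pi> ` A = orb (carrier G) ` {v. s v \<in> A}"
    proof -
      have "A = s ` {v. s v \<in> A}" using openin_subset[OF that] s(3) by auto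
      then have "\<pi> ` A = \<pi> ` s ` {v. s v \<in> A}" by simp
      then show ?thesis by (simp add: image_image \<pi>)
    qed
    moreover have "open {v. s v \<in> A}"
      using openin_continuous_map_preimage[OF s(1) that] by simp
    ultimately show ?thesis using openin_orb_image[OF C] by simp
  qed
  have "\<exists>T. y \<in> T \<and> evenly_covered Z ?M \<pi> T" if y: "y \<in> topspace ?M" for y
  proof -
    obtain v where v: "y = orb (carrier G) v" using y unfolding topspace_quot by blast
    obtain \<epsilon> where \<epsilon>: "\<epsilon> > 0" "\<And>g w. \<lbrakk>g \<in> carrier G; w \<in> ball v \<epsilon>; act g w \<in> ball v \<epsilon>\<rbrakk> \<Longrightarrow> g = \<one>"
      using act_discontinuous[of v] by blast
    let ?U = "ball v \<epsilon>"
    let ?T = "orb (carrier G) ` ?U"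
    let ?V = "(\<lambda>g. s ` act g ` ?U) ` carrier G"
    have T: "openin ?M ?T" by (rule openin_orb_image[OF C open_ball])
    have V: "openin Z u" if "u \<in> ?V" for u
      using that s(2) open_act_image by (auto simp: open_map_def)
    have "\<Union>?V = {x \<in> topspace Z. \<pi> x \<in> ?T}"
    proof
      show "\<Union>?V \<subseteq> {x \<in> topspace Z. \<pi> x \<in> ?T}"
        using s(3) by (auto simp: \<pi>)
      show "{x \<in> topspace Z. \<pi> x \<in> ?T} \<subseteq> \<Union>?V"
      proof
        fix x assume x: "x \<in> {x \<in> topspace Z. \<pi> x \<in> ?T}"
        then obtain w where w: "x = s w" using s(3) by blast
        with x have "orb (carrier G) w \<in> ?T" by (simp add: \<pi>)
        then obtain u where u: "u \<in> ?U" "orb (carrier G) u = orb (carrier G) w" by (metis imageE)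
        then obtain g where "g \<in> carrier G" "w = act g u" using orb_eq_iff[OF C] by blast
        then show "x \<in> \<Union>?V" using w u by blast
      qed
    qed
    moreover have "pairwise disjnt ?V"
    proof (clarsimp simp: pairwise_def disjnt_def)
      fix g h assume g: "g \<in> carrier G" "h \<in> carrier G"
        and ne: "s ` act g ` ?U \<noteq> s ` act h ` ?U"
      show "s ` act g ` ?U \<inter> s ` act h ` ?U = {}"
      proof (rule ccontr)
        assume "s ` act g ` ?U \<inter> s ` act h ` ?U \<noteq> {}"
        then obtain u u' where u: "u \<in> ?U" "u' \<in> ?U" "s (act g u) = s (act h u')" by blast
        then obtain k where k: "k \<in> K" "act h u' = act k (act g u)"
          using fib orb_eq_iff[OF K] by metis
        have "act (inv h \<otimes> (k \<otimes> g)) u = u'"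
          using g k KC by (simp add: act_mult act_inv flip: k(2))
        then have "inv h \<otimes> (k \<otimes> g) = \<one>"
          using \<epsilon>(2)[of "inv h \<otimes> (k \<otimes> g)" u] g k KC u by simp
        then have h: "h = k \<otimes> g" using g k KC by (metis inv_closed inv_equality inv_inv m_closed)
        have "s (act h w) = s (act g w)" for w
          unfolding fib using orb_eq_iff[OF K, of "act g w" "act h w"] g k KC
          by (auto simp: h act_mult)
        then show False using ne by (simp add: image_image)
      qed
    qed
    moreover have "homeomorphic_map (subtopology Z u) (subtopology ?M ?T) \<pi>" if u: "u \<in> ?V" for u
    proof -
      obtain g where g: "g \<in> carrier G" "u = s ` act g ` ?U" using u by blast
      have uZ: "u \<subseteq> topspace Z" using V[OF u] openin_subset by blast
      have uT: "\<pi> ` u = ?T" using g by (simp add: image_image \<pi>)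
      have tu: "topspace (subtopology Z u) = u" using uZ by auto
      show ?thesis
      proof (rule bijective_open_imp_homeomorphic_map)
        show "continuous_map (subtopology Z u) (subtopology ?M ?T) \<pi>"
          using cont uT continuous_map_from_subtopology[OF cont]
          unfolding continuous_map_in_subtopology tu by blast
        show "open_map (subtopology Z u) (subtopology ?M ?T) \<pi>"
          unfolding open_map_def openin_open_subtopology[OF V[OF u]] openin_open_subtopology[OF T]
          using open\<pi> uT by blast
        show "\<pi> ` topspace (subtopology Z u) = topspace (subtopology ?M ?T)"
          using tu uT openin_subset[OF T] by auto
        show "inj_on \<pi> (topspace (subtopology Z u))"
          unfolding tu
        proof (rule inj_onI)
          fix a b assume ab: "a \<in> u" "b \<in> u" "\<pi> a = \<pi> b"
          then obtain w w' where w: "w \<in> ?U" "w' \<in> ?U" "a = s (act g w)" "b = s (act g w')"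
            using g(2) by blast
          then have "orb (carrier G) w = orb (carrier G) w'"
            using ab(3) g(1) by (simp add: \<pi>)
          then obtain h where "h \<in> carrier G" "w' = act h w" using orb_eq_iff[OF C] by blast
          then have "w = w'" using \<epsilon>(2) w act_one by metis
          then show "a = b" using w by simp
        qed
      qed
    qed
    ultimately have "evenly_covered Z ?M \<pi> ?T"
      unfolding evenly_covered_def by (intro conjI exI[of _ ?V] ballI T V)
    moreover have "y \<in> ?T" unfolding v by (rule imageI) (use \<epsilon>(1) in simp)
    ultimately show ?thesis by blast
  qed
  then show ?thesis
    unfolding covering_map_iff_evenly_covered using cont surj by blast
qed

lemma open_map_orb: "subgroup K G \<Longrightarrow> open_map euclidean (quot K) (orb K)"
  using openin_orb_image by (simp add: open_map_def)

lemma covering_map_proj: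
  assumes "subgroup K G"
  shows "covering_map (quot K) (quot (carrier G)) proj"
proof (rule covering_map_quotient[OF assms, where s = "orb K"])
  show "range (orb K) = topspace (quot K)" by (rule topspace_quot[symmetric])
qed (rule continuous_orb open_map_orb[OF assms] refl proj_orb[OF assms])+

lemma covering_map_orb: "covering_map euclidean (quot (carrier G)) (orb (carrier G))"
proof (rule covering_map_quotient[OF triv_subgroup, where s = "\<lambda>v. v"])
  show "v = w \<longleftrightarrow> orb {\<one>} v = orb {\<one>} w" for v w
    unfolding orb_eq_iff[OF triv_subgroup] by (auto simp: act_one)
qed (auto simp: open_map_def)

lemma connected_quot: "connected_space (quot K)"
  by (rule connected_space_quotient_map_image[OF quotient_map_orbit_space])
    (use connectedin_topspace[of "euclidean :: E3 topology"] connected_UNIV[where 'a = E3] in simp)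

end

section \<open>Lifts of the orbit map and the Galois correspondence\<close>

context free_action
begin

\<comment> \<open>otherwise the simplifier splits quantified points of \<open>E3\<close> into coordinates\<close>
declare split_paired_All [simp del] split_paired_Ex [simp del]

lemma orb_lift_unique:
  assumes "covering_map N (quot (carrier G)) p"
    "lifts_on UNIV N p (orb (carrier G)) F" "lifts_on UNIV N p (orb (carrier G)) F'" "F v = F' v"
  shows "F w = F' w"
  by (rule lifts_on_unique[OF assms(1) connected_UNIV assms(2,3) UNIV_I assms(4) UNIV_I])

lemma orb_lift_act:
  assumes F: "lifts_on UNIV N p (orb (carrier G)) F" and g: "g \<in> carrier G"
  shows "lifts_on UNIV N p (orb (carrier G)) (\<lambda>v. F (act g v))"
proof -
  have "continuous_map euclidean euclidean (act g)"
    using act_continuous[OF g] by simp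
  then have "continuous_map euclidean N (F \<circ> act g)"
    using lifts_on_continuous[OF F] by (intro continuous_map_compose) simp_all
  then show ?thesis
    using lifts_on_eq[OF F] g by (intro lifts_on_UNIV_I) (simp_all add: comp_def)
qed

text \<open>The composite of \<open>F\<close> with \<open>p\<close> is the open map
  \<open>orb (carrier G)\<close>. Inside one sheet \<open>p\<close> is injective, so there the image
  of a small open set is the preimage under \<open>p\<close> of an open set.\<close>

lemma orb_lift_open:
  assumes cov: "covering_map N (quot (carrier G)) p"
    and F: "lifts_on UNIV N p (orb (carrier G)) F"
  shows "open_map euclidean N F"
  unfolding open_map_def
proof (intro allI impI)
  fix W :: "E3 set" assume W: "openin euclidean W"
  have cF: "continuous_map euclidean N F" and pF: "p (F w) = orb (carrier G) w" for w
    using lifts_on_continuous[OF F] lifts_on_eq[OF F] by simp_all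
  have "\<exists>T. openin N T \<and> F w \<in> T \<and> T \<subseteq> F ` W" if w: "w \<in> W" for w
  proof -
    have FN: "F w \<in> topspace N" using continuous_map_image_subset_topspace[OF cF] by auto
    have "p (F w) \<in> topspace (quot (carrier G))" by (simp add: pF)
    then obtain T where T: "p (F w) \<in> T" "evenly_covered N (quot (carrier G)) p T"
      using cov unfolding covering_map_iff_evenly_covered by blast
    obtain u s where u: "openin N u" "F w \<in> u"
      and ps: "homeomorphic_maps (subtopology N u) (subtopology (quot (carrier G)) T) p s"
      using evenly_covered_sheet[OF T(2) FN T(1)] by blast
    have uN: "u \<subseteq> topspace N" using openin_subset[OF u(1)] .
    have sp: "s (p x) = x" if "x \<in> u" for x
      using ps that uN unfolding homeomorphic_maps_def by auto
    define W' where "W' = W \<inter> {v. F v \<in> u}"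
    have "open {v. F v \<in> u}"
      using openin_continuous_map_preimage[OF cF u(1)] by simp
    then have "open W'" unfolding W'_def using W by auto
    then have "openin (quot (carrier G)) (orb (carrier G) ` W')"
      by (rule openin_orb_image[OF subgroup_self])
    then have "openin N {x \<in> topspace N. p x \<in> orb (carrier G) ` W'}"
      using cov by (intro openin_continuous_map_preimage) (simp_all add: covering_map_def)
    then have op: "openin N (u \<inter> {x \<in> topspace N. p x \<in> orb (carrier G) ` W'})"
      using u(1) by blast
    have "F w \<in> u \<inter> {x \<in> topspace N. p x \<in> orb (carrier G) ` W'}"
      using w u(2) FN pF[of w] by (simp add: W'_def)
    moreover have "u \<inter> {x \<in> topspace N. p x \<in> orb (carrier G) ` W'} \<subseteq> F ` W"
    proof
      fix x assume "x \<in> u \<inter> {x \<in> topspace N. p x \<in> orb (carrier G) ` W'}"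
      then have x: "x \<in> u" "p x \<in> orb (carrier G) ` W'" by auto
      then obtain v where v: "v \<in> W'" "p x = p (F v)" unfolding pF by blast
      have vW: "v \<in> W" "F v \<in> u" using v(1) unfolding W'_def by blast+
      have "x = F v" using sp[OF x(1)] sp[OF vW(2)] v(2) by metis
      then show "x \<in> F ` W" using vW(1) by blast
    qed
    ultimately show ?thesis using op by blast
  qed
  then show "openin N (F ` W)"
    unfolding openin_subopen[of N "F ` W"] by blast
qed

text \<open>The complement of the range is open too: a lift through a point outside has an open
  range, and if that range met the range of \<open>F\<close>, then the two lifts would differ by
  some \<open>act g\<close>, and the point would be a value of \<open>F\<close>.\<close>

lemma orb_lift_surj:
  assumes cov: "covering_map N (quot (carrier G)) p" and con: "connected_space N"
    and F: "lifts_on UNIV N p (orb (carrier G)) F"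
  shows "range F = topspace N"
proof (rule ccontr)
  assume ne: "range F \<noteq> topspace N"
  have FN: "range F \<subseteq> topspace N"
    using F continuous_map_image_subset_topspace unfolding lifts_on_def by fastforce
  have op: "openin N (range F')" if "lifts_on UNIV N p (orb (carrier G)) F'" for F'
    using orb_lift_open[OF cov that] by (simp add: open_map_def)
  have "\<exists>T. openin N T \<and> x \<in> T \<and> T \<subseteq> topspace N - range F" if x: "x \<in> topspace N - range F" for x
  proof -
    have "p x \<in> topspace (quot (carrier G))"
      using cov x unfolding covering_map_def by blast
    then obtain v where v: "p x = orb (carrier G) v" unfolding topspace_quot by blast
    obtain F' where F': "lifts_on UNIV N p (orb (carrier G)) F'" "F' v = x"
      by (rule lift_exists[OF cov continuous_orb _ v]) (use x in auto)
    have "range F' \<inter> range F = {}"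
    proof (rule ccontr)
      assume "range F' \<inter> range F \<noteq> {}"
      then obtain w w' where ww: "F' w = F w'" by blast
      have "orb (carrier G) w = p (F' w)" using lifts_on_eq[OF F'(1)] by simp
      also have "\<dots> = orb (carrier G) w'" using lifts_on_eq[OF F] ww by simp
      finally obtain g where g: "g \<in> carrier G" "w' = act g w"
        using orb_eq_iff[OF subgroup_self] by blast
      have "F' v = F (act g v)"
        by (rule orb_lift_unique[OF cov F'(1) orb_lift_act[OF F g(1)], of w]) (simp add: ww g(2))
      then show False using x F'(2) by blast
    qed
    then show ?thesis
      using op[OF F'(1)] F'(2) openin_subset[OF op[OF F'(1)]] by blast
  qed
  then have "openin N (topspace N - range F)"
    unfolding openin_subopen[of N "topspace N - range F"] by blast
  then have "closedin N (range F)" using FN by (simp add: closedin_def)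
  then show False
    using con op[OF F] ne unfolding connected_space_clopen_in by blast
qed

text \<open>\<open>K\<close> consists of the elements that leave a lift \<open>F\<close> of the
  orbit map invariant. If \<open>F v = F w\<close>, then \<open>w = act g v\<close> for some
  \<open>g\<close>; the lifts \<open>F\<close> and \<open>F \<circ> act g\<close> agree at
  \<open>v\<close>, hence everywhere, so \<open>g\<close> lies in \<open>K\<close>. Thus the fibres
  of \<open>F\<close> are the \<open>K\<close>-orbits.\<close>

theorem covering_classification:
  assumes cov: "covering_map N (quot (carrier G)) p" and con: "connected_space N"
  obtains K \<eta> where "subgroup K G" "homeomorphic_map (quot K) N \<eta>"
    "\<And>x. x \<in> topspace (quot K) \<Longrightarrow> p (\<eta> x) = proj x"
proof -
  have "orb (carrier G) 0 \<in> p ` topspace N"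
    using cov unfolding covering_map_def by simp
  then obtain x where x: "x \<in> topspace N" "p x = orb (carrier G) 0" by (metis imageE)
  obtain F where F: "lifts_on UNIV N p (orb (carrier G)) F" "F 0 = x"
    by (rule lift_exists[OF cov continuous_orb x])
  have cF: "continuous_map euclidean N F" and pF: "p (F w) = orb (carrier G) w" for w
    using lifts_on_continuous[OF F(1)] lifts_on_eq[OF F(1)] by simp_all
  define K where "K = {g \<in> carrier G. \<forall>v. F (act g v) = F v}"
  have K: "subgroup K G"
  proof (rule subgroupI)
    show "K \<noteq> {}" using act_one by (auto simp: K_def)
    show "inv g \<in> K" if "g \<in> K" for g
    proof -
      have g: "g \<in> carrier G" "\<And>v. F (act g v) = F v" using that by (simp_all add: K_def)
      have "F (act (inv g) v) = F v" for v
        using g(2)[of "act (inv g) v"] act_inv(2)[OF g(1)] by simp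
      then show ?thesis using g(1) by (simp add: K_def)
    qed
  qed (auto simp: K_def act_mult)
  have fib: "orb K v = orb K w \<longleftrightarrow> F v = F w" for v w
  proof
    assume "orb K v = orb K w"
    then show "F v = F w" using orb_eq_iff[OF K] by (auto simp: K_def)
  next
    assume eq: "F v = F w"
    then have "orb (carrier G) v = orb (carrier G) w" using pF by metis
    then obtain g where g: "g \<in> carrier G" "w = act g v" using orb_eq_iff[OF subgroup_self] by blast
    have "F (act g u) = F u" for u
      by (rule orb_lift_unique[OF cov orb_lift_act[OF F(1) g(1)] F(1), of v]) (simp add: eq flip:
          g(2))
    then have "g \<in> K" using g by (simp add: K_def)
    then show "orb K v = orb K w" using orb_eq_iff[OF K] g(2) by blast
  qed
  have qF: "quotient_map euclidean N F"
    using continuous_open_imp_quotient_map[OF cF orb_lift_open[OF cov F(1)]]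
      orb_lift_surj[OF cov con F(1)] by simp
  obtain \<eta> where \<eta>: "homeomorphic_map (quot K) N \<eta>" "\<And>v. v \<in> topspace euclidean \<Longrightarrow> \<eta> (orb K v) = F v"
    using quotient_maps_same_fibres[OF quotient_map_orbit_space qF fib] by blast
  have "p (\<eta> y) = proj y" if y: "y \<in> topspace (quot K)" for y
  proof -
    obtain v where "y = orb K v" using y unfolding topspace_quot by blast
    then show ?thesis using \<eta>(2) pF proj_orb[OF K] by simp
  qed
  then show ?thesis using that K \<eta>(1) by blast
qed

text \<open>An equivalence of the quotients is covered by a map of the universal cover that lies
  over the identity of the base; by uniqueness of lifts this map is some \<open>act g\<close>. It
  carries \<open>K\<close>-orbits to \<open>L\<close>-orbits, which by freeness means that
  \<open>g\<close> conjugates \<open>K\<close> onto \<open>L\<close>.\<close>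

theorem covering_equiv_iff_conjugate:
  assumes K: "subgroup K G" and L: "subgroup L G"
  shows "covering_equiv (quot K, proj) (quot L, proj) \<longleftrightarrow> (\<exists>g\<in>carrier G. L = g <# K #> inv g)"
proof
  assume "covering_equiv (quot K, proj) (quot L, proj)"
  then obtain \<eta> where \<eta>: "homeomorphic_map (quot K) (quot L) \<eta>"
      "\<And>x. x \<in> topspace (quot K) \<Longrightarrow> proj x = proj (\<eta> x)"
    by (auto simp: covering_equiv_def)
  have KC: "k \<in> carrier G" if "k \<in> K" for k using subgroup.mem_carrier[OF K that] .
  have LC: "k \<in> carrier G" if "k \<in> L" for k using subgroup.mem_carrier[OF L that] .
  let ?f = "\<lambda>v. \<eta> (orb K v)"
  have "continuous_map euclidean (quot L) (\<eta> \<circ> orb K)"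
    by (rule continuous_map_compose[OF continuous_orb homeomorphic_imp_continuous_map[OF \<eta>(1)]])
  then have f: "lifts_on UNIV (quot L) proj (orb (carrier G)) ?f"
    by (intro lifts_on_UNIV_I) (simp_all add: comp_def proj_orb[OF K] flip: \<eta>(2))
  have oL: "lifts_on UNIV (quot L) proj (orb (carrier G)) (orb L)"
    by (intro lifts_on_UNIV_I continuous_orb proj_orb[OF L])
  have "?f 0 \<in> topspace (quot L)"
    using homeomorphic_imp_surjective_map[OF \<eta>(1)] orb_in_topspace[of K 0] by blast
  then obtain w where w: "?f 0 = orb L w" unfolding topspace_quot by blast
  have "orb (carrier G) 0 = proj (?f 0)" using lifts_on_eq[OF f, of 0] by simp
  also have "\<dots> = orb (carrier G) w" unfolding w by (rule proj_orb[OF L])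
  finally obtain g where g: "g \<in> carrier G" "w = act g 0" using orb_eq_iff[OF subgroup_self]
      by blast
  \<comment> \<open>Both sides lift the orbit map of the whole group through \<open>quot L\<close>,
    and \<open>g\<close> is chosen so that they agree at 0.\<close>
  have eq: "\<eta> (orb K v) = orb L (act g v)" for v
    by (rule orb_lift_unique[OF covering_map_proj[OF L] f orb_lift_act[OF oL g(1)], of 0])
      (simp add: w g(2))
  have fib: "orb K v = orb K u \<longleftrightarrow> orb L (act g v) = orb L (act g u)" for v u
    using homeomorphic_imp_injective_map[OF \<eta>(1)] orb_in_topspace eq unfolding inj_on_def by metis
  have "L = {g \<otimes> k \<otimes> inv g | k. k \<in> K}"
  proof
    show "L \<subseteq> {g \<otimes> k \<otimes> inv g | k. k \<in> K}"
    proof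
      fix l assume l: "l \<in> L"
      let ?v = "0 :: E3" and ?k = "inv g \<otimes> l \<otimes> g"
      have "act g (act ?k ?v) = act l (act g ?v)"
        using g(1) LC[OF l] by (simp add: act_mult act_inv)
      then have "orb L (act g ?v) = orb L (act g (act ?k ?v))"
        using orb_eq_iff[OF L] l by metis
      then obtain k where k: "k \<in> K" "act ?k ?v = act k ?v"
        using orb_eq_iff[OF K] fib by metis
      have "?k = k"
        by (rule act_inj[OF _ _ k(2)]) (use g(1) LC[OF l] KC[OF k(1)] in auto)
      moreover have "g \<otimes> ?k \<otimes> inv g = l"
        using g(1) LC[OF l] by (simp add: m_assoc) (simp flip: m_assoc)
      ultimately show "l \<in> {g \<otimes> k \<otimes> inv g | k. k \<in> K}" using k(1) by force
    qed
    show "{g \<otimes> k \<otimes> inv g | k. k \<in> K} \<subseteq> L"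
    proof clarify
      fix k assume k: "k \<in> K"
      have "orb L (act g 0) = orb L (act g (act k 0))"
        using fib orb_eq_iff[OF K] k by metis
      then obtain l where l: "l \<in> L" "act g (act k 0) = act l (act g 0)"
        using orb_eq_iff[OF L] by metis
      have "act (g \<otimes> k) 0 = act (l \<otimes> g) 0"
        using l g(1) KC[OF k] LC by (simp add: act_mult)
      then have "g \<otimes> k = l \<otimes> g"
        by (intro act_inj[where v = 0]) (use l g(1) KC[OF k] LC in auto)
      then have "g \<otimes> k \<otimes> inv g = l"
        using l(1) g(1) LC by (simp add: m_assoc)
      then show "g \<otimes> k \<otimes> inv g \<in> L" using l(1) by simp
    qed
  qed
  then show "\<exists>g\<in>carrier G. L = g <# K #> inv g" using g(1) unfolding conj_set by blast
next
  assume "\<exists>g\<in>carrier G. L = g <# K #> inv g"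
  then obtain g where g: "g \<in> carrier G" and Lg: "L = {g \<otimes> k \<otimes> inv g | k. k \<in> K}"
    unfolding conj_set by blast
  have KC: "k \<in> carrier G" if "k \<in> K" for k using subgroup.mem_carrier[OF K that] .
  have "homeomorphic_maps euclidean euclidean (act g) (act (inv g))"
    using g act_inv act_continuous[of g] act_continuous[of "inv g"]
        by (simp add: homeomorphic_maps_def)
  then have hg: "quotient_map euclidean euclidean (act g)"
    by (metis homeomorphic_map_def homeomorphic_map_maps)
  have q: "quotient_map euclidean (quot L) (orb L \<circ> act g)"
    by (rule quotient_map_compose[OF hg quotient_map_orbit_space])
  have conj: "act g u = act (g \<otimes> k \<otimes> inv g) (act g v) \<longleftrightarrow> u = act k v" if "k \<in> K" for k u v
    using g KC[OF that] act_inv act_mult by (metis inv_closed m_closed)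
  have "orb K v = orb K u \<longleftrightarrow> (orb L \<circ> act g) v = (orb L \<circ> act g) u" for v u
    unfolding comp_def orb_eq_iff[OF K] orb_eq_iff[OF L] using conj Lg by blast
  then obtain \<eta> where \<eta>: "homeomorphic_map (quot K) (quot L) \<eta>"
      "\<And>v. v \<in> topspace euclidean \<Longrightarrow> \<eta> (orb K v) = (orb L \<circ> act g) v"
    using quotient_maps_same_fibres[OF quotient_map_orbit_space q, of "act ` K"] by metis
  have "proj x = proj (\<eta> x)" if x: "x \<in> topspace (quot K)" for x
  proof -
    obtain v where "x = orb K v" using x unfolding topspace_quot by blast
    then show ?thesis using \<eta>(2)[of v] g by (simp add: proj_orb[OF K] proj_orb[OF L])
  qed
  then show "covering_equiv (quot K, proj) (quot L, proj)"
    using \<eta>(1) by (auto simp: covering_equiv_def)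
qed

text \<open>By freeness the group is in bijection with the orbit of \<open>v\<close>, and the coset
  of \<open>a\<close> becomes the \<open>K\<close>-orbit of \<open>act a v\<close>, which is one
  point of the fibre.\<close>

lemma fibre_bij_rcosets:
  assumes K: "subgroup K G"
  shows "bij_betw (\<lambda>R. (\<lambda>g. act g v) ` R) (rcosets K)
    {x \<in> topspace (quot K). proj x = orb (carrier G) v}"
proof -
  have KC: "k \<in> carrier G" if "k \<in> K" for k using subgroup.mem_carrier[OF K that] .
  have im: "(\<lambda>g. act g v) ` (K #> a) = orb K (act a v)" if "a \<in> carrier G" for a
    unfolding orb_altdef r_coset_def using that KC by (auto simp: act_mult image_iff)
  have RC: "R \<subseteq> carrier G" if "R \<in> rcosets K" for R
    using that r_coset_subset_G[OF subgroup.subset[OF K]] by (auto simp: RCOSETS_def)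
  have inj: "inj_on (\<lambda>g. act g v) (carrier G)" by (rule inj_onI) (rule act_inj)
  show ?thesis
    unfolding bij_betw_def
  proof
    show "inj_on (\<lambda>R. (\<lambda>g. act g v) ` R) (rcosets K)"
      using inj_on_image_eq_iff[OF inj] RC by (auto intro: inj_onI)
    show "(\<lambda>R. (\<lambda>g. act g v) ` R) ` (rcosets K) = {x \<in> topspace (quot K). proj x =
        orb (carrier G) v}"
    proof
      show "(\<lambda>R. (\<lambda>g. act g v) ` R) ` (rcosets K) \<subseteq> {x \<in> topspace (quot K). proj x =
          orb (carrier G) v}"
        by (auto simp: RCOSETS_def im proj_orb[OF K])
      show "{x \<in> topspace (quot K). proj x = orb (carrier G) v} \<subseteq> (\<lambda>R. (\<lambda>g. act g v) ` R) `
          (rcosets K)"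
      proof
        fix x assume x: "x \<in> {x \<in> topspace (quot K). proj x = orb (carrier G) v}"
        then obtain w where w: "x = orb K w" unfolding topspace_quot by blast
        with x have "orb (carrier G) v = orb (carrier G) w" by (simp add: proj_orb[OF K])
        then obtain a where a: "a \<in> carrier G" "w = act a v"
          using orb_eq_iff[OF subgroup_self] by blast
        then have "x = (\<lambda>g. act g v) ` (K #> a)" using im w by simp
        then show "x \<in> (\<lambda>R. (\<lambda>g. act g v) ` R) ` (rcosets K)" using a by (auto simp: RCOSETS_def)
      qed
    qed
  qed
qed

lemma nfold_covering_iff:
  assumes K: "subgroup K G" and n: "n > 0"
  shows "nfold_covering n (quot K) (quot (carrier G)) proj \<longleftrightarrow> card (rcosets K) = n"
proof -
  have card: "card {x \<in> topspace (quot K). proj x = orb (carrier G) v} = card (rcosets K)" for v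
    using bij_betw_same_card[OF fibre_bij_rcosets[OF K]] by metis
  have "finite {x \<in> topspace (quot K). proj x = y} \<and> card {x \<in> topspace (quot K). proj x = y} = n"
    if y: "y \<in> topspace (quot (carrier G))" "card (rcosets K) = n" for y
  proof -
    obtain v where "y = orb (carrier G) v" using y(1) unfolding topspace_quot by blast
    then have "card {x \<in> topspace (quot K). proj x = y} = n" using card[of v] y(2) by simp
    \<comment> \<open>An infinite set has cardinality 0, so \<open>n > 0\<close> yields the
      finiteness demanded by \<open>nfold_covering\<close>.\<close>
    then show ?thesis using n card_ge_0_finite by auto
  qed
  moreover have "card (rcosets K) = n" if "nfold_covering n (quot K) (quot (carrier G)) proj"
  proof -
    have "card {x \<in> topspace (quot K). proj x = orb (carrier G) 0} = n"
      using that orb_in_topspace unfolding nfold_covering_def by blast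
    then show ?thesis using card[of 0] by simp
  qed
  ultimately show ?thesis
    unfolding nfold_covering_def using connected_quot[of K] covering_map_proj[OF K] by meson
qed

end

section \<open>Bijections between sets of classes, and equivalence of coverings\<close>

lemma bij_betw_images_same_fibres:
  assumes "\<And>x y. \<lbrakk>x \<in> A; y \<in> A\<rbrakk> \<Longrightarrow> f x = f y \<longleftrightarrow> g x = g y"
  obtains h where "bij_betw h (f ` A) (g ` A)"
proof (rule that)
  have eq: "g (inv_into A f (f x)) = g x" if "x \<in> A" for x
    using assms[of "inv_into A f (f x)" x] that by (simp add: inv_into_into f_inv_into_f)
  show "bij_betw (\<lambda>y. g (inv_into A f y)) (f ` A) (g ` A)"
  proof (rule bij_betw_imageI)
    show "inj_on (\<lambda>y. g (inv_into A f y)) (f ` A)"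
      using eq assms by (auto simp: inj_on_def)
    show "(\<lambda>y. g (inv_into A f y)) ` f ` A = g ` A"
      unfolding image_image by (rule image_cong[OF refl eq])
  qed
qed

text \<open>Only equality of classes is compared, which suits \<open>conj_rel\<close>. The same
  scheme serves the passage from subgroups to coverings, from numerical parameters to subgroups, and
  between isomorphic groups.\<close>

lemma quotient_bij_betw:
  assumes fB: "\<And>x. x \<in> A \<Longrightarrow> f x \<in> B"
    and eq: "\<And>x y. \<lbrakk>x \<in> A; y \<in> A\<rbrakk> \<Longrightarrow> r `` {x} = r `` {y} \<longleftrightarrow> s `` {f x} = s `` {f y}"
    and onto: "\<And>b. b \<in> B \<Longrightarrow> \<exists>a\<in>A. s `` {f a} = s `` {b}"
  shows "\<exists>h. bij_betw h (A // r) (B // s)"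
proof -
  have "A // r = (\<lambda>x. r `` {x}) ` A" by (auto simp: quotient_def)
  moreover have "B // s = (\<lambda>x. s `` {f x}) ` A"
  proof
    show "B // s \<subseteq> (\<lambda>x. s `` {f x}) ` A"
    proof
      fix X assume "X \<in> B // s"
      then obtain b where b: "b \<in> B" "X = s `` {b}" by (rule quotientE)
      then obtain a where "a \<in> A" "s `` {f a} = s `` {b}" using onto by blast
      then show "X \<in> (\<lambda>x. s `` {f x}) ` A" using b by blast
    qed
  qed (auto intro: quotientI fB)
  moreover obtain h where "bij_betw h ((\<lambda>x. r `` {x}) ` A) ((\<lambda>x. s `` {f x}) ` A)"
    by (rule bij_betw_images_same_fibres[OF eq])
  ultimately show ?thesis by metis
qed

lemma covering_equiv_iff:
  "covering_equiv (N, p) (N', p') \<longleftrightarrow>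
    (\<exists>\<eta>. homeomorphic_map N N' \<eta> \<and> (\<forall>x\<in>topspace N. p x = p' (\<eta> x)))"
  by (simp add: covering_equiv_def)

lemma covering_equiv_refl: "covering_equiv (N, p) (N, p)"
  unfolding covering_equiv_iff by (rule exI[of _ id]) simp

lemma covering_equiv_sym:
  assumes "covering_equiv (N, p) (N', p')"
  shows "covering_equiv (N', p') (N, p)"
proof -
  obtain \<eta> where \<eta>: "homeomorphic_map N N' \<eta>" "\<And>x. x \<in> topspace N \<Longrightarrow> p x = p' (\<eta> x)"
    using assms unfolding covering_equiv_iff by blast
  obtain \<theta> where \<theta>: "homeomorphic_maps N N' \<eta> \<theta>"
    using \<eta>(1) unfolding homeomorphic_map_maps by blast
  then have "homeomorphic_map N' N \<theta>" using homeomorphic_maps_map by blast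
  moreover have "p' y = p (\<theta> y)" if "y \<in> topspace N'" for y
  proof -
    have "\<theta> y \<in> topspace N" "\<eta> (\<theta> y) = y"
      using \<theta> that unfolding homeomorphic_maps_def continuous_map_def by auto
    then show ?thesis using \<eta>(2)[of "\<theta> y"] by simp
  qed
  ultimately show ?thesis unfolding covering_equiv_iff by blast
qed

lemma covering_equiv_trans:
  assumes "covering_equiv (N, p) (N', p')" "covering_equiv (N', p') (N'', p'')"
  shows "covering_equiv (N, p) (N'', p'')"
proof -
  obtain \<eta> where \<eta>: "homeomorphic_map N N' \<eta>" "\<And>x. x \<in> topspace N \<Longrightarrow> p x = p' (\<eta> x)"
    using assms(1) unfolding covering_equiv_iff by blast
  obtain \<theta> where \<theta>: "homeomorphic_map N' N'' \<theta>" "\<And>x. x \<in> topspace N' \<Longrightarrow> p' x = p'' (\<theta> x)"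
    using assms(2) unfolding covering_equiv_iff by blast
  have "\<eta> x \<in> topspace N'" if "x \<in> topspace N" for x
    using homeomorphic_imp_surjective_map[OF \<eta>(1)] that by blast
  then show ?thesis
    unfolding covering_equiv_iff using homeomorphic_map_compose[OF \<eta>(1) \<theta>(1)] \<eta>(2) \<theta>(2)
    by (intro exI[of _ "\<theta> \<circ> \<eta>"]) simp
qed

lemma equiv_covering_equiv: "equiv UNIV {(C, D). covering_equiv C D}"
proof (rule equivI)
  show "refl {(C, D). covering_equiv C D}"
    by (rule refl_onI) (metis case_prodI covering_equiv_refl mem_Collect_eq surj_pair)
  show "sym {(C, D). covering_equiv C D}"
    by (rule symI) (metis case_prodD case_prodI covering_equiv_sym mem_Collect_eq surj_pair)
  show "trans {(C, D). covering_equiv C D}"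
    by (rule transI) (metis case_prodD case_prodI covering_equiv_trans mem_Collect_eq surj_pair)
qed simp

lemma covering_class_eq_iff:
  "{(C, D). covering_equiv C D} `` {x} = {(C, D). covering_equiv C D} `` {y} \<longleftrightarrow> covering_equiv x y"
  using eq_equiv_class_iff[OF equiv_covering_equiv, of x y] by simp

context free_action
begin

lemma nfold_covering_classification:
  assumes cov: "nfold_covering n N (quot (carrier G)) p" and n: "n > 0"
  obtains K \<eta> where "subgroup K G" "card (rcosets K) = n" "homeomorphic_map (quot K) N \<eta>"
    "\<And>x. x \<in> topspace (quot K) \<Longrightarrow> p (\<eta> x) = proj x"
proof -
  have cov': "covering_map N (quot (carrier G)) p" and con: "connected_space N"
    using cov by (auto simp: nfold_covering_def)
  obtain K \<eta> where K: "subgroup K G" and \<eta>: "homeomorphic_map (quot K) N \<eta>"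
      "\<And>x. x \<in> topspace (quot K) \<Longrightarrow> p (\<eta> x) = proj x"
    using covering_classification[OF cov' con] by blast
  let ?y = "orb (carrier G) 0"
  have inj: "inj_on \<eta> (topspace (quot K))" and surj: "\<eta> ` topspace (quot K) = topspace N"
    using \<eta>(1) homeomorphic_imp_injective_map homeomorphic_imp_surjective_map by blast+
  have "{x \<in> topspace N. p x = ?y} = \<eta> ` {x \<in> topspace (quot K). proj x = ?y}"
    unfolding surj[symmetric] using \<eta>(2) by auto
  then have "card {x \<in> topspace N. p x = ?y} = card {x \<in> topspace (quot K). proj x = ?y}"
    using card_image[OF inj_on_subset[OF inj, of "{x \<in> topspace (quot K). proj x = ?y}"]] by auto
  then have "card (rcosets K) = n"
    using bij_betw_same_card[OF fibre_bij_rcosets[OF K, of 0]] cov orb_in_topspace[of "carrier G" 0]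
    unfolding nfold_covering_def by simp
  then show ?thesis using that K \<eta> by blast
qed

text \<open>The quotient spaces have points of type \<open>E3 set\<close>, the type fixed in
  \<open>covering_classes\<close>, so \<open>K\<close> can be sent to the pair of
  \<open>quot K\<close> and \<open>proj\<close>.\<close>

theorem covering_classes_bij:
  assumes n: "n > 0"
  shows "\<exists>h. bij_betw h
    ({K. subgroup K G \<and> card (rcosets K) = n \<and> quot K homeomorphic_space Y} // conj_rel G)
    (covering_classes n (quot (carrier G)) Y)"
  unfolding covering_classes_def
proof -
  let ?A = "{K. subgroup K G \<and> card (rcosets K) = n \<and> quot K homeomorphic_space Y}"
  let ?B = "{(N :: E3 set topology, p). nfold_covering n N (quot (carrier G)) p \<and>
      N homeomorphic_space Y}"
  let ?s = "{(C, D). covering_equiv C D}"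
  show "\<exists>h. bij_betw h (?A // conj_rel G) (?B // ?s)"
  proof (rule quotient_bij_betw[where f = "\<lambda>K. (quot K, proj)"])
    show "(quot K, proj) \<in> ?B" if "K \<in> ?A" for K
      using that nfold_covering_iff[OF _ n] by simp
    show "conj_rel G `` {K} = conj_rel G `` {L} \<longleftrightarrow> ?s `` {(quot K, proj)} = ?s `` {(quot L, proj)}"
      if "K \<in> ?A" "L \<in> ?A" for K L
    proof -
      have K: "subgroup K G" "subgroup L G" using that by auto
      show ?thesis
        unfolding conj_rel_class_eq_iff[OF subgroup.subset[OF K(1)] subgroup.subset[OF K(2)]]
          covering_class_eq_iff covering_equiv_iff_conjugate[OF K]
        by (simp add: conj_rel_def)
    qed
    show "\<exists>K\<in>?A. ?s `` {(quot K, proj)} = ?s `` {b}" if b: "b \<in> ?B" for b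
    proof -
      obtain N p where Np: "b = (N, p)" "nfold_covering n N (quot (carrier G)) p"
          "N homeomorphic_space Y"
        using b by blast
      obtain K \<eta> where K: "subgroup K G" "card (rcosets K) = n"
          and \<eta>: "homeomorphic_map (quot K) N \<eta>"
          "\<And>x. x \<in> topspace (quot K) \<Longrightarrow> p (\<eta> x) = proj x"
        using nfold_covering_classification[OF Np(2) n] by blast
      have "quot K homeomorphic_space Y"
        using \<eta>(1) Np(3) homeomorphic_space homeomorphic_space_trans by blast
      moreover have "covering_equiv (quot K, proj) (N, p)"
        unfolding covering_equiv_iff using \<eta> by metis
      ultimately show ?thesis
        unfolding covering_class_eq_iff Np(1) by (intro bexI[of _ K] CollectI conjI K)
    qed
  qed
qed

end

text \<open>A homeomorphism of the quotients lifts to a map \<open>F\<close> of the universal cover,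
  and a suitable lift \<open>E\<close> of its inverse is inverse to \<open>F\<close> by uniqueness.
  Each \<open>F \<circ> a g\<close> is again a lift, hence equals \<open>b g' \<circ> F\<close> for
  one \<open>g'\<close>; sending \<open>g\<close> to \<open>g'\<close> is the isomorphism.\<close>

theorem homeomorphic_quot_imp_iso:
  assumes "free_action G a" "free_action H b"
    and hom: "orbit_space (a ` carrier G) homeomorphic_space orbit_space (b ` carrier H)"
  shows "G \<cong> H"
proof -
  interpret A: free_action G a by fact
  interpret B: free_action H b by fact
  let ?p = "A.orb (carrier G)" and ?q = "B.orb (carrier H)"
  obtain h k where hk: "homeomorphic_maps (A.quot (carrier G)) (B.quot (carrier H)) h k"
    using hom unfolding homeomorphic_space_def by blast
  then have ch: "continuous_map (A.quot (carrier G)) (B.quot (carrier H)) h"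
    and ck: "continuous_map (B.quot (carrier H)) (A.quot (carrier G)) k"
    and kh: "\<And>v. k (h (?p v)) = ?p v" and hk': "\<And>v. h (k (?q v)) = ?q v"
    by (simp_all add: homeomorphic_maps_def)
  have ph: "continuous_map euclidean (B.quot (carrier H)) (\<lambda>v. h (?p v))"
    using continuous_map_compose[OF A.continuous_orb ch] by (simp add: comp_def)
  have qk: "continuous_map euclidean (A.quot (carrier G)) (\<lambda>v. k (?q v))"
    using continuous_map_compose[OF B.continuous_orb ck] by (simp add: comp_def)
  have "h (?p 0) \<in> topspace (B.quot (carrier H))"
    by (rule subsetD[OF continuous_map_image_subset_topspace[OF ph]], rule imageI) simp
  then obtain w0 where w0: "?q w0 = h (?p 0)" unfolding B.topspace_quot by blast
  have top: "v \<in> topspace (euclidean :: E3 topology)" for v by simp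
  obtain F where F: "lifts_on UNIV euclidean ?q (\<lambda>v. h (?p v)) F" "F 0 = w0"
    by (rule lift_exists[OF B.covering_map_orb ph top w0])
  have "?p 0 = k (?q w0)" using w0 kh by simp
  then obtain E where E: "lifts_on UNIV euclidean ?p (\<lambda>v. k (?q v)) E" "E w0 = 0"
    by (rule lift_exists[OF A.covering_map_orb qk top])
  have cF: "continuous_on UNIV F" and qF: "\<And>v. ?q (F v) = h (?p v)"
    using lifts_on_continuous[OF F(1)] lifts_on_eq[OF F(1)] by simp_all
  have cE: "continuous_on UNIV E" and pE: "\<And>v. ?p (E v) = k (?q v)"
    using lifts_on_continuous[OF E(1)] lifts_on_eq[OF E(1)] by simp_all
  note uniqA = lifts_on_unique[OF A.covering_map_orb connected_UNIV _ _ UNIV_I _ UNIV_I]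
  note uniqB = lifts_on_unique[OF B.covering_map_orb connected_UNIV _ _ UNIV_I _ UNIV_I]
  have EF: "E (F v) = v" for v
  proof (rule uniqA)
    show "lifts_on UNIV euclidean ?p ?p (\<lambda>v. E (F v))"
      by (intro lifts_on_UNIV_I)
        (use continuous_on_compose2[OF cE cF] in \<open>simp_all add: pE qF kh\<close>)
    show "lifts_on UNIV euclidean ?p ?p (\<lambda>v. v)" by (intro lifts_on_UNIV_I) simp_all
    show "E (F 0) = 0" using F(2) E(2) by simp
  qed
  have FE: "F (E v) = v" for v
  proof (rule uniqB)
    show "lifts_on UNIV euclidean ?q ?q (\<lambda>v. F (E v))"
      by (intro lifts_on_UNIV_I)
        (use continuous_on_compose2[OF cF cE] in \<open>simp_all add: pE qF hk'\<close>)
    show "lifts_on UNIV euclidean ?q ?q (\<lambda>v. v)" by (intro lifts_on_UNIV_I) simp_all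
    show "F (E w0) = w0" using F(2) E(2) by simp
  qed
  have "\<exists>g'\<in>carrier H. \<forall>v. F (a g v) = b g' (F v)" if g: "g \<in> carrier G" for g
  proof -
    have "?q (F (a g 0)) = ?q (F 0)" using g by (simp add: qF)
    then obtain g' where g': "g' \<in> carrier H" "F (a g 0) = b g' (F 0)"
      using B.orb_eq_iff[OF B.subgroup_self] by metis
    have "F (a g v) = b g' (F v)" for v
    proof (rule uniqB[where f = "\<lambda>v. F (a g v)" and g = "\<lambda>v. b g' (F v)"])
      show "lifts_on UNIV euclidean ?q (\<lambda>v. h (?p v)) (\<lambda>v. F (a g v))"
        by (intro lifts_on_UNIV_I)
          (use continuous_on_compose2[OF cF A.act_continuous[OF g]] g in \<open>simp_all add: qF\<close>)
      show "lifts_on UNIV euclidean ?q (\<lambda>v. h (?p v)) (\<lambda>v. b g' (F v))"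
        by (intro lifts_on_UNIV_I)
          (use continuous_on_compose2[OF B.act_continuous[OF g'(1)] cF] g' in \<open>simp_all add: qF\<close>)
      show "F (a g 0) = b g' (F 0)" by (rule g'(2))
    qed
    then show ?thesis using g'(1) by blast
  qed
  then obtain \<psi> where \<psi>: "\<And>g. g \<in> carrier G \<Longrightarrow> \<psi> g \<in> carrier H"
      "\<And>g v. g \<in> carrier G \<Longrightarrow> F (a g v) = b (\<psi> g) (F v)" by metis
  have "\<psi> \<in> hom G H"
  proof (rule homI)
    fix x y assume xy: "x \<in> carrier G" "y \<in> carrier G"
    have "b (\<psi> (x \<otimes>\<^bsub>G\<^esub> y)) (F 0) = b (\<psi> x \<otimes>\<^bsub>H\<^esub> \<psi> y) (F 0)"
      using xy \<psi> by (simp flip: \<psi>(2) add: A.act_mult B.act_mult)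
    then show "\<psi> (x \<otimes>\<^bsub>G\<^esub> y) = \<psi> x \<otimes>\<^bsub>H\<^esub> \<psi> y"
      by (rule B.act_inj[rotated 2]) (use xy \<psi>(1) in auto)
  qed (rule \<psi>(1))
  moreover have "inj_on \<psi> (carrier G)"
  proof (rule inj_onI)
    fix x y assume xy: "x \<in> carrier G" "y \<in> carrier G" "\<psi> x = \<psi> y"
    then have "a x 0 = a y 0" using \<psi>(2) EF by metis
    then show "x = y" using A.act_inj xy by blast
  qed
  moreover have "carrier H \<subseteq> \<psi> ` carrier G"
  proof
    fix g' assume g': "g' \<in> carrier H"
    have "?p (E (b g' w0)) = ?p 0" using g' w0 kh by (simp add: pE)
    then obtain g where g: "g \<in> carrier G" "E (b g' w0) = a g 0"
      using A.orb_eq_iff[OF A.subgroup_self] by metis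
    then have "b g' w0 = b (\<psi> g) w0" using FE \<psi>(2)[OF g(1), of 0] F(2) by metis
    then have "g' = \<psi> g" using B.act_inj g' \<psi>(1)[OF g(1)] by blast
    then show "g' \<in> \<psi> ` carrier G" using g(1) by blast
  qed
  ultimately have "\<psi> \<in> iso G H"
    using \<psi>(1) by (auto simp: iso_def bij_betw_def)
  then show ?thesis unfolding is_iso_def by blast
qed

text \<open>Equivariance of the bijection \<open>h\<close> turns the orbits of \<open>H\<close> into
  those of its image under \<open>\<psi>\<close>. With an affine \<open>h\<close> this identifies
  the quotient by a parametrised subgroup with a model space.\<close>

theorem homeomorphic_quot_equivariant:
  assumes "free_action G a" "free_action H b" and \<psi>: "\<psi> \<in> hom H G"
    and h: "homeomorphic_map euclidean euclidean h"
    and eqv: "\<And>g v. g \<in> carrier H \<Longrightarrow> h (b g v) = a (\<psi> g) (h v)"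
  shows "orbit_space (a ` \<psi> ` carrier H) homeomorphic_space orbit_space (b ` carrier H)"
proof -
  interpret A: free_action G a by fact
  interpret B: free_action H b by fact
  interpret \<psi>: group_hom H G \<psi> by unfold_locales (rule \<psi>)
  let ?K = "\<psi> ` carrier H"
  have K: "subgroup ?K G" by (rule \<psi>.img_is_subgroup)
  have q: "quotient_map euclidean (A.quot ?K) (A.orb ?K \<circ> h)"
    using h by (intro quotient_map_compose[OF _ quotient_map_orbit_space]) (simp add:
        homeomorphic_map_def)
  have inj: "h v = h w \<longleftrightarrow> v = w" for v w
    using homeomorphic_imp_injective_map[OF h] by (auto simp: inj_on_def)
  have fib: "B.orb (carrier H) v = B.orb (carrier H) w \<longleftrightarrow> (A.orb ?K \<circ> h) v = (A.orb ?K \<circ> h) w"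
      for v w
  proof -
    have "(A.orb ?K \<circ> h) v = (A.orb ?K \<circ> h) w \<longleftrightarrow> (\<exists>g\<in>carrier H. h w = a (\<psi> g) (h v))"
      by (simp add: A.orb_eq_iff[OF K])
    also have "\<dots> \<longleftrightarrow> (\<exists>g\<in>carrier H. w = b g v)"
      by (simp add: inj flip: eqv)
    finally show ?thesis by (simp add: B.orb_eq_iff[OF B.subgroup_self])
  qed
  obtain \<eta> where "homeomorphic_map (B.quot (carrier H)) (A.quot ?K) \<eta>"
    using quotient_maps_same_fibres[OF quotient_map_orbit_space q fib] by blast
  then show ?thesis using homeomorphic_space homeomorphic_space_sym by blast
qed

section \<open>The groups of the three manifolds\<close>

text \<open>The first coordinate of \<sigma>^a (b, c), where \<sigma> (b, c) = (s * b + u * c, c).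
  For the pairs (s, u) in use \<sigma> squares to the identity, so only the parity of
  \<open>a\<close> matters.\<close>

definition twist :: "int \<Rightarrow> int \<Rightarrow> int \<Rightarrow> int \<Rightarrow> int \<Rightarrow> int" where
  "twist s u a b c = (if even a then b else s * b + u * c)"

text \<open>The triple \<open>(a, b, c)\<close> stands for \<beta>^b \<gamma>^c \<alpha>^a; moving
  \<alpha>^a past the lattice part of the second factor produces the twist.\<close>

definition flat_group :: "int \<Rightarrow> int \<Rightarrow> (int \<times> int \<times> int) monoid" where
  "flat_group s u = \<lparr>carrier = UNIV,
     monoid.mult = (\<lambda>(a, b, c) (a', b', c'). (a + a', b + twist s u a b' c', c + c')), one =
         (0, 0, 0)\<rparr>"

text \<open>The pair \<open>(b, c)\<close> acts as the translation by (b - u c / 2, c) in the last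
  two coordinates. In this basis \<sigma> just multiplies the first of them by \<open>s\<close>,
  which for s = -1 is a reflection; for u = 1 the formula gives the half shift of
  \<open>B2_gamma\<close>.\<close>

definition flat_act :: "int \<Rightarrow> int \<Rightarrow> int \<times> int \<times> int \<Rightarrow> E3 \<Rightarrow> E3" where
  "flat_act s u = (\<lambda>(a, b, c) (x, y, z).
     (x + a, (if even a then y else s * y) + b - u / 2 * c, z + c))"

text \<open>The pairs \<open>(1, 0)\<close>, \<open>(-1, 0)\<close> and \<open>(-1, 1)\<close> give the groups of the torus and of the
  first and second amphicosm.\<close>

definition flat_type :: "int \<Rightarrow> int \<Rightarrow> bool" where
  "flat_type s u \<longleftrightarrow> (s, u) \<in> {(1, 0), (- 1, 0), (- 1, 1)}"

lemma flat_type_simps [simp]: "flat_type 1 0" "flat_type (- 1) 0" "flat_type (- 1) 1"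
  by (auto simp: flat_type_def)

lemma carrier_flat_group [simp]: "carrier (flat_group s u) = UNIV"
  by (simp add: flat_group_def)

lemma one_flat_group: "\<one>\<^bsub>flat_group s u\<^esub> = (0, 0, 0)"
  by (simp add: flat_group_def)

lemma mult_flat_group:
  "(a, b, c) \<otimes>\<^bsub>flat_group s u\<^esub> (a', b', c') = (a + a', b + twist s u a b' c', c + c')"
  by (simp add: flat_group_def)

lemma group_flat_group:
  assumes "flat_type s u"
  shows "group (flat_group s u)"
proof (rule groupI)
  fix x y z :: "int \<times> int \<times> int"
  obtain a b c a' b' c' a'' b'' c'' where xyz: "x = (a, b, c)" "y = (a', b', c')"
      "z = (a'', b'', c'')"
    by (metis prod_cases3)
  show "x \<otimes>\<^bsub>flat_group s u\<^esub> y \<otimes>\<^bsub>flat_group s u\<^esub> z = x \<otimes>\<^bsub>flat_group s u\<^esub> (y \<otimes>\<^bsub>flat_group s u\<^esub> z)"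
    using assms by (auto simp: xyz mult_flat_group twist_def flat_type_def algebra_simps)
  show "\<one>\<^bsub>flat_group s u\<^esub> \<otimes>\<^bsub>flat_group s u\<^esub> x = x"
    by (simp add: xyz one_flat_group mult_flat_group twist_def)
  have "(- a, - twist s u a b c, - c) \<otimes>\<^bsub>flat_group s u\<^esub> x = \<one>\<^bsub>flat_group s u\<^esub>"
    using assms by (auto simp: xyz one_flat_group mult_flat_group twist_def flat_type_def)
  then show "\<exists>y\<in>carrier (flat_group s u). y \<otimes>\<^bsub>flat_group s u\<^esub> x = \<one>\<^bsub>flat_group s u\<^esub>"
    by (metis UNIV_I carrier_flat_group)
qed auto

lemma inv_flat_group:
  assumes "flat_type s u"
  shows "inv\<^bsub>flat_group s u\<^esub> (a, b, c) = (- a, - twist s u a b c, - c)"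
proof (rule group.inv_equality[OF group_flat_group[OF assms]])
  show "(- a, - twist s u a b c, - c) \<otimes>\<^bsub>flat_group s u\<^esub> (a, b, c) = \<one>\<^bsub>flat_group s u\<^esub>"
    using assms by (auto simp: one_flat_group mult_flat_group twist_def flat_type_def)
qed auto

lemma flat_act_mult:
  assumes "flat_type s u"
  shows "flat_act s u (g \<otimes>\<^bsub>flat_group s u\<^esub> h) v = flat_act s u g (flat_act s u h v)"
proof -
  obtain a b c a' b' c' x y z where *: "g = (a, b, c)" "h = (a', b', c')" "v = (x, y, z)"
    by (metis prod_cases3)
  show ?thesis
    using assms by (auto simp: * flat_act_def mult_flat_group twist_def flat_type_def
        algebra_simps add_divide_distrib)
qed

lemma free_action_flat:
  assumes su: "flat_type s u"
  shows "free_action (flat_group s u) (flat_act s u)"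
proof -
  interpret group "flat_group s u" by (rule group_flat_group[OF su])
  show ?thesis
  proof
    show "flat_act s u \<one>\<^bsub>flat_group s u\<^esub> v = v" for v
      by (cases v) (simp add: flat_act_def one_flat_group)
    show "continuous_on UNIV (flat_act s u g)" for g
    proof -
      obtain a b c where g: "g = (a, b, c)" by (metis prod_cases3)
      have "flat_act s u g = (\<lambda>v :: E3. (fst v + a, (if even a then fst (snd v) else s * fst (snd
          v)) + b - u / 2 * c, snd (snd v) + c))"
        by (auto simp: flat_act_def g fun_eq_iff)
      then show ?thesis by (cases "even a") (auto intro!: continuous_intros)
    qed
    show "\<exists>\<epsilon>>0. \<forall>g\<in>carrier (flat_group s u). \<forall>w\<in>ball v \<epsilon>. flat_act s u g w \<in> ball v \<epsilon> \<longrightarrow>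
        g = \<one>\<^bsub>flat_group s u\<^esub>" for v
    \<comment> \<open>With radius 1/2 a point that stays in the ball has moved by less than 1 in
      each coordinate. This forces \<open>a\<close> and \<open>c\<close> to vanish; then the sign
      and the half shift disappear, and \<open>b\<close> vanishes too.\<close>
    proof (intro exI[of _ "1/2"] conjI ballI impI)
      fix g w assume w: "w \<in> ball v (1/2)" and gw: "flat_act s u g w \<in> ball v (1/2)"
      obtain a b c where g: "g = (a, b, c)" by (metis prod_cases3)
      obtain x y z where xyz: "w = (x, y, z)" by (metis prod_cases3)
      let ?w = "flat_act s u g w"
      have d: "dist ?w w < 1"
        using w gw dist_triangle_half_r[of v ?w 1 w] by (simp add: dist_commute)
      have "dist (fst ?w) (fst w) < 1" "dist (fst (snd ?w)) (fst (snd w)) < 1"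
          "dist (snd (snd ?w)) (snd (snd w)) < 1"
        using d dist_fst_le[of ?w w] dist_snd_le[of ?w w] dist_fst_le[of "snd ?w" "snd w"]
          dist_snd_le[of "snd ?w" "snd w"] by linarith+
      then have 1: "\<bar>real_of_int a\<bar> < 1" "\<bar>real_of_int c\<bar> < 1"
        "\<bar>(if even a then y else s * y) + b - u / 2 * c - y\<bar> < 1"
        by (simp_all add: g xyz flat_act_def dist_real_def)
      then have "a = 0" "c = 0" by linarith+
      with 1(3) have "\<bar>real_of_int b\<bar> < 1" by simp
      then have "b = 0" by linarith
      then show "g = \<one>\<^bsub>flat_group s u\<^esub>" using \<open>a = 0\<close> \<open>c = 0\<close> by (simp add: g one_flat_group)
    qed simp
  qed (rule flat_act_mult[OF su])
qed

lemma flat_group_1_0_iso_Z3: "flat_group 1 0 \<cong> Z3"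
proof -
  have "(\<lambda>x. x) \<in> iso (flat_group 1 0) Z3"
    by (auto simp: iso_def hom_def bij_betw_def Z3_def DirProd_def integer_group_def
        mult_flat_group twist_def)
  then show ?thesis unfolding is_iso_def by blast
qed

subsection \<open>Generators and relations\<close>

context group
begin

lemma conj_hom:
  assumes x: "x \<in> carrier G"
  shows "(\<lambda>y. x \<otimes> y \<otimes> inv x) \<in> hom G G"
proof (rule homI)
  fix y z assume "y \<in> carrier G" "z \<in> carrier G"
  then show "x \<otimes> (y \<otimes> z) \<otimes> inv x = (x \<otimes> y \<otimes> inv x) \<otimes> (x \<otimes> z \<otimes> inv x)"
    using x inv_solve_left by (simp add: m_assoc)
qed (use x in auto)

lemma conj_int_pow:
  assumes "x \<in> carrier G" "y \<in> carrier G" "x \<otimes> y \<otimes> inv x = z" 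
  shows "x \<otimes> y [^] (i::int) \<otimes> inv x = z [^] i"
  using hom_int_pow[OF conj_hom[OF assms(1)] assms(2) is_group is_group, of i] assms(3) by simp

lemma conj_eq_iff:
  assumes "x \<in> carrier G" "y \<in> carrier G" "z \<in> carrier G"
  shows "x \<otimes> y \<otimes> inv x = z \<longleftrightarrow> x \<otimes> y = z \<otimes> x"
  using assms inv_solve_right[of z "x \<otimes> y" x] by auto

lemma commute_int_pow:
  assumes "x \<in> carrier G" "y \<in> carrier G" "x \<otimes> y = y \<otimes> x"
  shows "x [^] (i::int) \<otimes> y [^] (j::int) = y [^] j \<otimes> x [^] i"
proof -
  have "x \<otimes> y [^] j \<otimes> inv x = y [^] j"
    using conj_int_pow[OF assms(1,2)] conj_eq_iff[OF assms(1,2,2)] assms(3) by simp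
  then have "x \<otimes> y [^] j = y [^] j \<otimes> x" using assms conj_eq_iff by simp
  then have "y [^] j \<otimes> x [^] i \<otimes> inv (y [^] j) = x [^] i"
    using conj_int_pow[of "y [^] j" x x i] conj_eq_iff[of "y [^] j" x x] assms(1,2) by simp
  then show ?thesis using assms conj_eq_iff[of "y [^] j" "x [^] i" "x [^] i"] by simp
qed

text \<open>The products \<open>D b c\<close> of powers of \<open>B\<close> and \<open>C\<close>
  multiply like lattice vectors, and conjugation by \<open>A\<close> acts on them as \<sigma>, so
  normal forms multiply as in \<open>flat_group\<close>. This supplies the map from a model group to
  a presented group.\<close>

lemma flat_group_universal:
  assumes su: "flat_type s u" and ABC: "A \<in> carrier G" "B \<in> carrier G" "C \<in> carrier G"
    and CB: "C \<otimes> B = B \<otimes> C" and AB: "A \<otimes> B = B [^] s \<otimes> A" and AC: "A \<otimes> C = B [^] u \<otimes> C \<otimes> A"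
  shows "(\<lambda>(a, b, c). B [^] b \<otimes> C [^] c \<otimes> A [^] a) \<in> hom (flat_group s u) G"
proof -
  define D where "D b c = B [^] b \<otimes> C [^] c" for b c :: int
  have D: "D b c \<in> carrier G" for b c using ABC by (simp add: D_def)
  have DD: "D b c \<otimes> D b' c' = D (b + b') (c + c')" for b c b' c'
  proof -
    have "B [^] b \<otimes> C [^] c \<otimes> (B [^] b' \<otimes> C [^] c') = B [^] b \<otimes> (C [^] c \<otimes> B [^] b') \<otimes> C [^] c'"
      using ABC by (simp add: m_assoc)
    also have "\<dots> = B [^] b \<otimes> (B [^] b' \<otimes> C [^] c) \<otimes> C [^] c'"
      using commute_int_pow[OF ABC(3,2) CB] by simp
    also have "\<dots> = D (b + b') (c + c')"
      using ABC by (simp add: D_def int_pow_mult m_assoc)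
    finally show ?thesis by (simp add: D_def)
  qed
  have conjB: "A \<otimes> B [^] b \<otimes> inv A = D (s * b) 0" for b
    using conj_int_pow[OF ABC(1,2), of "B [^] s" b] AB ABC conj_eq_iff[of A B "B [^] s"]
    by (simp add: int_pow_pow D_def)
  have conjC: "A \<otimes> C [^] c \<otimes> inv A = D (u * c) c" for c
  proof -
    have "A \<otimes> C [^] c \<otimes> inv A = (B [^] u \<otimes> C) [^] c"
      by (rule conj_int_pow) (use ABC AC conj_eq_iff[of A C "B [^] u \<otimes> C"] in auto)
    also have "\<dots> = (B [^] u) [^] c \<otimes> C [^] c"
      using commute_int_pow[OF ABC(2,3) CB[symmetric], of u 1] ABC
      by (intro int_pow_mult_distrib) auto
    finally show ?thesis using ABC by (simp add: int_pow_pow D_def)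
  qed
  have conjD: "A \<otimes> D b c = D (s * b + u * c) c \<otimes> A" for b c
  proof -
    have "A \<otimes> D b c \<otimes> inv A = (A \<otimes> B [^] b \<otimes> inv A) \<otimes> (A \<otimes> C [^] c \<otimes> inv A)"
      unfolding D_def using hom_mult[OF conj_hom[OF ABC(1)]] ABC by simp
    also have "\<dots> = D (s * b + u * c) c" by (simp add: conjB conjC DD)
    finally show ?thesis using conj_eq_iff ABC D by simp
  qed
  have conjD': "inv A \<otimes> D b c = D (s * b + u * c) c \<otimes> inv A" for b c
  proof -
    \<comment> \<open>\<sigma> is its own inverse, so conjugation by \<open>inv A\<close> acts on
      \<open>D b c\<close> in the same way.\<close>
    have "s * (s * b + u * c) + u * c = b"
      using su by (auto simp: flat_type_def)
    then have "D b c \<otimes> A = A \<otimes> D (s * b + u * c) c" using conjD[of "s * b + u * c" c] by simp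
    then have "inv A \<otimes> (D b c \<otimes> A) \<otimes> inv A = inv A \<otimes> (A \<otimes> D (s * b + u * c) c) \<otimes> inv A" by simp
    then show ?thesis using ABC D by (simp add: m_assoc) (simp flip: m_assoc)
  qed
  have tw: "twist s u (a + 1) b c = twist s u a (s * b + u * c) c"
    "twist s u (a - 1) b c = twist s u a (s * b + u * c) c" for a b c
    using su by (auto simp: twist_def flat_type_def)
  have AD: "A [^] a \<otimes> D b c = D (twist s u a b c) c \<otimes> A [^] a" for a b c :: int
  proof (induction a arbitrary: b c rule: int_induct[where k = 0])
    case base
    show ?case using D by (simp add: twist_def)
  next
    case (step1 a)
    have "A [^] (a + 1) \<otimes> D b c = A [^] a \<otimes> (A \<otimes> D b c)"
      using ABC D by (simp add: int_pow_mult m_assoc)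
    also have "\<dots> = A [^] a \<otimes> D (s * b + u * c) c \<otimes> A"
      using ABC D by (simp add: conjD m_assoc)
    also have "\<dots> = D (twist s u (a + 1) b c) c \<otimes> (A [^] a \<otimes> A)"
      using ABC D by (simp add: step1 tw m_assoc)
    finally show ?case using ABC by (simp add: int_pow_mult)
  next
    case (step2 a)
    have pow: "A [^] (a - 1) = A [^] a \<otimes> inv A"
      using ABC int_pow_diff[of A a 1] by simp
    have "A [^] (a - 1) \<otimes> D b c = A [^] a \<otimes> (inv A \<otimes> D b c)"
      using ABC D by (simp add: pow m_assoc)
    also have "\<dots> = A [^] a \<otimes> D (s * b + u * c) c \<otimes> inv A"
      using ABC D by (simp add: conjD' m_assoc)
    also have "\<dots> = D (twist s u (a - 1) b c) c \<otimes> (A [^] a \<otimes> inv A)"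
      using ABC D by (simp add: step2 tw m_assoc)
    finally show ?case by (simp add: pow)
  qed
  show ?thesis
  proof (rule homI)
    fix x y :: "int \<times> int \<times> int"
    obtain a b c a' b' c' where xy: "x = (a, b, c)" "y = (a', b', c')" by (metis prod_cases3)
    have "(D b c \<otimes> A [^] a) \<otimes> (D b' c' \<otimes> A [^] a') = D b c \<otimes> (A [^] a \<otimes> D b' c') \<otimes> A [^] a'"
      using ABC D by (simp add: m_assoc)
    also have "\<dots> = (D b c \<otimes> D (twist s u a b' c') c') \<otimes> (A [^] a \<otimes> A [^] a')"
      using ABC D by (simp add: AD m_assoc)
    also have "\<dots> = D (b + twist s u a b' c') (c + c') \<otimes> A [^] (a + a')"
      using ABC by (simp add: DD int_pow_mult)
    finally show "(\<lambda>(a, b, c). B [^] b \<otimes> C [^] c \<otimes> A [^] a) (x \<otimes>\<^bsub>flat_group s u\<^esub> y) =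
      (\<lambda>(a, b, c). B [^] b \<otimes> C [^] c \<otimes> A [^] a) x \<otimes> (\<lambda>(a, b, c). B [^] b \<otimes> C [^] c \<otimes> A [^] a) y"
      by (simp add: xy mult_flat_group D_def)
  qed (use ABC in auto)
qed

definition eval_word :: "('x \<Rightarrow> 'a) \<Rightarrow> 'x word \<Rightarrow> 'a" where
  "eval_word f w = foldr (\<lambda>(x, s) g. (if s then f x else inv f x) \<otimes> g) w \<one>"

lemma eval_word_simps [simp]:
  "eval_word f [] = \<one>"
  "eval_word f ((x, s) # w) = (if s then f x else inv f x) \<otimes> eval_word f w"
  by (simp_all add: eval_word_def)

lemma eval_word_closed: "range f \<subseteq> carrier G \<Longrightarrow> eval_word f w \<in> carrier G"
  by (induction w) (auto simp: image_subset_iff)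

lemma eval_word_append:
  assumes f: "range f \<subseteq> carrier G"
  shows "eval_word f (v @ w) = eval_word f v \<otimes> eval_word f w"
  using f by (induction v) (auto simp: image_subset_iff eval_word_closed m_assoc)

lemma eval_word_generate: "range f \<subseteq> carrier G \<Longrightarrow> eval_word f w \<in> generate G (range f)"
  by (induction w) (auto simp: generate.one generate.incl generate.inv intro!: generate.eng)

lemma eval_word_replicate_True: "range f \<subseteq> carrier G \<Longrightarrow>
    eval_word f (replicate n (x, True)) = f x [^] n"
  by (induction n) (simp_all add: image_subset_iff flip: nat_pow_Suc2)

lemma eval_word_replicate_False: "range f \<subseteq> carrier G \<Longrightarrow>
    eval_word f (replicate n (x, False)) = inv f x [^] n"
  by (induction n) (simp_all add: image_subset_iff flip: nat_pow_Suc2)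

lemma eval_word_int_pow:
  assumes f: "range f \<subseteq> carrier G"
  obtains w where "eval_word f w = f x [^] (i :: int)"
proof (cases i)
  case (nonneg n)
  then show ?thesis
    using that[of "replicate n (x, True)"] eval_word_replicate_True[OF f, of n x]
        by (simp add: int_pow_int)
next
  case (neg n)
  then have "inv f x [^] Suc n = f x [^] i"
    using f int_pow_neg[of "f x" "int (Suc n)"] nat_pow_inv[of "f x" "Suc n"]
    by (simp add: image_subset_iff int_pow_int del: of_nat_Suc nat_pow_Suc)
  then show ?thesis
    using that[of "replicate (Suc n) (x, False)"] eval_word_replicate_False[OF f, of "Suc n" x]
        by simp
qed

lemma eval_word_eq:
  assumes f: "range f \<subseteq> carrier G"
    and R: "\<And>l r. (l, r) \<in> R \<Longrightarrow> eval_word f l = eval_word f r"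
  shows "word_eq R v w \<Longrightarrow> eval_word f v = eval_word f w"
proof (induction rule: word_eq.induct)
  case (word_eq_cancel u x s v)
  have "f x \<in> carrier G" using f by blast
  moreover have "eval_word f v \<in> carrier G" by (rule eval_word_closed[OF f])
  ultimately show ?case
    by (cases s) (simp_all add: eval_word_append[OF f] flip: m_assoc)
next
  case (word_eq_rel l r u v)
  then show ?case using R by (simp add: eval_word_append[OF f])
qed auto

end

text \<open>\<open>\<Psi>\<close> runs from the concrete group to the presented one, where a normal
  form defines it. It sends the value of a word to the class of the word; since the relations hold
  in \<open>G\<close>, words with the same class have the same value, and this is
  injectivity.\<close>

lemma (in group) presented_group_iso:
  assumes f: "range f \<subseteq> carrier G"
    and R: "\<And>l r. (l, r) \<in> R \<Longrightarrow> eval_word f l = eval_word f r"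
    and onto: "\<And>g. g \<in> carrier G \<Longrightarrow> \<exists>w. g = eval_word f w"
    and \<Psi>: "\<Psi> \<in> hom G (presented_group R)" "\<And>x. \<Psi> (f x) = {w. word_eq R (gen x) w}"
  shows "presented_group R \<cong> G"
proof -
  let ?P = "presented_group R"
  interpret P: group ?P by (rule group_presented_group)
  interpret \<Psi>: group_hom G ?P \<Psi> by unfold_locales (rule \<Psi>(1))
  have fG: "f x \<in> carrier G" for x using f by blast
  have clP: "{w. word_eq R v w} \<in> carrier ?P" for v by (auto simp: carrier_presented_group)
  have inv: "inv\<^bsub>?P\<^esub> {w. word_eq R (gen x) w} = {w. word_eq R (gen_inv x) w}" for x
  proof (rule P.inv_equality[OF _ clP clP])
    have "word_eq R (gen_inv x @ gen x) []"
      using word_eq_cancel[of R "[]" x False "[]"] by (simp add: gen_def gen_inv_def)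
    then show "{w. word_eq R (gen_inv x) w} \<otimes>\<^bsub>?P\<^esub> {w. word_eq R (gen x) w} = \<one>\<^bsub>?P\<^esub>"
      by (simp only: mult_presented_group one_presented_group word_class_eq_iff)
  qed
  have \<Psi>_eval: "\<Psi> (eval_word f w) = {v. word_eq R w v}" for w
  proof (induction w)
    case Nil
    show ?case by (simp add: one_presented_group)
  next
    case (Cons y w)
    obtain x b where y: "y = (x, b)" by fastforce
    have "\<Psi> (eval_word f (y # w)) = \<Psi> (if b then f x else inv f x) \<otimes>\<^bsub>?P\<^esub> {v. word_eq R w v}"
      using eval_word_closed[OF f, of w] fG by (simp add: y Cons)
    also have "\<Psi> (if b then f x else inv f x) = {v. word_eq R [(x, b)] v}"
      using fG \<Psi>(2) inv by (simp add: gen_def gen_inv_def)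
    also have "\<dots> \<otimes>\<^bsub>?P\<^esub> {v. word_eq R w v} = {v. word_eq R (y # w) v}"
      by (simp add: mult_presented_group y)
    finally show ?case .
  qed
  have "inj_on \<Psi> (carrier G)"
  proof (rule inj_onI)
    fix g h assume gh: "g \<in> carrier G" "h \<in> carrier G" "\<Psi> g = \<Psi> h"
    then obtain v w where vw: "g = eval_word f v" "h = eval_word f w" using onto by meson
    then have "word_eq R v w" using gh(3) by (simp only: \<Psi>_eval word_class_eq_iff)
    then show "g = h" using eval_word_eq[OF f R] vw by simp
  qed
  moreover have "\<Psi> ` carrier G = carrier ?P"
  proof
    show "carrier ?P \<subseteq> \<Psi> ` carrier G"
    proof
      fix X assume "X \<in> carrier ?P"
      then obtain w where "X = {v. word_eq R w v}" by (auto simp: carrier_presented_group)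
      then show "X \<in> \<Psi> ` carrier G"
        using \<Psi>_eval[of w] eval_word_closed[OF f, of w] by blast
    qed
  qed auto
  ultimately have "\<Psi> \<in> iso G ?P" using \<Psi>(1) by (simp add: iso_def bij_betw_def)
  then show ?thesis using iso_sym unfolding is_iso_def by blast
qed

lemma flat_pow:
  assumes "flat_type s u"
  shows "(0, b, c) [^]\<^bsub>flat_group s u\<^esub> (i :: int) = (0, i * b, i * c)"
    and "(a, 0, 0) [^]\<^bsub>flat_group s u\<^esub> (i :: int) = (i * a, 0, 0)"
proof -
  interpret group "flat_group s u" by (rule group_flat_group[OF assms])
  have *: "x [^]\<^bsub>flat_group s u\<^esub> (i :: int) = p i"
    if "p 0 = \<one>\<^bsub>flat_group s u\<^esub>" "\<And>i. p i \<otimes>\<^bsub>flat_group s u\<^esub> x = p (i + 1)" for x p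
  proof (induction i rule: int_induct[where k = 0])
    case base
    show ?case using that by simp
  next
    case (step1 i)
    then show ?case using that(2)[of i] by (simp add: int_pow_mult)
  next
    case (step2 i)
    have "p (i - 1) \<otimes>\<^bsub>flat_group s u\<^esub> x = p i" using that(2)[of "i - 1"] by simp
    then show ?case using step2 int_pow_diff[of x i 1] by (simp add: inv_solve_right')
  qed
  show "(0, b, c) [^]\<^bsub>flat_group s u\<^esub> (i :: int) = (0, i * b, i * c)"
    using *[of "\<lambda>i. (0, i * b, i * c)" "(0, b, c)"]
    by (simp add: one_flat_group mult_flat_group twist_def algebra_simps)
  show "(a, 0, 0) [^]\<^bsub>flat_group s u\<^esub> (i :: int) = (i * a, 0, 0)"
    using *[of "\<lambda>i. (i * a, 0, 0)" "(a, 0, 0)"]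
    by (simp add: one_flat_group mult_flat_group twist_def algebra_simps)
qed

lemma flat_group_normal_form:
  assumes "flat_type s u"
  shows "(a, b, c) = (0, 1, 0) [^]\<^bsub>flat_group s u\<^esub> b \<otimes>\<^bsub>flat_group s u\<^esub> (0, 0, 1) [^]\<^bsub>flat_group s
      u\<^esub> c
    \<otimes>\<^bsub>flat_group s u\<^esub> (1, 0, 0) [^]\<^bsub>flat_group s u\<^esub> a"
  by (simp add: flat_pow[OF assms] mult_flat_group twist_def)

lemma flat_group_eval_word_surj:
  assumes su: "flat_type s u" and f: "{(1, 0, 0), (0, 1, 0), (0, 0, 1)} \<subseteq> range f"
  shows "\<exists>w. g = group.eval_word (flat_group s u) f w"
proof -
  interpret group "flat_group s u" by (rule group_flat_group[OF su])
  have fG: "range f \<subseteq> carrier (flat_group s u)" by simp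
  obtain a b c where g: "g = (a, b, c)" by (metis prod_cases3)
  obtain x y z where xyz: "f x = (1, 0, 0)" "f y = (0, 1, 0)" "f z = (0, 0, 1)"
    using f by (auto simp: image_iff)
  obtain w1 w2 w3 where "eval_word f w1 = f y [^]\<^bsub>flat_group s u\<^esub> b"
      "eval_word f w2 = f z [^]\<^bsub>flat_group s u\<^esub> c"
      "eval_word f w3 = f x [^]\<^bsub>flat_group s u\<^esub> a"
    using eval_word_int_pow[OF fG] by metis
  then have "eval_word f (w1 @ w2 @ w3) = g"
    using flat_group_normal_form[OF su, of a b c]
        by (simp add: eval_word_append[OF fG] xyz g m_assoc)
  then show ?thesis by metis
qed

lemma flat_group_generate:
  assumes su: "flat_type s u"
  shows "generate (flat_group s u) {(1, 0, 0), (0, 1, 0), (0, 0, 1)} = UNIV"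
proof -
  interpret group "flat_group s u" by (rule group_flat_group[OF su])
  define f :: "nat \<Rightarrow> int \<times> int \<times> int" where
    "f i = (if i = 0 then (1, 0, 0) else if i = 1 then (0, 1, 0) else (0, 0, 1))" for i
  have ran: "range f = {(1, 0, 0), (0, 1, 0), (0, 0, 1)}"
    using rangeI[of f 0] rangeI[of f 1] rangeI[of f 2] by (auto simp: f_def)
  have "g \<in> generate (flat_group s u) (range f)" for g
    using flat_group_eval_word_surj[OF su, of f g] eval_word_generate[of f] ran by auto
  then show ?thesis by (auto simp: ran)
qed

lemma flat_act_hom:
  assumes su: "flat_type s u"
  shows "flat_act s u \<in> hom (flat_group s u) (BijGroup UNIV)"
proof (rule homI)
  interpret free_action "flat_group s u" "flat_act s u" by (rule free_action_flat[OF su])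
  have bij: "flat_act s u g \<in> Bij UNIV" for g
    unfolding Bij_def using act_inv[of g]
        by (auto intro!: bij_betwI[of _ _ _ "flat_act s u (inv\<^bsub>flat_group s u\<^esub> g)"])
  then show "flat_act s u g \<in> carrier (BijGroup UNIV)" for g by (simp add: BijGroup_def)
  show "flat_act s u (g \<otimes>\<^bsub>flat_group s u\<^esub> h) = flat_act s u g \<otimes>\<^bsub>BijGroup UNIV\<^esub> flat_act s u h"
      for g h
    using bij by (simp add: BijGroup_def compose_def flat_act_mult[OF su] fun_eq_iff restrict_def)
qed

lemma generate_flat_act:
  assumes su: "flat_type s u"
  shows "generate (BijGroup UNIV) {flat_act s u (1, 0, 0), flat_act s u (0, 1, 0), flat_act s u
      (0, 0, 1)} =
    range (flat_act s u)"
proof -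
  interpret group_hom "flat_group s u" "BijGroup UNIV" "flat_act s u"
    by (intro group_hom.intro group_flat_group[OF su] group_BijGroup group_hom_axioms.intro
        flat_act_hom[OF su])
  show ?thesis
    using generate_img[of "{(1, 0, 0), (0, 1, 0), (0, 0, 1)}"]
        by (simp add: flat_group_generate[OF su])
qed

lemma G1_eq: "G1 = orbit_space (range (flat_act 1 0))"
proof -
  have "(\<lambda>(x, y, z). (x + 1, y, z)) = flat_act 1 0 (1, 0, 0)"
      "(\<lambda>(x, y, z). (x, y + 1, z)) = flat_act 1 0 (0, 1, 0)"
    "(\<lambda>(x, y, z). (x, y, z + 1)) = flat_act 1 0 (0, 0, 1)"
    by (auto simp: flat_act_def fun_eq_iff)
  then show ?thesis unfolding G1_def by (simp add: generate_flat_act)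
qed

lemma B1_eq: "B1 = orbit_space (range (flat_act (- 1) 0))"
proof -
  have gens: "B1_a = flat_act (- 1) 0 (1, 0, 0)" "B1_b = flat_act (- 1) 0 (0, 1, 0)"
      "B1_c = flat_act (- 1) 0 (0, 0, 1)"
    by (auto simp: flat_act_def B1_a_def B1_b_def B1_c_def fun_eq_iff)
  show ?thesis unfolding B1_def gens by (subst generate_flat_act) simp_all
qed

lemma B2_eq: "B2 = orbit_space (range (flat_act (- 1) 1))"
proof -
  have gens: "B2_alpha = flat_act (- 1) 1 (1, 0, 0)" "B2_beta = flat_act (- 1) 1 (0, 1, 0)"
    "B2_gamma = flat_act (- 1) 1 (0, 0, 1)"
    by (auto simp: flat_act_def B2_alpha_def B2_beta_def B2_gamma_def fun_eq_iff)
  show ?thesis unfolding B2_def gens by (subst generate_flat_act) simp_all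
qed

lemma word_eq_move_right:
  "word_eq R (l @ gen_inv x) r \<Longrightarrow> word_eq R l (r @ gen x)"
  "word_eq R (l @ gen x) r \<Longrightarrow> word_eq R l (r @ gen_inv x)"
  using word_eq_cancel[of R l x False "[]"] word_eq_cancel[of R l x True "[]"]
    word_eq_append_right[of R "l @ gen_inv x" r "gen x"] word_eq_append_right[of R "l @ gen x" r
        "gen_inv x"]
  by (auto simp: gen_def gen_inv_def intro: word_eq_trans word_eq_sym)

text \<open>The three hypotheses on \<open>word_eq\<close> are the rules that govern normal forms;
  the two presentations differ in whether moving \<open>x\<close> past \<open>z\<close> leaves a
  \<open>y\<close> behind.\<close>

lemma presented_flat_group_iso:
  assumes u: "u = 0 \<or> u = 1" and xyz: "f x = (1, 0, 0)" "f y = (0, 1, 0)" "f z = (0, 0, 1)"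
      "UNIV = {x, y, z}"
    and R: "\<And>l r. (l, r) \<in> R \<Longrightarrow>
      group.eval_word (flat_group (- 1) u) f l = group.eval_word (flat_group (- 1) u) f r"
    and zy: "word_eq R (gen z @ gen y) (gen y @ gen z)"
    and xy: "word_eq R (gen x @ gen y) (gen_inv y @ gen x)"
    and xz: "word_eq R (gen x @ gen z) ((if u = 0 then [] else gen y) @ gen z @ gen x)"
  shows "presented_group R \<cong> flat_group (- 1) u"
proof -
  let ?G = "flat_group (- 1) u" and ?P = "presented_group R"
  have su: "flat_type (- 1) u" using u by (auto simp: flat_type_def)
  interpret group ?G by (rule group_flat_group[OF su])
  interpret P: group ?P by (rule group_presented_group)
  define cl where "cl u = {w. word_eq R u w}" for u
  have clP [simp]: "cl v \<in> carrier ?P" for v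
    by (auto simp: cl_def carrier_presented_group)
  have cl_append: "cl v \<otimes>\<^bsub>?P\<^esub> cl w = cl (v @ w)" for v w
    by (simp add: cl_def mult_presented_group)
  have cl_Nil: "cl [] = \<one>\<^bsub>?P\<^esub>" by (simp add: cl_def one_presented_group)
  have cl_eq: "cl v = cl w" if "word_eq R v w" for v w
    using that by (simp add: cl_def word_class_eq_iff)
  have "cl (gen_inv v) = inv\<^bsub>?P\<^esub> cl (gen v)" for v
  proof (rule P.inv_equality[symmetric])
    show "cl (gen_inv v) \<otimes>\<^bsub>?P\<^esub> cl (gen v) = \<one>\<^bsub>?P\<^esub>"
      unfolding cl_append cl_Nil[symmetric]
      by (rule cl_eq) (use word_eq_cancel[of R "[]" v False "[]"] in \<open>simp add: gen_def
          gen_inv_def\<close>)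
  qed simp_all
  then have cl_inv: "cl (gen y) [^]\<^bsub>?P\<^esub> (- 1 :: int) = cl (gen_inv y)"
    by (simp add: P.int_pow_neg)
  have cl_u: "cl (gen y) [^]\<^bsub>?P\<^esub> u = cl (if u = 0 then [] else gen y)"
    using u by (auto simp: cl_Nil)
  have hom: "(\<lambda>(a, b, c). cl (gen y) [^]\<^bsub>?P\<^esub> b \<otimes>\<^bsub>?P\<^esub> cl (gen z) [^]\<^bsub>?P\<^esub> c
      \<otimes>\<^bsub>?P\<^esub> cl (gen x) [^]\<^bsub>?P\<^esub> a) \<in> hom ?G ?P"
    using cl_eq[OF zy] cl_eq[OF xy] cl_eq[OF xz]
    by (intro P.flat_group_universal[OF su]) (simp_all add: cl_append cl_inv cl_u)
  show ?thesis
  proof (rule presented_group_iso[OF _ R _ hom])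
    show "\<exists>w. g = eval_word f w" for g
    proof (rule flat_group_eval_word_surj[OF su])
      show "{(1, 0, 0), (0, 1, 0), (0, 0, 1)} \<subseteq> range f"
        using rangeI[of f x] rangeI[of f y] rangeI[of f z] by (simp add: xyz)
    qed
    show "(case f v of (a, b, c) \<Rightarrow> cl (gen y) [^]\<^bsub>?P\<^esub> b \<otimes>\<^bsub>?P\<^esub> cl (gen z) [^]\<^bsub>?P\<^esub> c
      \<otimes>\<^bsub>?P\<^esub> cl (gen x) [^]\<^bsub>?P\<^esub> a) = {w. word_eq R (gen v) w}" for v
    proof -
      have "v \<in> {x, y, z}" using xyz(4) by blast
      then show ?thesis using xyz(1-3) by (auto simp flip: cl_def)
    qed
  qed simp
qed

lemma pi1_B1_iso: "pi1_B1 \<cong> flat_group (- 1) 0"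
  unfolding pi1_B1_def
proof (rule presented_flat_group_iso[where f = "case_gen_B1 (1, 0, 0) (0, 1, 0) (0, 0, 1)"
      and x = Gen_a and y = Gen_b and z = Gen_c], goal_cases)
  case 5
  show ?case by (auto intro: gen_B1.exhaust)
next
  interpret group "flat_group (- 1) 0" by (rule group_flat_group) simp
  let ?R = "{(gen Gen_c @ gen Gen_a @ gen_inv Gen_c @ gen_inv Gen_a, gen Gen_c @ gen Gen_b @
      gen_inv Gen_c @ gen_inv Gen_b),
     (gen Gen_c @ gen Gen_b @ gen_inv Gen_c @ gen_inv Gen_b, []),
     (gen Gen_a @ gen Gen_b @ gen_inv Gen_a @ gen Gen_b, [])}"
  have rel: "word_eq ?R l r" if "(l, r) \<in> ?R" for l r
    using word_eq_rel[OF that, of "[]" "[]"] by simp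
  {
    case 6
    then show ?case
      by (auto simp: gen_def gen_inv_def inv_flat_group mult_flat_group one_flat_group twist_def)
  next
    case 7
    have "word_eq ?R (((gen Gen_c @ gen Gen_b) @ gen_inv Gen_c) @ gen_inv Gen_b) []"
      by (rule rel) simp
    from word_eq_move_right(1)[OF word_eq_move_right(1)[OF this]] show ?case by simp
  next
    case 8
    have "word_eq ?R (((gen Gen_a @ gen Gen_b) @ gen_inv Gen_a) @ gen Gen_b) []"
      by (rule rel) simp
    from word_eq_move_right(1)[OF word_eq_move_right(2)[OF this]] show ?case by simp
  next
    case 9
    have "word_eq ?R (((gen Gen_c @ gen Gen_a) @ gen_inv Gen_c) @ gen_inv Gen_a) []"
      by (rule word_eq_trans[OF rel rel]) auto
    from word_eq_move_right(1)[OF word_eq_move_right(1)[OF this]] show ?case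
      by (auto intro: word_eq_sym)
  }
qed simp_all

lemma pi1_B2_iso: "pi1_B2 \<cong> flat_group (- 1) 1"
  unfolding pi1_B2_def
proof (rule presented_flat_group_iso[where f = "case_gen_B2 (1, 0, 0) (0, 1, 0) (0, 0, 1)"
      and x = Gen_alpha and y = Gen_beta and z = Gen_gamma], goal_cases)
  case 5
  show ?case by (auto intro: gen_B2.exhaust)
next
  interpret group "flat_group (- 1) 1" by (rule group_flat_group) simp
  let ?R = "{(gen Gen_gamma @ gen Gen_beta @ gen_inv Gen_gamma,
        gen Gen_alpha @ gen Gen_gamma @ gen_inv Gen_alpha @ gen_inv Gen_gamma),
     (gen Gen_alpha @ gen Gen_gamma @ gen_inv Gen_alpha @ gen_inv Gen_gamma, gen Gen_beta),
     (gen Gen_alpha @ gen Gen_beta @ gen_inv Gen_alpha, gen_inv Gen_beta)}"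
  have rel: "word_eq ?R l r" if "(l, r) \<in> ?R" for l r
    using word_eq_rel[OF that, of "[]" "[]"] by simp
  {
    case 6
    then show ?case
      by (auto simp: gen_def gen_inv_def inv_flat_group mult_flat_group one_flat_group twist_def)
  next
    case 7
    have "word_eq ?R ((gen Gen_gamma @ gen Gen_beta) @ gen_inv Gen_gamma) (gen Gen_beta)"
      by (rule word_eq_trans[OF rel rel]) auto
    from word_eq_move_right(1)[OF this] show ?case by simp
  next
    case 8
    have "word_eq ?R ((gen Gen_alpha @ gen Gen_beta) @ gen_inv Gen_alpha) (gen_inv Gen_beta)"
      by (rule rel) simp
    from word_eq_move_right(1)[OF this] show ?case by simp
  next
    case 9
    have "word_eq ?R (((gen Gen_alpha @ gen Gen_gamma) @ gen_inv Gen_alpha) @ gen_inv Gen_gamma)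
        (gen Gen_beta)"
      by (rule rel) simp
    from word_eq_move_right(1)[OF word_eq_move_right(1)[OF this]] show ?case by simp
  }
qed simp_all

subsection \<open>Isomorphism types\<close>

lemma flat_iso_unique:
  assumes "flat_type s u" "flat_type s' u'" and iso: "flat_group s u \<cong> flat_group s' u'"
  shows "s = s'" "u = u'"
proof -
  have not1: "\<not> flat_group 1 0 \<cong> flat_group (- 1) v" if "flat_type (- 1) v" for v
  proof
    assume "flat_group 1 0 \<cong> flat_group (- 1) v"
    then obtain \<phi> where \<phi>: "\<phi> \<in> hom (flat_group 1 0) (flat_group (- 1) v)" "surj \<phi>"
      by (auto simp: is_iso_def iso_def bij_betw_def)
    obtain x y where xy: "\<phi> x = (1, 0, 0)" "\<phi> y = (0, 1, 0)" using \<phi>(2) by (metis surjD)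
    have "x \<otimes>\<^bsub>flat_group 1 0\<^esub> y = y \<otimes>\<^bsub>flat_group 1 0\<^esub> x"
      by (cases x; cases y) (simp add: mult_flat_group twist_def)
    then have "\<phi> x \<otimes>\<^bsub>flat_group (- 1) v\<^esub> \<phi> y = \<phi> y \<otimes>\<^bsub>flat_group (- 1) v\<^esub> \<phi> x"
      using hom_mult[OF \<phi>(1), of x y] hom_mult[OF \<phi>(1), of y x] by simp
    then show False by (simp add: xy mult_flat_group twist_def)
  qed
  \<comment> \<open>\<open>\<beta>\<close> is conjugate to its inverse. In the second group every such element is a commutator,
    but in the first one commutators have an even second coordinate.\<close>
  have not2: "\<not> flat_group (- 1) 0 \<cong> flat_group (- 1) 1"
  proof
    let ?G = "flat_group (- 1) 0" and ?H = "flat_group (- 1) 1"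
    assume "?G \<cong> ?H"
    then obtain \<phi> where \<phi>: "\<phi> \<in> hom ?G ?H" "inj \<phi>" "surj \<phi>"
      by (auto simp: is_iso_def iso_def bij_betw_def)
    have mult: "\<phi> (x \<otimes>\<^bsub>?G\<^esub> y) = \<phi> x \<otimes>\<^bsub>?H\<^esub> \<phi> y" for x y using hom_mult[OF \<phi>(1)] by simp
    let ?\<beta> = "(0, 1, 0) :: int \<times> int \<times> int" and ?\<alpha> = "(1, 0, 0) :: int \<times> int \<times> int"
    \<comment> \<open>The relation \<beta> \<alpha> \<beta> = \<alpha> survives under
      \<open>\<phi>\<close>. The first and the third coordinate are additive, so both vanish for the
      image of \<beta>.\<close>
    have "?\<beta> \<otimes>\<^bsub>?G\<^esub> ?\<alpha> \<otimes>\<^bsub>?G\<^esub> ?\<beta> = ?\<alpha>" by (simp add: mult_flat_group twist_def)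
    then have *: "\<phi> ?\<beta> \<otimes>\<^bsub>?H\<^esub> \<phi> ?\<alpha> \<otimes>\<^bsub>?H\<^esub> \<phi> ?\<beta> = \<phi> ?\<alpha>" by (metis mult)
    obtain a b c where abc: "\<phi> ?\<beta> = (a, b, c)" by (metis prod_cases3)
    obtain a' b' c' where "\<phi> ?\<alpha> = (a', b', c')" by (metis prod_cases3)
    with * abc have "a = 0" "c = 0" by (auto simp: mult_flat_group)
    \<comment> \<open>In the second group \<alpha> \<gamma>^b = \<beta>^b \<gamma>^b \<alpha>, so
      these preimages exhibit \<beta> as a commutator in the first group.\<close>
    obtain g h where gh: "\<phi> g = (1, 0, 0)" "\<phi> h = (0, 0, b)" using \<phi>(3) by (metis surjD)
    have "\<phi> ?\<beta> \<otimes>\<^bsub>?H\<^esub> \<phi> h \<otimes>\<^bsub>?H\<^esub> \<phi> g = \<phi> g \<otimes>\<^bsub>?H\<^esub> \<phi> h"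
      by (simp add: gh abc \<open>a = 0\<close> \<open>c = 0\<close> mult_flat_group twist_def)
    then have "?\<beta> \<otimes>\<^bsub>?G\<^esub> h \<otimes>\<^bsub>?G\<^esub> g = g \<otimes>\<^bsub>?G\<^esub> h"
      using \<phi>(2) by (simp flip: mult add: inj_eq)
    moreover obtain a1 b1 c1 where "g = (a1, b1, c1)" by (metis prod_cases3)
    moreover obtain a2 b2 c2 where "h = (a2, b2, c2)" by (metis prod_cases3)
    \<comment> \<open>Modulo 2 the signs disappear and the equation reads 1 = 0.\<close>
    ultimately have "1 + b2 + twist (- 1) 0 a2 b1 c1 = b1 + twist (- 1) 0 a1 b2 c2"
      by (simp add: mult_flat_group twist_def split: if_splits)
    then show False by (auto simp: twist_def split: if_splits) presburger+
  qed
  have sym: "flat_group s' u' \<cong> flat_group s u"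
    using group.iso_sym[OF group_flat_group[OF assms(1)]] iso by (auto simp: is_iso_def)
  show "s = s'" "u = u'"
    using assms(1,2) iso sym not1[of 0] not1[of 1] not2 by (auto simp: flat_type_def)
qed

section \<open>Subgroups of finite index\<close>

abbreviation amphi :: "(int \<times> int \<times> int) monoid" where "amphi \<equiv> flat_group (- 1) 1"

lemma group_amphi: "group amphi"
  by (rule group_flat_group) simp

interpretation amphi: group amphi
  by (rule group_amphi)

lemma inv_amphi: "inv\<^bsub>amphi\<^esub> (a, b, c) = (- a, - twist (- 1) 1 a b c, - c)"
  by (rule inv_flat_group) simp

lemma flat_hom_range_subset:
  assumes su: "flat_type s u" and \<psi>: "\<psi> \<in> hom (flat_group s u) amphi" and K: "subgroup K amphi"
    and gens: "\<psi> (1, 0, 0) \<in> K" "\<psi> (0, 1, 0) \<in> K" "\<psi> (0, 0, 1) \<in> K"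
  shows "range \<psi> \<subseteq> K"
proof
  fix y assume "y \<in> range \<psi>"
  then obtain a b c where y: "y = \<psi> (a, b, c)" by auto
  interpret F: group "flat_group s u" by (rule group_flat_group[OF su])
  have pow: "\<psi> (x [^]\<^bsub>flat_group s u\<^esub> (i :: int)) = \<psi> x [^]\<^bsub>amphi\<^esub> i" for x i
    by (rule hom_int_pow[OF \<psi> _ F.is_group group_amphi]) simp
  have mult: "\<psi> (x \<otimes>\<^bsub>flat_group s u\<^esub> y) = \<psi> x \<otimes>\<^bsub>amphi\<^esub> \<psi> y" for x y
    using hom_mult[OF \<psi>] by simp
  have "y = \<psi> (0, 1, 0) [^]\<^bsub>amphi\<^esub> b \<otimes>\<^bsub>amphi\<^esub> \<psi> (0, 0, 1) [^]\<^bsub>amphi\<^esub> c \<otimes>\<^bsub>amphi\<^esub> \<psi> (1, 0, 0)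
      [^]\<^bsub>amphi\<^esub> a"
    unfolding y flat_group_normal_form[OF su, of a b c] by (simp only: mult pow)
  then show "y \<in> K"
    using gens amphi.subgroup_int_pow_closed[OF K] subgroup.m_closed[OF K] by simp
qed

text \<open>Hermite normal form: \<open>A\<close>, \<open>e\<close> and \<open>d\<close> generate the successive projections of \<open>K\<close>,
  first to the coordinate \<open>a\<close>, then to \<open>c\<close> on the part with \<open>a = 0\<close>, then to \<open>b\<close> on the part
  with \<open>a = c = 0\<close>.\<close>

definition hermite :: "(int \<times> int \<times> int) set \<Rightarrow> int \<Rightarrow> int \<Rightarrow> int \<Rightarrow> int \<Rightarrow> int \<Rightarrow> int \<Rightarrow> bool" where
  "hermite K A t1 t2 e b0 d \<longleftrightarrow> A > 0 \<and> e > 0 \<and> d > 0 \<and> (A, t1, t2) \<in> K \<and> (0, b0, e) \<in> K \<and>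
      (0, d, 0) \<in> K \<and>
     (\<forall>a b c. (a, b, c) \<in> K \<longrightarrow> A dvd a) \<and> (\<forall>b c. (0, b, c) \<in> K \<longrightarrow> e dvd c) \<and>
         (\<forall>b. (0, b, 0) \<in> K \<longrightarrow> d dvd b)"

lemma amphi_pow_0: "(0, b, c) [^]\<^bsub>amphi\<^esub> (i :: int) = (0, i * b, i * c)"
  by (rule flat_pow) simp

lemma fst_amphi_pow: "fst (x [^]\<^bsub>amphi\<^esub> (i :: int)) = i * fst x"
proof -
  have mult: "fst (x \<otimes>\<^bsub>amphi\<^esub> y) = fst x + fst y" for x y
    by (cases x; cases y) (simp add: mult_flat_group)
  show ?thesis
  proof (induction i rule: int_induct[where k = 0])
    case (step1 i)
    then show ?case by (simp add: amphi.int_pow_mult mult algebra_simps)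
  next
    case (step2 i)
    have "fst (x [^]\<^bsub>amphi\<^esub> (i - 1) \<otimes>\<^bsub>amphi\<^esub> x) = fst (x [^]\<^bsub>amphi\<^esub> i)"
      using amphi.int_pow_mult[of x "i - 1" 1] by simp
    then show ?case using step2 by (simp add: mult algebra_simps)
  qed (simp add: one_flat_group)
qed

lemma hermite_lattice:
  assumes K: "subgroup K amphi" and h: "hermite K A t1 t2 e b0 d"
  shows "(0, j * b0 + i * d, j * e) \<in> K"
proof -
  have "(0, b0, e) [^]\<^bsub>amphi\<^esub> j \<otimes>\<^bsub>amphi\<^esub> (0, d, 0) [^]\<^bsub>amphi\<^esub> i \<in> K"
    using h subgroup.m_closed[OF K] amphi.subgroup_int_pow_closed[OF K] by (simp add: hermite_def)
  then show ?thesis by (simp add: amphi_pow_0 mult_flat_group twist_def)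
qed

lemma hermite_lattice_iff:
  assumes K: "subgroup K amphi" and h: "hermite K A t1 t2 e b0 d"
  shows "(0, b, c) \<in> K \<longleftrightarrow> (\<exists>i j. b = j * b0 + i * d \<and> c = j * e)"
proof
  assume bc: "(0, b, c) \<in> K"
  then obtain j where j: "c = j * e" using h unfolding hermite_def by (metis dvd_def mult.commute)
  have "(0, - j * b0 + 0 * d, - j * e) \<in> K" by (rule hermite_lattice[OF K h])
  from subgroup.m_closed[OF K this bc] have "(0, b - j * b0, 0) \<in> K"
    by (simp add: mult_flat_group twist_def j)
  then obtain i where "b - j * b0 = i * d" using h unfolding hermite_def
      by (metis dvd_def mult.commute)
  then have "b = j * b0 + i * d" by simp
  then show "\<exists>i j. b = j * b0 + i * d \<and> c = j * e" using j by blast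
qed (use hermite_lattice[OF K h] in blast)

text \<open>The box with sides \<open>A\<close>, \<open>d\<close>, \<open>e\<close> is a set of
  coset representatives: left multiplication by a power of the generator over \<open>A\<close>
  reduces the first coordinate, then a lattice element reduces the other two.\<close>

lemma hermite_card_rcosets:
  assumes K: "subgroup K amphi" and h: "hermite K A t1 t2 e b0 d"
  shows "card (rcosets\<^bsub>amphi\<^esub> K) = nat (A * d * e)"
proof -
  let ?B = "{0..<A} \<times> {0..<d} \<times> {0..<e}"
  have pos: "A > 0" "e > 0" "d > 0" and g: "(A, t1, t2) \<in> K"
    and dvd: "\<And>a b c. (a, b, c) \<in> K \<Longrightarrow> A dvd a" "\<And>b c. (0, b, c) \<in> K \<Longrightarrow> e dvd c"
        "\<And>b. (0, b, 0) \<in> K \<Longrightarrow> d dvd b"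
    using h unfolding hermite_def by blast+
  have small: "x = y" if "m dvd (x - y)" "0 \<le> x" "x < m" "0 \<le> y" "y < m" for x y m :: int
    using that by (metis mod_eq_dvd_iff mod_pos_pos_trivial)
  have "bij_betw (\<lambda>x. K #>\<^bsub>amphi\<^esub> x) ?B (rcosets\<^bsub>amphi\<^esub> K)"
  proof (rule bij_betw_imageI)
    show "inj_on (\<lambda>x. K #>\<^bsub>amphi\<^esub> x) ?B"
    proof (rule inj_onI)
      fix x y assume x: "x \<in> ?B" and y: "y \<in> ?B" and eq: "K #>\<^bsub>amphi\<^esub> x = K #>\<^bsub>amphi\<^esub> y"
      obtain a b c where xe: "x = (a, b, c)" by (metis prod_cases3)
      obtain a' b' c' where ye: "y = (a', b', c')" by (metis prod_cases3)
      have "x \<in> K #>\<^bsub>amphi\<^esub> y" using amphi.rcos_self[OF _ K, of x] eq by simp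
      then obtain k where k: "k \<in> K" "x = k \<otimes>\<^bsub>amphi\<^esub> y" by (auto simp: r_coset_def)
      obtain k1 k2 k3 where ke: "k = (k1, k2, k3)" by (metis prod_cases3)
      have "a = a'"
        using small[of A a a'] dvd(1)[of k1 k2 k3] k x y by (simp add: xe ye ke mult_flat_group)
      then have k1: "k1 = 0" using k(2) by (simp add: xe ye ke mult_flat_group)
      have "c = c'"
        using small[of e c c'] dvd(2)[of k2 k3] k x y by (simp add: xe ye ke k1 mult_flat_group)
      then have k3: "k3 = 0" using k(2) by (simp add: xe ye ke mult_flat_group)
      have "b = b'"
        using small[of d b b'] dvd(3)[of k2] k x y
          by (simp add: xe ye ke k1 k3 mult_flat_group twist_def)
      then show "x = y" using \<open>a = a'\<close> \<open>c = c'\<close> by (simp add: xe ye)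
    qed
    show "(\<lambda>x. K #>\<^bsub>amphi\<^esub> x) ` ?B = rcosets\<^bsub>amphi\<^esub> K"
    proof
      show "rcosets\<^bsub>amphi\<^esub> K \<subseteq> (\<lambda>x. K #>\<^bsub>amphi\<^esub> x) ` ?B"
      proof
        fix R assume "R \<in> rcosets\<^bsub>amphi\<^esub> K"
        then obtain x where R: "R = K #>\<^bsub>amphi\<^esub> x" by (auto simp: RCOSETS_def)
        have absorb: "K #>\<^bsub>amphi\<^esub> (k \<otimes>\<^bsub>amphi\<^esub> y) = K #>\<^bsub>amphi\<^esub> y" if "k \<in> K" for k y
          using amphi.coset_mult_assoc[of K k y] amphi.coset_join2[OF _ K that] by simp
        obtain a b c where x: "x = (a, b, c)" by (metis prod_cases3)
        let ?k = "(A, t1, t2) [^]\<^bsub>amphi\<^esub> (- (a div A))"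
        have k: "?k \<in> K" using amphi.subgroup_int_pow_closed[OF K g] .
        obtain a' b' c' where x': "?k \<otimes>\<^bsub>amphi\<^esub> x = (a', b', c')" by (metis prod_cases3)
        have "a' = fst (?k \<otimes>\<^bsub>amphi\<^esub> x)" by (simp only: x' fst_conv)
        also have "\<dots> = fst ?k + a" by (cases ?k) (simp add: x mult_flat_group)
        also have "\<dots> = a mod A" by (simp add: fst_amphi_pow minus_div_mult_eq_mod algebra_simps)
        finally have a': "a' = a mod A" .
        define j where "j = - (c' div e)"
        define i where "i = - ((b' + j * b0) div d)"
        have "(0, j * b0 + i * d, j * e) \<otimes>\<^bsub>amphi\<^esub> (a', b', c') =
          (a', (b' + j * b0) mod d, c' mod e)"
          by (simp add: mult_flat_group twist_def i_def j_def minus_div_mult_eq_mod algebra_simps)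
        then have "K #>\<^bsub>amphi\<^esub> x = K #>\<^bsub>amphi\<^esub> (a mod A, (b' + j * b0) mod d, c' mod e)"
          using absorb[OF k, of x] absorb[OF hermite_lattice[OF K h], of j i "(a', b', c')"] x'
            a' by simp
        moreover have "(a mod A, (b' + j * b0) mod d, c' mod e) \<in> ?B" using pos by simp
        ultimately show "R \<in> (\<lambda>x. K #>\<^bsub>amphi\<^esub> x) ` ?B" unfolding R by blast
      qed
    qed (auto simp: RCOSETS_def)
  qed
  then have "card (rcosets\<^bsub>amphi\<^esub> K) = card ?B" by (metis bij_betw_same_card)
  also have "\<dots> = nat (A * d * e)" using pos by (simp add: nat_mult_distrib)
  finally show ?thesis .
qed

section \<open>Existence of Hermite generators\<close>

lemma int_subgroup_generator:
  fixes S :: "int set"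
  assumes diff: "\<And>x y. x \<in> S \<Longrightarrow> y \<in> S \<Longrightarrow> x - y \<in> S" and a: "a \<in> S" "a > 0"
  obtains m where "m > 0" "m \<in> S" "\<And>x. x \<in> S \<Longrightarrow> m dvd x"
proof -
  define m where "m = int (LEAST k. int k \<in> S \<and> k > 0)"
  have "int (nat a) \<in> S \<and> nat a > 0" using a by simp
  then have m: "m \<in> S" "m > 0"
    unfolding m_def using LeastI[of "\<lambda>k. int k \<in> S \<and> k > 0"] by fastforce+
  have least: "m \<le> k" if "k \<in> S" "k > 0" for k
    using Least_le[of "\<lambda>k. int k \<in> S \<and> k > 0" "nat k"] that by (simp add: m_def)
  have zero: "0 \<in> S" using diff[OF m(1) m(1)] by simp
  have neg: "- x \<in> S" if "x \<in> S" for x using diff[OF zero that] by simp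
  have add: "x + y \<in> S" if "x \<in> S" "y \<in> S" for x y using diff[OF that(1) neg[OF that(2)]] by simp
  have mult: "i * m \<in> S" for i
  proof (induction i rule: int_induct[where k = 0])
    case (step1 i) then show ?case using add[OF step1(2) m(1)] by (simp add: algebra_simps)
  next
    case (step2 i) then show ?case using diff[OF step2(2) m(1)] by (simp add: algebra_simps)
  qed (simp add: zero)
  have "m dvd x" if "x \<in> S" for x
  proof -
    have "x mod m \<in> S" using diff[OF that mult[of "x div m"]] by (simp add: minus_div_mult_eq_mod)
    then have "\<not> x mod m > 0" using least[of "x mod m"] pos_mod_bound[OF m(2), of x] by linarith
    then show ?thesis using pos_mod_sign[OF m(2), of x] by (simp add: dvd_eq_mod_eq_0)
  qed
  then show ?thesis using that m by blast
qed

lemma (in group) finite_index_pow_mem: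
  assumes K: "subgroup K G" and fin: "finite (rcosets K)" and x: "x \<in> carrier G"
  obtains n :: nat where "n > 0" "x [^] n \<in> K"
proof -
  have "range (\<lambda>n::nat. K #> x [^] n) \<subseteq> rcosets K" using x by (auto simp: RCOSETS_def)
  then have "\<not> inj (\<lambda>n::nat. K #> x [^] n)"
    using fin finite_subset infinite_UNIV_nat by (metis finite_imageD)
  then obtain i j :: nat where ij: "i < j" "K #> x [^] i = K #> x [^] j"
    unfolding inj_def by (metis linorder_neqE_nat)
  have "x [^] j \<in> K #> x [^] i" using rcos_self[OF _ K, of "x [^] j"] x ij(2) by simp
  then obtain k where k: "k \<in> K" "x [^] j = k \<otimes> x [^] i" by (auto simp: r_coset_def)
  have "x [^] j = x [^] (j - i) \<otimes> x [^] i" using x ij(1) by (simp add: nat_pow_mult)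
  then have "x [^] (j - i) = k"
    using k x subgroup.mem_carrier[OF K] by (metis nat_pow_closed right_cancel)
  then show ?thesis using that[of "j - i"] ij(1) k(1) by simp
qed

text \<open>Finite index puts a positive power of each of \<alpha>, \<gamma>, \<beta> into
  \<open>K\<close>, so the three successive groups of integers are nonzero and have positive
  generators.\<close>

lemma hermite_exists:
  assumes K: "subgroup K amphi" and fin: "finite (rcosets\<^bsub>amphi\<^esub> K)"
  obtains A t1 t2 e b0 d where "hermite K A t1 t2 e b0 d"
proof -
  note clo = subgroup.m_closed[OF K] subgroup.m_inv_closed[OF K]
  have pow: "\<exists>n>0. x [^]\<^bsub>amphi\<^esub> int n \<in> K" for x
    using amphi.finite_index_pow_mem[OF K fin, of x]
        by (metis UNIV_I carrier_flat_group int_pow_int)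
  have diff: "x \<otimes>\<^bsub>amphi\<^esub> inv\<^bsub>amphi\<^esub> y \<in> K" if "x \<in> K" "y \<in> K" for x y
    using clo that by blast
  obtain n1 where n1: "n1 > 0" "(1, 0, 0) [^]\<^bsub>amphi\<^esub> int n1 \<in> K" using pow by blast
  have "int n1 = fst ((1, 0, 0) [^]\<^bsub>amphi\<^esub> int n1)" by (simp add: fst_amphi_pow)
  then have "int n1 \<in> fst ` K" using n1(2) by (metis imageI)
  moreover have "x - y \<in> fst ` K" if xy: "x \<in> fst ` K" "y \<in> fst ` K" for x y
  proof -
    obtain p q where "(x, p) \<in> K" "(y, q) \<in> K" using xy by auto
    then have "fst ((x, p) \<otimes>\<^bsub>amphi\<^esub> inv\<^bsub>amphi\<^esub> (y, q)) \<in> fst ` K" using diff by blast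
    then show ?thesis by (cases p; cases q) (simp add: inv_amphi mult_flat_group)
  qed
  ultimately obtain A where A: "A > 0" "A \<in> fst ` K" "\<And>x. x \<in> fst ` K \<Longrightarrow> A dvd x"
    using int_subgroup_generator[of "fst ` K" "int n1"] n1(1) by auto
  obtain t1 t2 where t: "(A, t1, t2) \<in> K" using A(2) by auto
  obtain n2 where n2: "n2 > 0" "(0, 0, 1) [^]\<^bsub>amphi\<^esub> int n2 \<in> K" using pow by blast
  have "x - y \<in> {c. \<exists>b. (0, b, c) \<in> K}" if xy: "x \<in> {c. \<exists>b. (0, b, c) \<in> K}"
      "y \<in> {c. \<exists>b. (0, b, c) \<in> K}" for x y
  proof -
    obtain p q where "(0, p, x) \<in> K" "(0, q, y) \<in> K" using xy by auto
    from diff[OF this] show ?thesis by (auto simp add: inv_amphi mult_flat_group twist_def)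
  qed
  moreover have "int n2 \<in> {c. \<exists>b. (0, b, c) \<in> K}" using n2(2) by (auto simp: amphi_pow_0)
  ultimately obtain e where e: "e > 0" "e \<in> {c. \<exists>b. (0, b, c) \<in> K}"
      "\<And>x. x \<in> {c. \<exists>b. (0, b, c) \<in> K} \<Longrightarrow> e dvd x"
    using int_subgroup_generator[of "{c. \<exists>b. (0, b, c) \<in> K}" "int n2"] n2(1) by auto
  obtain b0 where b0: "(0, b0, e) \<in> K" using e(2) by auto
  obtain n3 where n3: "n3 > 0" "(0, 1, 0) [^]\<^bsub>amphi\<^esub> int n3 \<in> K" using pow by blast
  have "x - y \<in> {b. (0, b, 0) \<in> K}" if "x \<in> {b. (0, b, 0) \<in> K}" "y \<in> {b. (0, b, 0) \<in> K}" for x y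
    using diff[of "(0, x, 0)" "(0, y, 0)"] that by (simp add: inv_amphi mult_flat_group twist_def)
  moreover have "int n3 \<in> {b. (0, b, 0) \<in> K}" using n3(2) by (auto simp: amphi_pow_0)
  ultimately obtain d where d: "d > 0" "d \<in> {b. (0, b, 0) \<in> K}"
      "\<And>x. x \<in> {b. (0, b, 0) \<in> K} \<Longrightarrow> d dvd x"
    using int_subgroup_generator[of "{b. (0, b, 0) \<in> K}" "int n3"] n3(1) by auto
  have "A dvd a" if "(a, b, c) \<in> K" for a b c
    using A(3)[of a] that by (metis fst_conv imageI)
  moreover have "e dvd c" if "(0, b, c) \<in> K" for b c using e(3) that by blast
  moreover have "d dvd b" if "(0, b, 0) \<in> K" for b using d(3) that by blast
  ultimately have "hermite K A t1 t2 e b0 d"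
    unfolding hermite_def using A(1) t e(1) b0 d(1,2) by blast
  then show ?thesis by (rule that)
qed

text \<open>Dividing an element of \<open>K\<close> by a power of the generator over
  \<open>A\<close> leaves a lattice element, and the other two generators span the lattice. So a
  homomorphism that takes the standard generators to these three has image \<open>K\<close>.\<close>

lemma hermite_eq_range:
  assumes K: "subgroup K amphi" and h: "hermite K A t1 t2 e b0 d"
    and su: "flat_type s u" and \<psi>: "\<psi> \<in> hom (flat_group s u) amphi"
      "\<psi> (1, 0, 0) = (A, t1, t2)" "\<psi> (0, 1, 0) = (0, d, 0)" "\<psi> (0, 0, 1) = (0, b0, e)"
  shows "K = range \<psi>"
proof
  show "range \<psi> \<subseteq> K"
    by (rule flat_hom_range_subset[OF su \<psi>(1) K]) (use h \<psi> in \<open>simp_all add: hermite_def\<close>)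
  interpret F: group "flat_group s u" by (rule group_flat_group[OF su])
  have pow: "\<psi> (x [^]\<^bsub>flat_group s u\<^esub> (i :: int)) = \<psi> x [^]\<^bsub>amphi\<^esub> i" for x i
    by (rule hom_int_pow[OF \<psi>(1) _ F.is_group group_amphi]) simp
  have mult: "\<psi> (x \<otimes>\<^bsub>flat_group s u\<^esub> y) = \<psi> x \<otimes>\<^bsub>amphi\<^esub> \<psi> y" for x y
    using hom_mult[OF \<psi>(1)] by simp
  show "K \<subseteq> range \<psi>"
  proof
    fix x assume x: "x \<in> K"
    obtain a b c where xe: "x = (a, b, c)" by (metis prod_cases3)
    obtain k where k: "a = k * A" using h x unfolding hermite_def xe by (metis dvd_def mult.commute)
    let ?p = "\<psi> ((1, 0, 0) [^]\<^bsub>flat_group s u\<^esub> k)"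
    have pe: "?p = (A, t1, t2) [^]\<^bsub>amphi\<^esub> k" by (simp add: pow \<psi>)
    then have p: "?p \<in> K" using h amphi.subgroup_int_pow_closed[OF K] by (simp add: hermite_def)
    obtain b' c' where y: "x \<otimes>\<^bsub>amphi\<^esub> inv\<^bsub>amphi\<^esub> ?p = (0, b', c')"
    proof -
      have "fst (x \<otimes>\<^bsub>amphi\<^esub> inv\<^bsub>amphi\<^esub> ?p) = 0"
        using fst_amphi_pow[of "(A, t1, t2)" k, folded pe]
        by (cases ?p) (simp add: xe inv_amphi mult_flat_group k)
      then show ?thesis using that by (metis prod.collapse)
    qed
    have "x \<otimes>\<^bsub>amphi\<^esub> inv\<^bsub>amphi\<^esub> ?p \<in> K"
      using x p subgroup.m_closed[OF K] subgroup.m_inv_closed[OF K] by blast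
    then obtain i j where ij: "b' = j * b0 + i * d" "c' = j * e"
      unfolding y hermite_lattice_iff[OF K h] by blast
    have "(0, b', c') = (0, d, 0) [^]\<^bsub>amphi\<^esub> i \<otimes>\<^bsub>amphi\<^esub> (0, b0, e) [^]\<^bsub>amphi\<^esub> j"
      by (simp add: amphi_pow_0 mult_flat_group twist_def ij)
    also have "\<dots> = \<psi> ((0, 1, 0) [^]\<^bsub>flat_group s u\<^esub> i \<otimes>\<^bsub>flat_group s u\<^esub> (0, 0, 1) [^]\<^bsub>flat_group
        s u\<^esub> j)"
      by (simp only: mult pow \<psi>)
    finally obtain z where z: "(0, b', c') = \<psi> z" by blast
    have "x = (0, b', c') \<otimes>\<^bsub>amphi\<^esub> ?p"
      by (simp add: y[symmetric] amphi.m_assoc)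
    then have "x = \<psi> (z \<otimes>\<^bsub>flat_group s u\<^esub> (1, 0, 0) [^]\<^bsub>flat_group s u\<^esub> k)" by (simp only: z mult)
    then show "x \<in> range \<psi>" by blast
  qed
qed

text \<open>The term \<open>(k div 2) * t\<close> below comes from \<open>(A, 0, t)\<^sup>2 = (2 A, t, 2 t)\<close> for odd \<open>A\<close>, and
  \<open>b = (e - u d) / 2\<close> solves \<open>\<sigma> (b, e) = (b, e) + u (d, 0)\<close>.\<close>

definition psi_even :: "int \<Rightarrow> int \<Rightarrow> int \<Rightarrow> int \<Rightarrow> int \<Rightarrow> int \<Rightarrow> int \<times> int \<times> int \<Rightarrow> int \<times> int \<times> int" where
  "psi_even A t1 t2 e b d = (\<lambda>(k, i, j). (k * A, k * t1 + j * b + i * d, k * t2 + j * e))"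

definition psi_odd :: "int \<Rightarrow> int \<Rightarrow> int \<Rightarrow> int \<Rightarrow> int \<Rightarrow> int \<times> int \<times> int \<Rightarrow> int \<times> int \<times> int" where
  "psi_odd A t e u d = (\<lambda>(k, i, j). (k * A, j * ((e - u * d) div 2) + i * d +
      (k div 2) * t, j * e + k * t))"

lemma psi_even_hom: "even A \<Longrightarrow> psi_even A t1 t2 e b d \<in> hom (flat_group 1 0) amphi"
  by (rule homI) (auto simp: psi_even_def mult_flat_group twist_def algebra_simps)

lemma psi_odd_hom:
  assumes "odd A" "even (e - u * d)"
  shows "psi_odd A t e u d \<in> hom (flat_group (- 1) u) amphi"
proof (rule homI)
  fix x y :: "int \<times> int \<times> int"
  obtain k i j where x: "x = (k, i, j)" by (metis prod_cases3)
  obtain k' i' j' where y: "y = (k', i', j')" by (metis prod_cases3)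
  obtain b where b: "e = u * d + 2 * b" using assms(2) by (metis add.commute diff_eq_eq dvdE)
  have div: "t * ((k' + k) div 2) = t * (k' div 2) + t * (k div 2)" if "even k"
    using that by (auto elim!: evenE simp: algebra_simps)
  \<comment> \<open>The half \<open>k div 2\<close> is not additive. For odd \<open>k\<close> the
    twist replaces the half of \<open>k'\<close> by \<open>k'\<close> minus this half, which is
    exactly the correction that the carry requires.\<close>
  have div': "t * ((k' + k) div 2) = t * (k div 2) + k' * t - t * (k' div 2)" if "odd k"
  proof -
    have "(k' + k) div 2 = k div 2 + k' - k' div 2" using that by presburger
    then show ?thesis by (simp only:) (simp add: algebra_simps)
  qed
  show "psi_odd A t e u d (x \<otimes>\<^bsub>flat_group (- 1) u\<^esub> y) =
      psi_odd A t e u d x \<otimes>\<^bsub>amphi\<^esub> psi_odd A t e u d y"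
    using assms(1) by (cases "even k") (simp_all add: x y b psi_odd_def mult_flat_group twist_def
        div div' algebra_simps)
qed simp

lemma inj_psi_even: "\<lbrakk>A \<noteq> 0; e \<noteq> 0; d \<noteq> 0\<rbrakk> \<Longrightarrow> inj (psi_even A t1 t2 e b d)"
  by (auto simp: inj_def psi_even_def)

lemma inj_psi_odd: "\<lbrakk>A \<noteq> 0; e \<noteq> 0; d \<noteq> 0\<rbrakk> \<Longrightarrow> inj (psi_odd A t e u d)"
  by (auto simp: inj_def psi_odd_def)

lemma hermite_psi_even:
  assumes "A > 0" "e > 0" "d > 0"
  shows "hermite (range (psi_even A t1 t2 e b d)) A t1 t2 e b d"
proof -
  have "psi_even A t1 t2 e b d (1, 0, 0) = (A, t1, t2)"
      "psi_even A t1 t2 e b d (0, 0, 1) = (0, b, e)"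
    "psi_even A t1 t2 e b d (0, 1, 0) = (0, d, 0)"
    by (simp_all add: psi_even_def)
  then have "(A, t1, t2) \<in> range (psi_even A t1 t2 e b d)"
      "(0, b, e) \<in> range (psi_even A t1 t2 e b d)"
    "(0, d, 0) \<in> range (psi_even A t1 t2 e b d)"
    by (metis rangeI)+
  then show ?thesis
    using assms by (auto simp: hermite_def psi_even_def)
qed

lemma hermite_psi_odd:
  assumes "A > 0" "e > 0" "d > 0"
  shows "hermite (range (psi_odd A t e u d)) A 0 t e ((e - u * d) div 2) d"
proof -
  have "psi_odd A t e u d (1, 0, 0) = (A, 0, t)"
      "psi_odd A t e u d (0, 0, 1) = (0, (e - u * d) div 2, e)"
    "psi_odd A t e u d (0, 1, 0) = (0, d, 0)"
    by (simp_all add: psi_odd_def)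
  then have "(A, 0, t) \<in> range (psi_odd A t e u d)"
      "(0, (e - u * d) div 2, e) \<in> range (psi_odd A t e u d)"
    "(0, d, 0) \<in> range (psi_odd A t e u d)"
    by (metis rangeI)+
  then show ?thesis
    using assms by (auto simp: hermite_def psi_odd_def)
qed

lemma subgroup_psi_even: "even A \<Longrightarrow> subgroup (range (psi_even A t1 t2 e b d)) amphi"
  using group_hom.img_is_subgroup[of "flat_group 1 0" amphi "psi_even A t1 t2 e b d"]
  by (simp add: group_hom_def group_hom_axioms_def psi_even_hom group_flat_group)

lemma subgroup_psi_odd:
  assumes "odd A" "even (e - u * d)" "flat_type (- 1) u"
  shows "subgroup (range (psi_odd A t e u d)) amphi"
  using group_hom.img_is_subgroup[of "flat_group (- 1) u" amphi "psi_odd A t e u d"] assms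
  by (simp add: group_hom_def group_hom_axioms_def psi_odd_hom group_flat_group)

section \<open>Affine models for the parametrised subgroups\<close>

lemma affine_homeomorphism:
  fixes p q e r m n w :: real
  assumes "p \<noteq> 0" "q \<noteq> 0" "e \<noteq> 0"
  shows "homeomorphic_map euclidean euclidean
    (\<lambda>(x, y, z). (p * x, q * y + r * z + m * x + w, e * z + n * x) :: E3)"
proof -
  let ?f = "\<lambda>v :: E3. (p * fst v, q * fst (snd v) + r * snd (snd v) + m * fst v +
      w, e * snd (snd v) + n * fst v)"
  let ?z = "\<lambda>v :: E3. (snd (snd v) - n * (fst v / p)) / e"
  let ?g = "\<lambda>v :: E3. (fst v / p, (fst (snd v) - r * ?z v - m * (fst v / p) - w) / q, ?z v)"
  have c: "continuous_on UNIV ?f" "continuous_on UNIV ?g"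
    using assms by (intro continuous_intros; simp)+
  have inv: "?g (?f v) = v" "?f (?g v) = v" for v
    using assms by (simp_all add: prod_eq_iff)
  have "homeomorphic_maps euclidean euclidean ?f ?g"
    unfolding homeomorphic_maps_def
    by (intro conjI ballI inv) (simp_all only: continuous_map_iff_continuous2 c)
  moreover have "(\<lambda>(x, y, z). (p * x, q * y + r * z + m * x + w, e * z + n * x)) = ?f"
    by (auto simp: fun_eq_iff)
  ultimately show ?thesis by (auto simp: homeomorphic_map_maps)
qed

lemma hom_image_iso:
  assumes "group G" and \<psi>: "\<psi> \<in> hom G H" "inj_on \<psi> (carrier G)"
  shows "H\<lparr>carrier := \<psi> ` carrier G\<rparr> \<cong> G"
proof -
  have "\<psi> \<in> iso G (H\<lparr>carrier := \<psi> ` carrier G\<rparr>)"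
    using \<psi> by (auto simp: iso_def hom_def bij_betw_def)
  then show ?thesis using group.iso_sym[OF assms(1)] unfolding is_iso_def by blast
qed

definition quotient_space :: "(int \<times> int \<times> int) set \<Rightarrow> E3 set topology" where
  "quotient_space K = orbit_space (flat_act (- 1) 1 ` K)"

definition model_space :: "int \<Rightarrow> int \<Rightarrow> E3 set topology" where
  "model_space s u = orbit_space (range (flat_act s u))"

interpretation amphi: free_action amphi "flat_act (- 1) 1"
  by (rule free_action_flat) simp

lemma psi_even_type:
  assumes "even A" "A > 0" "e > 0" "d > 0"
  shows "amphi\<lparr>carrier := range (psi_even A t1 t2 e b d)\<rparr> \<cong> flat_group 1 0"
    and "quotient_space (range (psi_even A t1 t2 e b d)) homeomorphic_space model_space 1 0"
proof -
  note hom = psi_even_hom[OF assms(1), of t1 t2 e b d]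
  show "amphi\<lparr>carrier := range (psi_even A t1 t2 e b d)\<rparr> \<cong> flat_group 1 0"
    using hom_image_iso[OF group_flat_group hom] inj_psi_even[of A e d] assms by simp
  \<comment> \<open>For even \<open>A\<close> the three generators act as translations, by (A, t1 -
    t2 / 2, t2), (0, d, 0) and (0, b - e / 2, e). These vectors are the columns for x, y and
    z.\<close>
  let ?h = "\<lambda>(x, y, z). (real_of_int A * x, real_of_int d * y + (b - e / 2) * z +
      (t1 - t2 / 2) * x + 0,
    real_of_int e * z + real_of_int t2 * x) :: E3"
  have "orbit_space (flat_act (- 1) 1 ` psi_even A t1 t2 e b d ` carrier (flat_group 1 0))
    homeomorphic_space orbit_space (flat_act 1 0 ` carrier (flat_group 1 0))"
  proof (rule homeomorphic_quot_equivariant[OF free_action_flat free_action_flat hom])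
    show "homeomorphic_map euclidean euclidean ?h"
      using assms by (intro affine_homeomorphism) auto
    show "?h (flat_act 1 0 g v) = flat_act (- 1) 1 (psi_even A t1 t2 e b d g) (?h v)" for g v
    proof -
      obtain k i j where g: "g = (k, i, j)" by (metis prod_cases3)
      obtain x y z where v: "v = (x, y, z)" by (metis prod_cases3)
      show ?thesis using assms(1) by (simp add: g v psi_even_def flat_act_def field_simps)
    qed
  qed simp_all
  then show "quotient_space (range (psi_even A t1 t2 e b d)) homeomorphic_space model_space 1 0"
    by (simp add: quotient_space_def model_space_def)
qed

lemma psi_odd_type:
  assumes "odd A" "A > 0" "e > 0" "d > 0" "flat_type (- 1) u" "even (e - u * d)"
  shows "amphi\<lparr>carrier := range (psi_odd A t e u d)\<rparr> \<cong> flat_group (- 1) u"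
    and "quotient_space (range (psi_odd A t e u d)) homeomorphic_space model_space (- 1) u"
proof -
  note hom = psi_odd_hom[OF assms(1,6), of t]
  show "amphi\<lparr>carrier := range (psi_odd A t e u d)\<rparr> \<cong> flat_group (- 1) u"
    using hom_image_iso[OF group_flat_group[OF assms(5)] hom] inj_psi_odd[of A e d] assms by simp
  \<comment> \<open>The generator over \<open>A\<close> sends the second coordinate y to - y - t /
    2, which fixes - t / 4: hence the shift. The vector (b, e) with b = (e - u d) / 2 translates y
    by - u d / 2, the shift of the model scaled by \<open>d\<close>, so this coordinate needs no
    shear.\<close>
  let ?h = "\<lambda>(x, y, z). (real_of_int A * x, real_of_int d * y + 0 * z + 0 * x + (- t / 4),
    real_of_int e * z + real_of_int t * x) :: E3"
  have "orbit_space (flat_act (- 1) 1 ` psi_odd A t e u d ` carrier (flat_group (- 1) u))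
    homeomorphic_space orbit_space (flat_act (- 1) u ` carrier (flat_group (- 1) u))"
  proof (rule homeomorphic_quot_equivariant[OF free_action_flat free_action_flat hom])
    show "homeomorphic_map euclidean euclidean ?h"
      using assms by (intro affine_homeomorphism) auto
    show "?h (flat_act (- 1) u g v) = flat_act (- 1) 1 (psi_odd A t e u d g) (?h v)" for g v
    proof -
      obtain k i j where g: "g = (k, i, j)" by (metis prod_cases3)
      obtain x y z where v: "v = (x, y, z)" by (metis prod_cases3)
      obtain b where b: "e = u * d + 2 * b" using assms(6) by (metis add.commute diff_eq_eq dvdE)
      show ?thesis
      proof (cases "even k")
        case True
        then obtain m where "k = 2 * m" by (rule evenE)
        then show ?thesis using assms(1) by (simp add: g v b psi_odd_def flat_act_def field_simps)
      next
        case False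
        then obtain m where "k = 2 * m + 1" by (rule oddE)
        then show ?thesis using assms(1) by (simp add: g v b psi_odd_def flat_act_def field_simps)
      qed
    qed
  qed (use assms in simp_all)
  then show "quotient_space (range (psi_odd A t e u d)) homeomorphic_space model_space (- 1) u"
    by (simp add: quotient_space_def model_space_def)
qed

text \<open>For odd \<open>a\<close> the shift 2 y - z takes every integer value, so the middle
  coordinate of such an element can be prescribed by conjugation. For even \<open>a\<close> only the
  parity of \<open>x\<close> has an effect.\<close>

lemma conj_amphi:
  "(x, y, z) \<otimes>\<^bsub>amphi\<^esub> (a, b, c) \<otimes>\<^bsub>amphi\<^esub> inv\<^bsub>amphi\<^esub> (x, y, z) =
    (a, (if even a then twist (- 1) 1 x b c else 2 * y - z + twist (- 1) 1 x b c), c)"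
  by (auto simp: inv_amphi mult_flat_group twist_def)

lemma conj_amphi_coords:
  assumes "(K, L) \<in> conj_rel amphi" "(a, b, c) \<in> K"
  obtains b' where "(a, b', c) \<in> L" "a = 0 \<Longrightarrow> c = 0 \<Longrightarrow> b' = b \<or> b' = - b"
proof -
  obtain x y z where L: "L = (\<lambda>k. (x, y, z) \<otimes>\<^bsub>amphi\<^esub> k \<otimes>\<^bsub>amphi\<^esub> inv\<^bsub>amphi\<^esub> (x, y, z)) ` K"
    using assms(1) unfolding amphi.conj_rel_iff by auto
  show ?thesis
    by (rule that[of "if even a then twist (- 1) 1 x b c else 2 * y - z + twist (- 1) 1 x b c"])
      (use assms(2) in \<open>auto simp: L image_iff conj_amphi twist_def intro!: bexI[of _ "(a, b, c)"]\<close>)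
qed

lemma conj_rel_sym_amphi:
  assumes "subgroup K amphi" "subgroup L amphi" "(K, L) \<in> conj_rel amphi"
  shows "(L, K) \<in> conj_rel amphi"
  using assms amphi.conj_rel_class_eq_iff[of K L] amphi.conj_rel_class_eq_iff[of L K] by simp

text \<open>Conjugation preserves the coordinates \<open>a\<close> and \<open>c\<close>, and
  \<open>b\<close> up to sign where both vanish, so the diagonal entries of the two groups divide
  each other. Two elements of \<open>L\<close> over \<open>A\<close> differ by a lattice element,
  which fixes \<open>t2\<close> modulo \<open>e\<close>.\<close>

lemma conj_hermite:
  assumes K: "subgroup K amphi" and L: "subgroup L amphi"
    and hK: "hermite K A t1 t2 e b d" and hL: "hermite L A' t1' t2' e' b' d'"
    and KL: "(K, L) \<in> conj_rel amphi"
  shows "A = A'" "e = e'" "d = d'" "e dvd t2 - t2'"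
proof -
  have half: "A' dvd A \<and> e' dvd e \<and> d' dvd d"
    if hK: "hermite K A t1 t2 e b d" and hL: "hermite L A' t1' t2' e' b' d'"
      and KL: "(K, L) \<in> conj_rel amphi"
    for K L A t1 t2 e b d A' t1' t2' e' b' d'
  proof -
    have K: "(A, t1, t2) \<in> K" "(0, b, e) \<in> K" "(0, d, 0) \<in> K" using hK
        by (simp_all add: hermite_def)
    have L: "\<And>a b c. (a, b, c) \<in> L \<Longrightarrow> A' dvd a" "\<And>b c. (0, b, c) \<in> L \<Longrightarrow> e' dvd c"
      "\<And>b. (0, b, 0) \<in> L \<Longrightarrow> d' dvd b" using hL unfolding hermite_def by blast+
    show ?thesis
      using conj_amphi_coords[OF KL K(1)] conj_amphi_coords[OF KL K(2)] conj_amphi_coords[OF KL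
          K(3)] L
      by (metis dvd_minus_iff)
  qed
  have pos: "A > 0" "e > 0" "d > 0" "A' > 0" "e' > 0" "d' > 0"
    using hK hL by (simp_all add: hermite_def)
  have 1: "A' dvd A \<and> e' dvd e \<and> d' dvd d" by (rule half[OF hK hL KL])
  have 2: "A dvd A' \<and> e dvd e' \<and> d dvd d'" by (rule half[OF hL hK conj_rel_sym_amphi[OF K L KL]])
  show A: "A = A'" and e: "e = e'" and "d = d'"
    using 1 2 pos by (auto intro: zdvd_antisym_nonneg)
  have "(A, t1, t2) \<in> K" using hK by (simp add: hermite_def)
  then obtain t1'' where t: "(A, t1'', t2) \<in> L" using conj_amphi_coords[OF KL] by metis
  have "(A', t1', t2') \<in> L" using hL by (simp add: hermite_def)
  then have "(A, t1'', t2) \<otimes>\<^bsub>amphi\<^esub> inv\<^bsub>amphi\<^esub> (A', t1', t2') \<in> L"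
    using t subgroup.m_closed[OF L] subgroup.m_inv_closed[OF L] by blast
  then have "e' dvd t2 - t2'"
    using hL by (auto simp: A inv_amphi mult_flat_group hermite_def)
  then show "e dvd t2 - t2'" using e by simp
qed

lemma hermite_normalize:
  assumes K: "subgroup K amphi" and h: "hermite K A t1 t2 e b0 d"
  obtains s1 s2 b where "hermite K A s1 s2 e b d" "0 \<le> s1" "s1 < d" "0 \<le> s2" "s2 < e" "0 \<le> b"
      "b < d"
proof -
  have pos: "e > 0" "d > 0" using h by (simp_all add: hermite_def)
  define j where "j = - (t2 div e)"
  define i where "i = - ((j * b0 + t1) div d)"
  have "(0, j * b0 + i * d, j * e) \<otimes>\<^bsub>amphi\<^esub> (A, t1, t2) \<in> K"
    using subgroup.m_closed[OF K hermite_lattice[OF K h]] h by (simp add: hermite_def)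
  also have "(0, j * b0 + i * d, j * e) \<otimes>\<^bsub>amphi\<^esub> (A, t1, t2) = (A, (j * b0 + t1) mod d, t2 mod e)"
    by (simp add: mult_flat_group twist_def i_def j_def minus_div_mult_eq_mod[symmetric])
  finally have 1: "(A, (j * b0 + t1) mod d, t2 mod e) \<in> K" .
  have "(0, 1 * b0 + (- (b0 div d)) * d, 1 * e) \<in> K" by (rule hermite_lattice[OF K h])
  then have 2: "(0, b0 mod d, e) \<in> K" by (simp add: minus_div_mult_eq_mod[symmetric])
  show ?thesis
    by (rule that[of "(j * b0 + t1) mod d" "t2 mod e" "b0 mod d"])
      (use h 1 2 pos in \<open>auto simp: hermite_def\<close>)
qed

lemma subgroup_conj_image:
  assumes "subgroup K amphi"
  shows "subgroup ((\<lambda>k. g \<otimes>\<^bsub>amphi\<^esub> k \<otimes>\<^bsub>amphi\<^esub> inv\<^bsub>amphi\<^esub> g) ` K) amphi"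
proof -
  interpret group_hom amphi amphi "\<lambda>k. g \<otimes>\<^bsub>amphi\<^esub> k \<otimes>\<^bsub>amphi\<^esub> inv\<^bsub>amphi\<^esub> g"
    by unfold_locales (rule amphi.conj_hom, simp)
  show ?thesis by (rule subgroup_img_is_subgroup[OF assms])
qed

text \<open>Conjugation by an element over odd \<open>A\<close> acts on the lattice as \<sigma> and
  preserves it. How far the vector (b0, e) is from being fixed by \<sigma>, modulo 2 d, separates
  the two amphicosms.\<close>

lemma odd_classification:
  assumes K: "subgroup K amphi" and h: "hermite K A t1 t e b0 d" and A: "odd A"
  obtains u where "u \<in> {0, 1}" "even (e - u * d)" "(K, range (psi_odd A t e u d)) \<in> conj_rel amphi"
proof -
  have g: "(A, t1, t) \<in> K" "(0, b0, e) \<in> K" and pos: "A > 0" "e > 0" "d > 0"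
    and dvd: "\<And>b. (0, b, 0) \<in> K \<Longrightarrow> d dvd b"
    using h unfolding hermite_def by blast+
  \<comment> \<open>This commutator is \<sigma> (b0, e) - (b0, e) = (e - 2 b0, 0) in the
    lattice.\<close>
  have "(A, t1, t) \<otimes>\<^bsub>amphi\<^esub> (0, b0, e) \<otimes>\<^bsub>amphi\<^esub> inv\<^bsub>amphi\<^esub> (A, t1, t) \<otimes>\<^bsub>amphi\<^esub> inv\<^bsub>amphi\<^esub> (0, b0,
      e) \<in> K"
    using g subgroup.m_closed[OF K] subgroup.m_inv_closed[OF K] by blast
  then have "(0, e - 2 * b0, 0) \<in> K"
    using A by (simp only: conj_amphi) (simp add: inv_amphi mult_flat_group twist_def)
  then obtain q where q: "e - 2 * b0 = d * q" using dvd by blast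
  \<comment> \<open>Adding a multiple of (d, 0) to (b0, e) changes e - 2 b0 by an even multiple of
    \<open>d\<close>, so only the parity of \<open>q\<close> remains.\<close>
  define u where "u = q mod 2"
  define b where "b = b0 + (q div 2) * d"
  have "q = 2 * (q div 2) + u" by (simp add: u_def)
  then have eb: "e - 2 * b = u * d" using q
      by (simp add: b_def algebra_simps) (metis distrib_left mult.commute mult.left_commute)
  then have b: "b = (e - u * d) div 2" "even (e - u * d)" by presburger+
  have u: "u \<in> {0, 1}" by (auto simp: u_def)
  have "(0, 1 * b0 + (q div 2) * d, 1 * e) \<in> K" by (rule hermite_lattice[OF K h])
  then have bK: "(0, b, e) \<in> K" by (simp add: b_def)
  \<comment> \<open>With y = 0 and z = t1 the shift 2 y - z equals - t1, which cancels the middle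
    coordinate of the generator over \<open>A\<close>.\<close>
  let ?c = "\<lambda>k. (0, 0, t1) \<otimes>\<^bsub>amphi\<^esub> k \<otimes>\<^bsub>amphi\<^esub> inv\<^bsub>amphi\<^esub> (0, 0, t1)"
  have c: "?c (a, b, c) = (a, (if even a then b else b - t1), c)" for a b c
    by (simp only: conj_amphi) (simp add: twist_def)
  have L: "subgroup (?c ` K) amphi" by (rule subgroup_conj_image[OF K])
  have mem: "(a, b, c) \<in> ?c ` K \<longleftrightarrow> (a, (if even a then b else b + t1), c) \<in> K" for a b c
  proof
    assume "(a, b, c) \<in> ?c ` K"
    then obtain a' b' c' where "(a', b', c') \<in> K" "(a, b, c) = ?c (a', b', c')" by auto
    then show "(a, (if even a then b else b + t1), c) \<in> K" unfolding c by auto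
  next
    assume k: "(a, (if even a then b else b + t1), c) \<in> K"
    have "(a, b, c) = ?c (a, (if even a then b else b + t1), c)" unfolding c by simp
    then show "(a, b, c) \<in> ?c ` K" using k by blast
  qed
  have "\<And>a b c. (a, b, c) \<in> K \<Longrightarrow> A dvd a" "\<And>b c. (0, b, c) \<in> K \<Longrightarrow> e dvd c" "(0, d, 0) \<in> K"
    using h unfolding hermite_def by blast+
  then have "hermite (?c ` K) A 0 t e b d"
    unfolding hermite_def using pos A g(1) bK dvd by (simp add: mem)
  then have "?c ` K = range (psi_odd A t e u d)"
    using A u b by (intro hermite_eq_range[OF L _ _ psi_odd_hom]) (auto simp: psi_odd_def
        flat_type_def)
  then have "(K, range (psi_odd A t e u d)) \<in> conj_rel amphi"
    unfolding amphi.conj_rel_iff by (intro bexI[of _ "(0, 0, t1)"]) auto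
  then show ?thesis using that u b(2) by blast
qed

text \<open>For even \<open>A\<close> the parameters describe \<open>K\<close> itself, and conjugacy
  is left to the later count of orbits; for odd \<open>A\<close> conjugation has already been used
  to remove \<open>t1\<close>. The residues are chosen in fixed ranges so that they can be
  counted.\<close>

theorem subgroup_classification:
  assumes K: "subgroup K amphi" and n: "card (rcosets\<^bsub>amphi\<^esub> K) = n" "n > 0"
  shows "(\<exists>A t1 t2 e b d. even A \<and> A > 0 \<and> e > 0 \<and> d > 0 \<and> nat (A * d * e) = n \<and>
      b \<in> {0..<d} \<and> t1 \<in> {0..<d} \<and> t2 \<in> {0..<e} \<and> K = range (psi_even A t1 t2 e b d)) \<or>
    (\<exists>A t e u d. odd A \<and> A > 0 \<and> e > 0 \<and> d > 0 \<and> nat (A * d * e) = n \<and> u \<in> {0, 1} \<and>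
      even (e - u * d) \<and> t \<in> {0..<e} \<and> (K, range (psi_odd A t e u d)) \<in> conj_rel amphi)"
proof -
  have "finite (rcosets\<^bsub>amphi\<^esub> K)" using n by (intro card_ge_0_finite) simp
  then obtain A t1' t2' e b' d where "hermite K A t1' t2' e b' d" using hermite_exists[OF K]
      by blast
  then obtain t1 t2 b where h: "hermite K A t1 t2 e b d"
      and range: "b \<in> {0..<d}" "t1 \<in> {0..<d}" "t2 \<in> {0..<e}"
    using hermite_normalize[OF K] by (metis atLeastLessThan_iff)
  have pos: "A > 0" "e > 0" "d > 0" using h by (simp_all add: hermite_def)
  have card: "nat (A * d * e) = n" using hermite_card_rcosets[OF K h] n by simp
  show ?thesis
  proof (cases "even A")
    case True
    then have "K = range (psi_even A t1 t2 e b d)"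
      by (intro hermite_eq_range[OF K h _ psi_even_hom]) (auto simp: psi_even_def)
    then show ?thesis using True pos card range by blast
  next
    case False
    then obtain u where "u \<in> {0, 1}" "even (e - u * d)"
        "(K, range (psi_odd A t2 e u d)) \<in> conj_rel amphi"
      using odd_classification[OF K h] by blast
    then show ?thesis
      using False pos card range
      by (intro disjI2 exI[of _ A] exI[of _ t2] exI[of _ e] exI[of _ u] exI[of _ d]) simp
  qed
qed

text \<open>Conjugate subgroups give equivalent coverings; the homeomorphism between them preserves
  fibres, whose sizes are the indices.\<close>

lemma conj_rel_type:
  assumes K: "subgroup K amphi" and L: "subgroup L amphi" and KL: "(K, L) \<in> conj_rel amphi"
  shows "amphi\<lparr>carrier := L\<rparr> \<cong> amphi\<lparr>carrier := K\<rparr>"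
      "quotient_space K homeomorphic_space quotient_space L"
    "card (rcosets\<^bsub>amphi\<^esub> L) = card (rcosets\<^bsub>amphi\<^esub> K)"
proof -
  obtain g where g: "L = (\<lambda>k. g \<otimes>\<^bsub>amphi\<^esub> k \<otimes>\<^bsub>amphi\<^esub> inv\<^bsub>amphi\<^esub> g) ` K"
    using KL unfolding amphi.conj_rel_iff by blast
  interpret K: group "amphi\<lparr>carrier := K\<rparr>" by (rule amphi.subgroup_imp_group[OF K])
  have "(\<lambda>k. g \<otimes>\<^bsub>amphi\<^esub> k \<otimes>\<^bsub>amphi\<^esub> inv\<^bsub>amphi\<^esub> g) \<in> hom (amphi\<lparr>carrier := K\<rparr>) amphi"
    using amphi.conj_hom[of g] by (auto simp: hom_def)
  moreover have "inj_on (\<lambda>k. g \<otimes>\<^bsub>amphi\<^esub> k \<otimes>\<^bsub>amphi\<^esub> inv\<^bsub>amphi\<^esub> g) K"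
    by (auto intro!: inj_onI)
  ultimately show "amphi\<lparr>carrier := L\<rparr> \<cong> amphi\<lparr>carrier := K\<rparr>"
    using hom_image_iso[OF K.is_group] g by fastforce
  have eqv: "covering_equiv (amphi.quot K, amphi.proj) (amphi.quot L, amphi.proj)"
    using KL amphi.covering_equiv_iff_conjugate[OF K L] by (auto simp: conj_rel_def)
  then obtain \<eta> where \<eta>: "homeomorphic_map (amphi.quot K) (amphi.quot L) \<eta>"
      "\<And>x. x \<in> topspace (amphi.quot K) \<Longrightarrow> amphi.proj x = amphi.proj (\<eta> x)"
    unfolding covering_equiv_iff by blast
  then show "quotient_space K homeomorphic_space quotient_space L"
    unfolding quotient_space_def using homeomorphic_space by blast
  have bij: "bij_betw \<eta> (topspace (amphi.quot K)) (topspace (amphi.quot L))"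
    using homeomorphic_imp_injective_map[OF \<eta>(1)] homeomorphic_imp_surjective_map[OF \<eta>(1)]
    by (simp add: bij_betw_def)
  have im: "\<eta> ` {x \<in> topspace (amphi.quot K). amphi.proj x = amphi.orb UNIV 0} =
      {x \<in> topspace (amphi.quot L). amphi.proj x = amphi.orb UNIV 0}"
    unfolding homeomorphic_imp_surjective_map[OF \<eta>(1), symmetric] using \<eta>(2) by auto
  have "bij_betw \<eta> {x \<in> topspace (amphi.quot K). amphi.proj x = amphi.orb UNIV 0}
      {x \<in> topspace (amphi.quot L). amphi.proj x = amphi.orb UNIV 0}"
    by (rule bij_betw_subset[OF bij _ im]) auto
  from bij_betw_same_card[OF this]
  show "card (rcosets\<^bsub>amphi\<^esub> L) = card (rcosets\<^bsub>amphi\<^esub> K)"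
    using bij_betw_same_card[OF amphi.fibre_bij_rcosets[OF K, of 0]]
      bij_betw_same_card[OF amphi.fibre_bij_rcosets[OF L, of 0]] by simp
qed

lemma model_space_unique:
  assumes "flat_type s u" "flat_type s' u'" "model_space s u homeomorphic_space model_space s' u'"
  shows "s = s' \<and> u = u'"
  using flat_iso_unique[OF assms(1,2) homeomorphic_quot_imp_iso[OF free_action_flat
      free_action_flat]] assms
  by (simp add: model_space_def)

text \<open>Group and quotient space receive the same pair \<open>(s, u)\<close>, because the
  parametrisation that gives the isomorphism also has an equivariant affine map.\<close>

theorem subgroup_type:
  assumes K: "subgroup K amphi" and n: "card (rcosets\<^bsub>amphi\<^esub> K) = n" "n > 0"
  obtains s u where "flat_type s u" "amphi\<lparr>carrier := K\<rparr> \<cong> flat_group s u"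
    "quotient_space K homeomorphic_space model_space s u" "odd n \<Longrightarrow> s = - 1 \<and> u = 1"
  using subgroup_classification[OF assms(1-3)]
proof (elim disjE exE conjE)
  fix A t1 t2 e b d
  assume 1: "even A" "A > 0" "e > 0" "d > 0" "nat (A * d * e) = n"
      "K = range (psi_even A t1 t2 e b d)"
  have "n = nat A * nat d * nat e" using 1 by (simp add: nat_mult_distrib)
  then have "even n" using 1 by (simp add: even_nat_iff)
  then show ?thesis using that[of 1 0] psi_even_type[OF 1(1-4), of t1 t2 b] 1(6) by simp
  next
  fix A t e u d
  assume 2: "odd A" "A > 0" "e > 0" "d > 0" "nat (A * d * e) = n" "u \<in> {0, 1}" "even (e - u * d)"
    "(K, range (psi_odd A t e u d)) \<in> conj_rel amphi"
  let ?L = "range (psi_odd A t e u d)"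
  have su: "flat_type (- 1) u" using 2 by (auto simp: flat_type_def)
  have L: "subgroup ?L amphi" by (rule subgroup_psi_odd[OF 2(1,7) su])
  note KL = conj_rel_type[OF K L 2(8)]
  note type = psi_odd_type[OF 2(1-4) su 2(7), of t]
  have "amphi\<lparr>carrier := K\<rparr> \<cong> flat_group (- 1) u"
    using iso_trans[OF _ type(1)] conj_rel_type(1)[OF L K conj_rel_sym_amphi[OF K L 2(8)]] by blast
  moreover have "quotient_space K homeomorphic_space model_space (- 1) u"
    using KL(2) type(2) homeomorphic_space_trans by blast
  \<comment> \<open>For odd \<open>n\<close> the entry \<open>e\<close> is odd, and then
    \<open>even (e - u * d)\<close> excludes \<open>u = 0\<close>.\<close>
  moreover have "u = 1" if "odd n"
  proof -
    have "n = nat A * nat d * nat e" using 2 by (simp add: nat_mult_distrib)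
    then have "odd e" using that 2 by (simp add: even_nat_iff)
    then show ?thesis using 2 by auto
  qed
  ultimately show ?thesis using that su by blast
qed

text \<open>Both types of \<open>K\<close> are given by one pair \<open>(s', u')\<close>, and
  distinct pairs have neither isomorphic groups nor homeomorphic spaces. This links the count of
  coverings to the count of subgroups.\<close>

corollary subgroup_type_iff:
  assumes K: "subgroup K amphi" and n: "card (rcosets\<^bsub>amphi\<^esub> K) = n" "n > 0" and su: "flat_type s u"
  shows "quotient_space K homeomorphic_space model_space s u \<longleftrightarrow> amphi\<lparr>carrier := K\<rparr> \<cong> flat_group s u"
proof -
  obtain s' u' where *: "flat_type s' u'" "amphi\<lparr>carrier := K\<rparr> \<cong> flat_group s' u'"
    "quotient_space K homeomorphic_space model_space s' u'" by (rule subgroup_type[OF K n])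
  interpret GK: group "amphi\<lparr>carrier := K\<rparr>" by (rule amphi.subgroup_imp_group[OF K])
  show ?thesis
  proof
    assume "quotient_space K homeomorphic_space model_space s u"
    then have "model_space s' u' homeomorphic_space model_space s u"
      using *(3) homeomorphic_space_sym homeomorphic_space_trans by blast
    then show "amphi\<lparr>carrier := K\<rparr> \<cong> flat_group s u" using model_space_unique[OF *(1) su] *(2)
        by simp
  next
    assume "amphi\<lparr>carrier := K\<rparr> \<cong> flat_group s u"
    then have "flat_group s' u' \<cong> flat_group s u"
      using *(2) GK.iso_sym iso_trans unfolding is_iso_def by blast
    then show "quotient_space K homeomorphic_space model_space s u"
        using flat_iso_unique[OF *(1) su] *(3) by simp
  qed
qed

section \<open>Counting conjugacy classes\<close>

definition typed_subgroups :: "int \<Rightarrow> int \<Rightarrow> nat \<Rightarrow> (int \<times> int \<times> int) set set" where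
  "typed_subgroups s u n =
    {K. subgroup K amphi \<and> card (rcosets\<^bsub>amphi\<^esub> K) = n \<and> amphi\<lparr>carrier := K\<rparr> \<cong> flat_group s u}"

text \<open>The entries stand for the diagonal \<open>A\<close>, \<open>d\<close>, \<open>e\<close>
  of a Hermite form, whose product is the index.\<close>

definition triples :: "nat \<Rightarrow> (nat \<times> nat \<times> nat) set" where
  "triples n = {(a, d, e). a * d * e = n}"

lemma finite_triples:
  assumes "n > 0"
  shows "finite (triples n)"
proof (rule finite_subset)
  show "triples n \<subseteq> {a. a dvd n} \<times> {a. a dvd n} \<times> {a. a dvd n}"
    by (auto simp: triples_def intro: dvdI)
  show "finite ({a. a dvd n} \<times> {a. a dvd n} \<times> {a. a dvd n})"
    using assms by (intro finite_cartesian_product) simp_all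
qed

text \<open>A class with odd \<open>A\<close> is determined by the diagonal and by \<open>t\<close>
  modulo \<open>e\<close>: \<open>t1\<close> is conjugated to 0, and \<open>b\<close> is half of e -
  u d, whence the parity condition.\<close>

definition odd_index :: "int \<Rightarrow> nat \<Rightarrow> ((nat \<times> nat \<times> nat) \<times> nat) set" where
  "odd_index u n = (SIGMA (a, d, e):{(a, d, e) \<in> triples n. odd a \<and>
      even (int e - u * int d)}. {..<e})"

lemma odd_classes:
  assumes n: "n > 0" and u: "u \<in> {0, 1}"
  shows "finite (typed_subgroups (- 1) u n // conj_rel amphi)"
    and "card (typed_subgroups (- 1) u n // conj_rel amphi) =
      (\<Sum>(a, d, e) | (a, d, e) \<in> triples n \<and> odd a \<and> even (int e - u * int d). e)"
proof -
  have su: "flat_type (- 1) u" using u by (auto simp: flat_type_def)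
  let ?I = "odd_index u n"
  let ?f = "\<lambda>((a, d, e), t). range (psi_odd (int a) (int t) (int e) u (int d))"
  let ?X = "typed_subgroups (- 1) u n"
  have I: "odd (int a)" "int a > 0" "int d > 0" "int e > 0" "even (int e - u * int d)" "t < e"
      "nat (int a * int d * int e) = n"
    if "((a, d, e), t) \<in> ?I" for a d e t
    using that n by (auto simp: odd_index_def triples_def simp flip: of_nat_mult intro!: Nat.gr0I)
  have sub: "subgroup (range (psi_odd (int a) (int t) (int e) u (int d))) amphi"
    and her: "hermite (range (psi_odd (int a) (int t) (int e) u (int d))) (int a) 0 (int t) (int
        e) ((int e - u * int d) div 2) (int d)"
    if "((a, d, e), t) \<in> ?I" for a d e t
    using subgroup_psi_odd[OF I(1,5)[OF that] su] hermite_psi_odd[OF I(2,4,3)[OF that]] by blast+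
  \<comment> \<open>Dividing by \<open>Id\<close> only replaces indices by singletons, and makes the
    lemma on sets of classes applicable.\<close>
  have "\<exists>h. bij_betw h (?I // Id) (?X // conj_rel amphi)"
  proof (rule quotient_bij_betw[where f = ?f])
    show "?f x \<in> ?X" if x: "x \<in> ?I" for x
    proof -
      obtain a d e t where xe: "x = ((a, d, e), t)" by (metis prod.exhaust)
      note x' = x[unfolded xe]
      show ?thesis
        using sub[OF x'] hermite_card_rcosets[OF sub[OF x'] her[OF x']] I(7)[OF x']
          psi_odd_type(1)[OF I(1,2,4,3)[OF x'] su I(5)[OF x']]
        by (simp add: typed_subgroups_def xe)
    qed
    show "Id `` {x} = Id `` {y} \<longleftrightarrow> conj_rel amphi `` {?f x} = conj_rel amphi `` {?f y}"
      if x: "x \<in> ?I" and y: "y \<in> ?I" for x y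
    proof
      assume eq: "conj_rel amphi `` {?f x} = conj_rel amphi `` {?f y}"
      obtain a d e t where xe: "x = ((a, d, e), t)" by (metis prod.exhaust)
      obtain a' d' e' t' where ye: "y = ((a', d', e'), t')" by (metis prod.exhaust)
      note x' = x[unfolded xe] and y' = y[unfolded ye]
      have "(?f x, ?f y) \<in> conj_rel amphi"
        using eq amphi.conj_rel_class_eq_iff[of "?f x" "?f y"] by simp
      then have "int a = int a'" "int e = int e'" "int d = int d'" "int e dvd int t - int t'"
        using conj_hermite[OF sub[OF x'] sub[OF y'] her[OF x'] her[OF y']] by (simp_all add: xe ye)
      moreover have "t = t'" if "int e dvd int t - int t'" "t < e" "t' < e"
        using that by (metis mod_eq_dvd_iff mod_less of_nat_eq_iff zmod_int)
      ultimately have "x = y" using I(6)[OF x'] I(6)[OF y'] by (simp add: xe ye)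
      then show "Id `` {x} = Id `` {y}" by simp
    qed auto
    show "\<exists>x\<in>?I. conj_rel amphi `` {?f x} = conj_rel amphi `` {K}" if K: "K \<in> ?X" for K
    proof -
      have K': "subgroup K amphi" "card (rcosets\<^bsub>amphi\<^esub> K) = n"
          "amphi\<lparr>carrier := K\<rparr> \<cong> flat_group (- 1) u"
        using K by (simp_all add: typed_subgroups_def)
      interpret GK: group "amphi\<lparr>carrier := K\<rparr>" by (rule amphi.subgroup_imp_group[OF K'(1)])
      have uniq: "s' = - 1 \<and> u' = u" if "flat_type s' u'"
          "amphi\<lparr>carrier := K\<rparr> \<cong> flat_group s' u'" for s' u'
        using flat_iso_unique[OF that(1) su] that(2) K'(3) GK.iso_sym iso_trans
          unfolding is_iso_def by blast
      show ?thesis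
        using subgroup_classification[OF K'(1,2) n]
      proof (elim disjE exE conjE)
        fix A t1 t2 e b d
        assume "even A" "A > 0" "e > 0" "d > 0" "K = range (psi_even A t1 t2 e b d)"
        then show ?thesis using psi_even_type(1)[of A e d t1 t2 b] uniq[of 1 0] by simp
      next
        fix A t e v d
        assume *: "odd A" "A > 0" "e > 0" "d > 0" "nat (A * d * e) = n" "v \<in> {0, 1}"
          "even (e - v * d)"
          "t \<in> {0..<e}" "(K, range (psi_odd A t e v d)) \<in> conj_rel amphi"
        have sv: "flat_type (- 1) v" using * by (auto simp: flat_type_def)
        let ?L = "range (psi_odd A t e v d)"
        have L: "subgroup ?L amphi" by (rule subgroup_psi_odd[OF *(1,7) sv])
        have LK: "(?L, K) \<in> conj_rel amphi" by (rule conj_rel_sym_amphi[OF K'(1) L *(9)])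
        have "amphi\<lparr>carrier := K\<rparr> \<cong> flat_group (- 1) v"
          using iso_trans[OF conj_rel_type(1)[OF L K'(1) LK] psi_odd_type(1)[OF *(1-4) sv *(7)]] .
        then have v: "v = u" using uniq[OF sv] by simp
        let ?x = "((nat A, nat d, nat e), nat t)"
        have "?x \<in> ?I"
          using * by (simp add: odd_index_def triples_def v even_nat_iff nat_mult_distrib)
        moreover have "conj_rel amphi `` {?f ?x} = conj_rel amphi `` {K}"
          using LK * amphi.conj_rel_class_eq_iff[of ?L K] by (simp add: v)
        ultimately show ?thesis by blast
      qed
    qed
  qed
  then obtain h where h: "bij_betw h (?I // Id) (?X // conj_rel amphi)" by blast
  have fin: "finite {(a, d, e) \<in> triples n. odd a \<and> even (int e - u * int d)}"
    using finite_triples[OF n] by (rule rev_finite_subset) auto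
  then have finI: "finite ?I" unfolding odd_index_def by (intro finite_SigmaI) auto
  have I_Id: "?I // Id = (\<lambda>x. {x}) ` ?I" by (auto simp: quotient_def)
  show "finite (?X // conj_rel amphi)"
    using bij_betw_finite[OF h] finI I_Id by simp
  have "card (?X // conj_rel amphi) = card ?I"
    using bij_betw_same_card[OF h] I_Id by (simp add: card_image)
  also have "\<dots> = (\<Sum>(a, d, e) | (a, d, e) \<in> triples n \<and> odd a \<and> even (int e - u * int d). e)"
    unfolding odd_index_def using fin
    by (subst card_SigmaI) (auto intro!: sum.cong)
  finally show "card (?X // conj_rel amphi) =
    (\<Sum>(a, d, e) | (a, d, e) \<in> triples n \<and> odd a \<and> even (int e - u * int d). e)" .
qed

text \<open>The orbit count for a group of order two: an orbit of size 2 has no fixed point and an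
  orbit of size 1 has one, so each orbit contributes 2 to the right-hand side.\<close>

lemma card_involution_orbits:
  assumes fin: "finite X" and \<sigma>: "\<And>x. x \<in> X \<Longrightarrow> \<sigma> x \<in> X" "\<And>x. x \<in> X \<Longrightarrow> \<sigma> (\<sigma> x) = x"
  shows "2 * card ((\<lambda>x. {x, \<sigma> x}) ` X) = card X + card {x \<in> X. \<sigma> x = x}"
proof -
  let ?Y = "(\<lambda>x. {x, \<sigma> x}) ` X" and ?F = "{x \<in> X. \<sigma> x = x}"
  have U: "X = \<Union>?Y" using \<sigma> by auto
  have orb: "C = {z, \<sigma> z}" if C: "C \<in> ?Y" and z: "z \<in> C" for C z
  proof -
    obtain x where "x \<in> X" "C = {x, \<sigma> x}" using C by blast
    then show ?thesis using z \<sigma>(2)[of x] by auto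
  qed
  have disj: "C \<inter> D = {}" if CD: "C \<in> ?Y" "D \<in> ?Y" "C \<noteq> D" for C D
  proof (rule ccontr)
    assume "C \<inter> D \<noteq> {}"
    then obtain z where "z \<in> C" "z \<in> D" by blast
    then have "C = {z, \<sigma> z}" "D = {z, \<sigma> z}" using orb CD(1,2) by metis+
    then show False using CD(3) by simp
  qed
  have finY: "finite ?Y" using fin by simp
  have "card (\<Union>?Y) = (\<Sum>C\<in>?Y. card C)"
    by (rule card_Union_disjoint) (use disj in \<open>auto simp: pairwise_def disjnt_def\<close>)
  then have "card X = (\<Sum>C\<in>?Y. card C)" by (simp only: U[symmetric])
  moreover have "card ?F = (\<Sum>C\<in>?Y. card (C \<inter> ?F))"
  proof -
    have "?F = (\<Union>C\<in>?Y. C \<inter> ?F)" using U by blast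
    then have "card ?F = card (\<Union>C\<in>?Y. C \<inter> ?F)" by simp
    also have "\<dots> = (\<Sum>C\<in>?Y. card (C \<inter> ?F))"
      by (rule card_UN_disjoint[OF finY]) (use disj in blast)+
    finally show ?thesis .
  qed
  moreover have "card C + card (C \<inter> ?F) = 2" if C: "C \<in> ?Y" for C
  proof -
    obtain x where x: "x \<in> X" "C = {x, \<sigma> x}" using C by blast
    show ?thesis
    proof (cases "\<sigma> x = x")
      case True
      then have "C = {x}" "C \<inter> ?F = {x}" using x by auto
      then show ?thesis by simp
    next
      case False
      then have "C \<inter> ?F = {}" using x \<sigma>(2)[OF x(1)] by auto
      then show ?thesis using x False by simp
    qed
  qed
  then have "(\<Sum>C\<in>?Y. card C + card (C \<inter> ?F)) = (\<Sum>C\<in>?Y. 2)" by (rule sum.cong[OF refl])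
  ultimately show ?thesis by (simp add: sum.distrib)
qed

text \<open>Conjugation by \<open>(1, 0, 0)\<close> on elements with an even first coordinate.\<close>

definition flip :: "(int \<times> int \<times> int) set \<Rightarrow> (int \<times> int \<times> int) set" where
  "flip K = (\<lambda>(a, b, c). (a, c - b, c)) ` K"

lemma flip_flip: "flip (flip K) = K"
  by (force simp: flip_def image_iff)

text \<open>On elements with even \<open>a\<close>, conjugation by \<open>(x, y, z)\<close> depends
  only on the parity of \<open>x\<close>, so a class has at most two members.\<close>

lemma conj_rel_even:
  assumes "\<And>a b c. (a, b, c) \<in> K \<Longrightarrow> even a"
  shows "(K, L) \<in> conj_rel amphi \<longleftrightarrow> L = K \<or> L = flip K"
proof -
  have c: "(x, y, z) \<otimes>\<^bsub>amphi\<^esub> k \<otimes>\<^bsub>amphi\<^esub> inv\<^bsub>amphi\<^esub> (x, y, z) =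
    (if even x then k else (\<lambda>(a, b, c). (a, c - b, c)) k)" if "k \<in> K" for k x y z
    using that assms by (cases k) (auto simp: conj_amphi twist_def)
  have "(\<lambda>k. (x, y, z) \<otimes>\<^bsub>amphi\<^esub> k \<otimes>\<^bsub>amphi\<^esub> inv\<^bsub>amphi\<^esub> (x, y, z)) ` K =
      (if even x then K else flip K)" for x y z
    by (auto simp: c flip_def cong: image_cong_simp)
  then have "(K, L) \<in> conj_rel amphi \<longleftrightarrow> (\<exists>x :: int. L = (if even x then K else flip K))" for L
    unfolding amphi.conj_rel_iff carrier_flat_group bex_UNIV split_paired_Ex by simp
  then show ?thesis by (metis even_zero odd_one)
qed

definition even_index :: "nat \<Rightarrow> ((nat \<times> nat \<times> nat) \<times> nat \<times> nat \<times> nat) set" where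
  "even_index n = (SIGMA (a, d, e):{(a, d, e) \<in> triples n. even a}. {..<d} \<times> {..<d} \<times> {..<e})"

text \<open>The congruences say that \<sigma> (b, e) - (b, e) and \<sigma> (t1, t2) - (t1, t2),
  whose second coordinates are 0, lie in the lattice.\<close>

definition fixed_index :: "nat \<Rightarrow> ((nat \<times> nat \<times> nat) \<times> nat \<times> nat \<times> nat) set" where
  "fixed_index n = (SIGMA (a, d, e):{(a, d, e) \<in> triples n. even a}.
    {b \<in> {..<d}. int d dvd int e - 2 * int b} \<times>
    {(t1, t2) \<in> {..<d} \<times> {..<e}. int d dvd int t2 - 2 * int t1})"

abbreviation even_subgroup :: "(nat \<times> nat \<times> nat) \<times> nat \<times> nat \<times> nat \<Rightarrow> (int \<times> int \<times> int) set" where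
  "even_subgroup \<equiv> \<lambda>((a, d, e), b, t1, t2). range (psi_even (int a) (int t1) (int t2) (int e)
      (int b) (int d))"

lemma even_indexD:
  assumes "((a, d, e), b, t1, t2) \<in> even_index n" "n > 0"
  shows "even (int a)" "int a > 0" "int d > 0" "int e > 0" "b < d" "t1 < d" "t2 < e"
    "nat (int a * int d * int e) = n"
  using assms by (auto simp: even_index_def triples_def simp flip: of_nat_mult intro!: Nat.gr0I)

text \<open>For injectivity \<open>conj_hermite\<close> is applied to one subgroup with two Hermite
  forms, which settles the diagonal and \<open>t2\<close>. Quotients of generators then lie on the
  axis of (0, d, 0), and this fixes \<open>b\<close> and \<open>t1\<close> within their
  ranges.\<close>

lemma bij_even_index:
  assumes n: "n > 0"
  shows "bij_betw even_subgroup (even_index n) (typed_subgroups 1 0 n)"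
proof (rule bij_betw_imageI)
  have sub: "subgroup (even_subgroup ((a, d, e), b, t1, t2)) amphi"
    and her: "hermite (even_subgroup ((a, d, e), b, t1, t2)) (int a) (int t1) (int t2) (int e)
        (int b) (int d)"
    if "((a, d, e), b, t1, t2) \<in> even_index n" for a d e b t1 t2
    using subgroup_psi_even[of "int a"] hermite_psi_even[of "int a" "int e"
        "int d"] even_indexD[OF that n] by simp_all
  show "inj_on even_subgroup (even_index n)"
  proof (rule inj_onI)
    fix x y assume x: "x \<in> even_index n" and y: "y \<in> even_index n"
        and eq: "even_subgroup x = even_subgroup y"
    obtain a d e b t1 t2 where xe: "x = ((a, d, e), b, t1, t2)" by (metis prod.exhaust)
    obtain a' d' e' b' t1' t2' where ye: "y = ((a', d', e'), b', t1', t2')" by (metis prod.exhaust)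
    note x' = x[unfolded xe] and y' = y[unfolded ye]
    let ?K = "even_subgroup ((a, d, e), b, t1, t2)"
    have hy: "hermite ?K (int a') (int t1') (int t2') (int e') (int b') (int d')"
      using her[OF y'] eq by (simp add: xe ye)
    note hx = her[OF x'] and K = sub[OF x']
    have "(?K, ?K) \<in> conj_rel amphi"
      using amphi.conj_rel_class_eq_iff[of ?K ?K] by simp
    note * = conj_hermite[OF K K hx hy this]
    have 1: "a = a'" "e = e'" "d = d'" using *(1-3) by simp_all
    have small: "i = j" if "int m dvd int i - int j" "i < m" "j < m" for i j m :: nat
      using that by (metis mod_eq_dvd_iff mod_less of_nat_eq_iff zmod_int)
    have t2: "t2 = t2'" using *(4) small even_indexD(7)[OF x' n] even_indexD(7)[OF y' n] 1 by blast
    have mem: "(0, int b, int e) \<in> ?K" "(0, int b', int e) \<in> ?K" "(int a, int t1, int t2) \<in> ?K"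
        "(int a, int t1', int t2) \<in> ?K"
      and dvd: "\<And>b. (0, b, 0) \<in> ?K \<Longrightarrow> int d dvd b"
      using hx hy 1 t2 unfolding hermite_def by blast+
    have diff: "p \<otimes>\<^bsub>amphi\<^esub> inv\<^bsub>amphi\<^esub> q \<in> ?K" if "p \<in> ?K" "q \<in> ?K" for p q
      using that subgroup.m_closed[OF K] subgroup.m_inv_closed[OF K] by blast
    have "(0, int b - int b', 0) \<in> ?K"
      using diff[OF mem(1,2)] by (simp add: inv_amphi mult_flat_group twist_def)
    then have b: "b = b'" using dvd small even_indexD(5)[OF x' n] even_indexD(5)[OF y' n] 1 by blast
    have "(0, int t1 - int t1', 0) \<in> ?K"
      using diff[OF mem(3,4)] even_indexD(1)[OF x' n]
          by (simp add: inv_amphi mult_flat_group twist_def)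
    then have "t1 = t1'" using dvd small even_indexD(6)[OF x' n] even_indexD(6)[OF y' n] 1 by blast
    then show "x = y" using 1 t2 b by (simp add: xe ye)
  qed
  show "even_subgroup ` even_index n = typed_subgroups 1 0 n"
  proof
    show "even_subgroup ` even_index n \<subseteq> typed_subgroups 1 0 n"
    proof
      fix K assume "K \<in> even_subgroup ` even_index n"
      then obtain a d e b t1 t2 where x: "((a, d, e), b, t1, t2) \<in> even_index n"
        and K: "K = even_subgroup ((a, d, e), b, t1, t2)" by auto
      note D = even_indexD[OF x n]
      show "K \<in> typed_subgroups 1 0 n"
        using sub[OF x] hermite_card_rcosets[OF sub[OF x] her[OF x]] D(8) psi_even_type(1)[OF
          D(1,2,4,3)]
        unfolding K typed_subgroups_def by simp
    qed
    show "typed_subgroups 1 0 n \<subseteq> even_subgroup ` even_index n"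
    proof
      fix K assume "K \<in> typed_subgroups 1 0 n"
      then have K': "subgroup K amphi" "card (rcosets\<^bsub>amphi\<^esub> K) = n"
          "amphi\<lparr>carrier := K\<rparr> \<cong> flat_group 1 0"
        by (simp_all add: typed_subgroups_def)
      interpret GK: group "amphi\<lparr>carrier := K\<rparr>" by (rule amphi.subgroup_imp_group[OF K'(1)])
      show "K \<in> even_subgroup ` even_index n"
        using subgroup_classification[OF K'(1,2) n]
      proof (elim disjE exE conjE)
        fix A t1 t2 e b d
        assume *: "even A" "A > 0" "e > 0" "d > 0" "nat (A * d * e) = n" "b \<in> {0..<d}"
          "t1 \<in> {0..<d}"
          "t2 \<in> {0..<e}" "K = range (psi_even A t1 t2 e b d)"
        let ?x = "((nat A, nat d, nat e), nat b, nat t1, nat t2)"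
        have "?x \<in> even_index n"
          using * by (simp add: even_index_def triples_def even_nat_iff nat_mult_distrib)
        moreover have "K = even_subgroup ?x" using * by simp
        ultimately show ?thesis by (rule rev_image_eqI)
      next
        fix A t e v d
        assume *: "odd A" "A > 0" "e > 0" "d > 0" "v \<in> {0, 1}" "even (e - v * d)"
          "(K, range (psi_odd A t e v d)) \<in> conj_rel amphi"
        have sv: "flat_type (- 1) v" using * by (auto simp: flat_type_def)
        let ?L = "range (psi_odd A t e v d)"
        have L: "subgroup ?L amphi" by (rule subgroup_psi_odd[OF *(1,6) sv])
        have LK: "(?L, K) \<in> conj_rel amphi" by (rule conj_rel_sym_amphi[OF K'(1) L *(7)])
        have "amphi\<lparr>carrier := K\<rparr> \<cong> flat_group (- 1) v"
          using iso_trans[OF conj_rel_type(1)[OF L K'(1) LK] psi_odd_type(1)[OF *(1-4) sv *(6)]] .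
        then have "flat_group 1 0 \<cong> flat_group (- 1) v"
          using K'(3) GK.iso_sym iso_trans unfolding is_iso_def by blast
        then show ?thesis using flat_iso_unique(1)[OF flat_type_simps(1) sv] by simp
      qed
    qed
  qed
qed

lemma flip_even_subgroup:
  assumes x: "((a, d, e), b, t1, t2) \<in> even_index n" and n: "n > 0"
  shows "flip (even_subgroup ((a, d, e), b, t1, t2)) = even_subgroup ((a, d, e), b, t1, t2) \<longleftrightarrow>
    int d dvd int e - 2 * int b \<and> int d dvd int t2 - 2 * int t1"
proof
  note D = even_indexD[OF x n]
  let ?K = "even_subgroup ((a, d, e), b, t1, t2)"
  have K: "subgroup ?K amphi" using subgroup_psi_even[OF D(1)] by simp
  have h: "hermite ?K (int a) (int t1) (int t2) (int e) (int b) (int d)"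
    using hermite_psi_even[OF D(2,4,3)] by simp
  then have mem: "(0, int b, int e) \<in> ?K" "(int a, int t1, int t2) \<in> ?K"
    and dvd: "\<And>b. (0, b, 0) \<in> ?K \<Longrightarrow> int d dvd b"
    unfolding hermite_def by blast+
  have diff: "p \<otimes>\<^bsub>amphi\<^esub> inv\<^bsub>amphi\<^esub> q \<in> ?K" if "p \<in> ?K" "q \<in> ?K" for p q
    using that subgroup.m_closed[OF K] subgroup.m_inv_closed[OF K] by blast
  assume eq: "flip ?K = ?K"
  have fl: "(a, c - b, c) \<in> ?K" if "(a, b, c) \<in> ?K" for a b c
    using imageI[OF that, of "\<lambda>(a, b, c). (a, c - b, c)"] eq by (simp add: flip_def)
  have "(0, int e - 2 * int b, 0) \<in> ?K"
    using diff[OF fl[OF mem(1)] mem(1)] by (simp add: inv_amphi mult_flat_group twist_def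
        algebra_simps)
  moreover have "(0, int t2 - 2 * int t1, 0) \<in> ?K"
    using diff[OF fl[OF mem(2)] mem(2)] D(1)
        by (simp add: inv_amphi mult_flat_group twist_def algebra_simps)
  ultimately show "int d dvd int e - 2 * int b \<and> int d dvd int t2 - 2 * int t1" using dvd by blast
next
  let ?K = "even_subgroup ((a, d, e), b, t1, t2)"
  assume "int d dvd int e - 2 * int b \<and> int d dvd int t2 - 2 * int t1"
  then obtain q1 q2 where q: "int e = 2 * int b + int d * q1" "int t2 = 2 * int t1 + int d * q2"
    by (metis dvd_def add.commute diff_add_cancel)
  have "flip ?K \<subseteq> ?K"
  proof
    fix y assume "y \<in> flip ?K"
    then obtain p where "y = (\<lambda>(a, b, c). (a, c - b, c)) (psi_even (int a) (int t1) (int t2) (int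
        e) (int b) (int d) p)"
      unfolding flip_def prod.case image_image by (rule imageE)
    moreover obtain k i j where "p = (k, i, j)" by (metis prod_cases3)
    ultimately have y: "y = (\<lambda>(a, b, c). (a, c - b, c)) (psi_even (int a) (int t1) (int t2) (int
        e) (int b) (int d) (k, i, j))"
      by simp
    \<comment> \<open>By the choice of \<open>q1\<close> and \<open>q2\<close>, flipping the other
      two generators only adds multiples of (0, d, 0) to them; these are absorbed in the middle
      argument.\<close>
    have "y = psi_even (int a) (int t1) (int t2) (int e) (int b) (int d) (k, - i + k * q2 +
        j * q1, j)"
      unfolding y psi_even_def q by (simp add: algebra_simps)
    then show "y \<in> ?K" by simp
  qed
  moreover have "?K \<subseteq> flip ?K"
    using image_mono[OF \<open>flip ?K \<subseteq> ?K\<close>, of "\<lambda>(a, b, c). (a, c - b, c)"] flip_flip[of ?K]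
    by (simp only: flip_def)
  ultimately show "flip ?K = ?K" by blast
qed

lemma even_classes:
  assumes n: "n > 0"
  shows "finite (typed_subgroups 1 0 n // conj_rel amphi)"
    and "2 * card (typed_subgroups 1 0 n // conj_rel amphi) =
        card (even_index n) + card (fixed_index n)"
proof -
  let ?X = "typed_subgroups 1 0 n"
  note bij = bij_even_index[OF n]
  have finT: "finite {(a, d, e) \<in> triples n. even a}"
    using finite_triples[OF n] by (rule rev_finite_subset) auto
  then have "finite (even_index n)" unfolding even_index_def by (intro finite_SigmaI) auto
  then have finX: "finite ?X" using bij_betw_finite[OF bij] by simp
  have even: "even a" if aK: "K \<in> ?X" "(a, b, c) \<in> K" for K a b c
  proof -
    have "K \<in> even_subgroup ` even_index n" using aK(1) bij_betw_imp_surj_on[OF bij] by simp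
    then obtain x where x: "K = even_subgroup x" "x \<in> even_index n" by (rule imageE)
    obtain a' d e b t1 t2 where xe: "x = ((a', d, e), b, t1, t2)" by (metis prod.exhaust)
    show ?thesis using aK(2) even_indexD(1)[OF x(2)[unfolded xe] n]
        by (auto simp: x(1) xe psi_even_def)
  qed
  have conj: "(K, L) \<in> conj_rel amphi \<longleftrightarrow> L = K \<or> L = flip K" if "K \<in> ?X" for K L
    by (rule conj_rel_even[OF even[OF that]])
  then have cls: "conj_rel amphi `` {K} = {K, flip K}" if "K \<in> ?X" for K
    using that by auto
  have flipX: "flip K \<in> ?X" if "K \<in> ?X" for K
  proof -
    have K: "subgroup K amphi" "card (rcosets\<^bsub>amphi\<^esub> K) = n" "amphi\<lparr>carrier := K\<rparr> \<cong> flat_group 1 0"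
      using that by (simp_all add: typed_subgroups_def)
    have KL: "(K, flip K) \<in> conj_rel amphi" using conj[OF that] by simp
    then obtain g where "flip K = (\<lambda>k. g \<otimes>\<^bsub>amphi\<^esub> k \<otimes>\<^bsub>amphi\<^esub> inv\<^bsub>amphi\<^esub> g) ` K"
      unfolding amphi.conj_rel_iff by blast
    then have L: "subgroup (flip K) amphi" using subgroup_conj_image[OF K(1)] by simp
    show ?thesis
      using L K(2) conj_rel_type(3)[OF K(1) L KL] iso_trans[OF conj_rel_type(1)[OF K(1) L KL] K(3)]
      by (simp add: typed_subgroups_def)
  qed
  have Q: "?X // conj_rel amphi = (\<lambda>K. {K, flip K}) ` ?X"
    unfolding quotient_def using cls by auto
  show "finite (?X // conj_rel amphi)" unfolding Q using finX by simp
  have "2 * card (?X // conj_rel amphi) = card ?X + card {K \<in> ?X. flip K = K}"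
    unfolding Q by (rule card_involution_orbits[OF finX flipX]) (simp_all add: flip_flip)
  also have "card ?X = card (even_index n)" using bij_betw_same_card[OF bij] by simp
  also have "card {K \<in> ?X. flip K = K} = card (fixed_index n)"
  proof -
    have sub: "fixed_index n \<subseteq> even_index n" by (auto simp: fixed_index_def even_index_def)
    have "{K \<in> ?X. flip K = K} = even_subgroup ` {x \<in> even_index n. flip (even_subgroup x) =
        even_subgroup x}"
      unfolding bij_betw_imp_surj_on[OF bij, symmetric] by blast
    also have "{x \<in> even_index n. flip (even_subgroup x) = even_subgroup x} = fixed_index n"
    proof (intro equalityI subsetI)
      fix x assume x: "x \<in> {x \<in> even_index n. flip (even_subgroup x) = even_subgroup x}"
      obtain a d e b t1 t2 where xe: "x = ((a, d, e), b, t1, t2)" by (metis prod.exhaust)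
      have x': "((a, d, e), b, t1, t2) \<in> even_index n" using x xe by simp
      have "flip (even_subgroup ((a, d, e), b, t1, t2)) =
          even_subgroup ((a, d, e), b, t1, t2)" using x xe by simp
      then show "x \<in> fixed_index n"
        using x' flip_even_subgroup[OF x' n] by (simp add: xe fixed_index_def even_index_def)
    next
      fix x assume x: "x \<in> fixed_index n"
      obtain a d e b t1 t2 where xe: "x = ((a, d, e), b, t1, t2)" by (metis prod.exhaust)
      have x': "((a, d, e), b, t1, t2) \<in> even_index n" using x sub by (auto simp: xe)
      have "flip (even_subgroup ((a, d, e), b, t1, t2)) = even_subgroup ((a, d, e), b, t1, t2)"
        using x flip_even_subgroup[OF x' n] by (simp add: xe fixed_index_def)
      then show "x \<in> {x \<in> even_index n. flip (even_subgroup x) = even_subgroup x}" using x'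
          by (simp add: xe)
    qed
    finally show ?thesis
      using card_image[OF inj_on_subset[OF bij_betw_imp_inj_on[OF bij] sub]] by simp
  qed
  finally show "2 * card (?X // conj_rel amphi) = card (even_index n) + card (fixed_index n)" .
qed

section \<open>Divisor sums\<close>

text \<open>These are the solutions of 2 b = x modulo \<open>d\<close>. Doubling is invertible for
  odd \<open>d\<close>; for even \<open>d\<close> it has a kernel of order 2 and the even residues
  as its image.\<close>

lemma card_halves_mod:
  assumes "d > 0"
  shows "card {b \<in> {..<d}. int d dvd int x - 2 * int b} =
      (if odd d then 1 else if even x then 2 else 0)"
proof (cases "odd d")
  case True
  then have cop: "coprime (int d) 2" by simp
  obtain k where d: "d = 2 * k + 1" using True by (rule oddE)
  \<comment> \<open>For d = 2 k + 1 the inverse of 2 modulo \<open>d\<close> is k + 1.\<close>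
  define b where "b = (x * (k + 1)) mod d"
  have "int d dvd int (x * (k + 1)) - int b"
    unfolding b_def by (simp only: zmod_int) (metis mod_eq_dvd_iff mod_mod_trivial)
  moreover have "int x - 2 * int b = int d * (- int x) + 2 * (int (x * (k + 1)) - int b)"
    by (simp add: d algebra_simps)
  ultimately have "int d dvd int x - 2 * int b"
    by (simp only: dvd_add dvd_mult dvd_triv_left)
  moreover have "b < d" unfolding b_def using assms by simp
  moreover have "c = b" if "c < d" "int d dvd int x - 2 * int c" "int d dvd int x - 2 * int b" for c
  proof -
    have "int d dvd 2 * (int c - int b)" using dvd_diff[OF that(3,2)] by (simp add: algebra_simps)
    then have "int d dvd int c - int b" using cop coprime_dvd_mult_right_iff by blast
    then show ?thesis using that(1) \<open>b < d\<close>
        by (metis mod_eq_dvd_iff mod_less of_nat_eq_iff zmod_int)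
  qed
  ultimately have "{b \<in> {..<d}. int d dvd int x - 2 * int b} = {b}" by blast
  then show ?thesis using True by simp
next
  case False
  then obtain k where d: "d = 2 * k" by blast
  then have k: "k > 0" using assms by simp
  show ?thesis
  proof (cases "even x")
    case True
    then obtain y where x: "x = 2 * y" by blast
    have iff: "int d dvd int x - 2 * int b \<longleftrightarrow> b mod k = y mod k" for b
    proof -
      have "int d dvd int x - 2 * int b \<longleftrightarrow> 2 * int k dvd 2 * (int y - int b)"
          by (simp add: d x algebra_simps)
      also have "\<dots> \<longleftrightarrow> int k dvd int y - int b" by (simp only: dvd_mult_cancel_left) simp
      also have "\<dots> \<longleftrightarrow> int y mod int k = int b mod int k" by (rule mod_eq_dvd_iff[symmetric])
      also have "\<dots> \<longleftrightarrow> b mod k = y mod k" by (auto simp flip: zmod_int)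
      finally show ?thesis .
    qed
    have "{b \<in> {..<d}. int d dvd int x - 2 * int b} = {y mod k, y mod k + k}"
    proof (intro equalityI subsetI)
      fix b assume "b \<in> {b \<in> {..<d}. int d dvd int x - 2 * int b}"
      then have b: "b < 2 * k" "b mod k = y mod k" using iff[of b] d by simp_all
      then have "b div k < 2" using div_less_iff_less_mult[OF k, of b 2] by simp
      then have "b div k = 0 \<or> b div k = 1" by linarith
      then show "b \<in> {y mod k, y mod k + k}"
        using b(2) div_mult_mod_eq[of b k] by auto
    next
      fix b assume b: "b \<in> {y mod k, y mod k + k}"
      have "y mod k < k" using k by simp
      then have "b < d" using b unfolding d by auto
      moreover have "b mod k = y mod k" using b by auto
      ultimately show "b \<in> {b \<in> {..<d}. int d dvd int x - 2 * int b}"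
        using iff[of b] by simp
    qed
    then show ?thesis using k True False by simp
  next
    case odd: False
    have "\<not> int d dvd int x - 2 * int b" for b
    proof
      assume "int d dvd int x - 2 * int b"
      then have "even (int x - 2 * int b)" by (rule dvd_trans[rotated]) (simp add: d)
      then show False using odd by simp
    qed
    then show ?thesis using odd False by simp
  qed
qed

lemma sum_even_below: "(\<Sum>t<2 * m. if even t then 2 else 0 :: nat) = 2 * m"
  by (induction m) (simp_all add: lessThan_Suc)

lemma card_even_index:
  assumes "n > 0"
  shows "card (even_index n) = (\<Sum>(a, d, e) | (a, d, e) \<in> triples n \<and> even a. d\<^sup>2 * e)"
proof -
  have "finite {(a, d, e) \<in> triples n. even a}"
    using finite_triples[OF assms] by (rule rev_finite_subset) auto
  then show ?thesis
    unfolding even_index_def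
    by (subst card_SigmaI) (auto intro!: sum.cong simp: power2_eq_square)
qed

text \<open>For odd \<open>d\<close> there is one \<open>b\<close> and one \<open>t1\<close> for
  each of the \<open>e\<close> values of \<open>t2\<close>. For even \<open>d\<close> and
  \<open>e\<close> there are two \<open>b\<close>, and two \<open>t1\<close> for each of the e / 2
  even \<open>t2\<close>. For even \<open>d\<close> and odd \<open>e\<close> no \<open>b\<close>
  exists.\<close>

lemma card_fixed_index:
  assumes n: "n > 0"
  shows "card (fixed_index n) =
    (\<Sum>(a, d, e) | (a, d, e) \<in> triples n \<and> even a. if odd d then e else if even e then 2 * e else 0)"
proof -
  have fin: "finite {(a, d, e) \<in> triples n. even a}"
    using finite_triples[OF n] by (rule rev_finite_subset) auto
  have pairs: "card {(t1, t2) \<in> {..<d} \<times> {..<e}. int d dvd int t2 - 2 * int t1} =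
      (\<Sum>t<e. if odd d then 1 else if even t then 2 else 0)" if "d > 0" for d e :: nat
  proof -
    have "{(t1, t2) \<in> {..<d} \<times> {..<e}. int d dvd int t2 - 2 * int t1} =
        prod.swap ` (SIGMA t:{..<e}. {b \<in> {..<d}. int d dvd int t - 2 * int b})"
      by (auto simp: image_iff)
    then have "card {(t1, t2) \<in> {..<d} \<times> {..<e}. int d dvd int t2 - 2 * int t1} =
        card (SIGMA t:{..<e}. {b \<in> {..<d}. int d dvd int t - 2 * int b})"
      by (simp add: card_image)
    also have "\<dots> = (\<Sum>t<e. card {b \<in> {..<d}. int d dvd int t - 2 * int b})"
      by (rule card_SigmaI) simp_all
    also have "\<dots> = (\<Sum>t<e. if odd d then 1 else if even t then 2 else 0)"
      by (simp only: card_halves_mod[OF that])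
    finally show ?thesis .
  qed
  have "card ({b \<in> {..<d}. int d dvd int e - 2 * int b} \<times>
      {(t1, t2) \<in> {..<d} \<times> {..<e}. int d dvd int t2 - 2 * int t1}) =
      (if odd d then e else if even e then 2 * e else 0)" if "(a, d, e) \<in> triples n" for a d e
  proof -
    have d: "d > 0" using that n by (auto simp: triples_def intro!: Nat.gr0I)
    show ?thesis
    proof (cases "even e")
      case True
      then obtain m where "e = 2 * m" by blast
      then show ?thesis
        unfolding card_cartesian_product card_halves_mod[OF d] pairs[OF d]
          using sum_even_below[of m] by simp
    next
      case False
      then show ?thesis
        unfolding card_cartesian_product card_halves_mod[OF d] pairs[OF d] by simp
    qed
  qed
  moreover have "finite ({b \<in> {..<d}. int d dvd int e - 2 * int b} \<times>
      {(t1, t2) \<in> {..<d} \<times> {..<e}. int d dvd int t2 - 2 * int t1})" for d e :: nat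
    by (intro finite_cartesian_product; rule finite_subset[of _ "{..<d} \<times> {..<e}"]
        finite_subset[of _ "{..<d}"]; auto)
  ultimately show ?thesis
    unfolding fixed_index_def using fin by (subst card_SigmaI) (auto intro!: sum.cong)
qed

section \<open>From sums over triples to divisor sums\<close>

lemma sum_triples:
  assumes n: "n > 0"
  shows "(\<Sum>(a, d, e)\<in>triples n. f a d e) =
    (\<Sum>l | l dvd n. \<Sum>m | m dvd n div l. f (n div (l * m)) l m)"
proof -
  have "(\<Sum>l | l dvd n. \<Sum>m | m dvd n div l. f (n div (l * m)) l m) =
      (\<Sum>(l, m)\<in>(SIGMA l:{l. l dvd n}. {m. m dvd n div l}). f (n div (l * m)) l m)"
  proof (rule sum.Sigma)
    show "\<forall>l\<in>{l. l dvd n}. finite {m. m dvd n div l}"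
      using n by (auto intro!: finite_divisors_nat simp: dvd_div_eq_0_iff)
  qed (use n in simp)
  also have "\<dots> = (\<Sum>(a, d, e)\<in>triples n. f a d e)"
  proof (rule sum.reindex_bij_witness[where i = "\<lambda>(a, d, e). (d, e)"
      and j = "\<lambda>(l, m). (n div (l * m), l, m)"])
    fix x assume "x \<in> (SIGMA l:{l. l dvd n}. {m. m dvd n div l})"
    then obtain l m where x: "x = (l, m)" "l dvd n" "m dvd n div l" by auto
    then have "l * m dvd n" using n by (metis dvd_div_mult_self dvd_mult_cancel2 mult.commute
        mult_dvd_mono dvd_refl)
    then have "n div (l * m) * l * m = n" by (simp add: mult.assoc)
    then show "(case x of (l, m) \<Rightarrow> (n div (l * m), l, m)) \<in> triples n" by (simp add: triples_def x)
  next
    fix x assume "x \<in> triples n"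
    then obtain a d e where x: "x = (a, d, e)" "a * d * e = n" by (auto simp: triples_def)
    then have pos: "d > 0" "e > 0" using n by (auto intro!: Nat.gr0I)
    have "n div d = a * e" using x(2) pos
        by (metis mult.assoc mult.commute nonzero_mult_div_cancel_right less_numeral_extra(3))
    then show "(case x of (a, d, e) \<Rightarrow> (d, e)) \<in> (SIGMA l:{l. l dvd n}. {m. m dvd n div l})"
      using x by (auto intro: dvdI[of _ _ "a * e"] simp: algebra_simps)
    have "n div (d * e) = a" using x(2) pos
        by (metis mult.assoc nonzero_mult_div_cancel_right less_numeral_extra(3) mult_is_0)
    then show "(case case x of (a, d, e) \<Rightarrow> (d, e) of (l, m) \<Rightarrow> (n div (l * m), l, m)) = x"
      by (simp add: x)
  qed auto
  finally show ?thesis by simp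
qed

lemma sum_triples_even:
  "(\<Sum>(a, d, e) | (a, d, e) \<in> triples (2 * N) \<and> even a. f a d e) =
      (\<Sum>(a, d, e)\<in>triples N. f (2 * a) d e)"
  by (rule sum.reindex_bij_witness[where i = "\<lambda>(a, d, e). (2 * a, d, e)"
      and j = "\<lambda>(a, d, e). (a div 2, d, e)"])
    (auto simp: triples_def elim!: evenE)

text \<open>The number of fixed points depends on the parity of \<open>e\<close>, but the exponent n
  / (2 l m) in the formula is the entry \<open>a\<close>. Moving a factor 2 from \<open>a\<close> to
  \<open>e\<close> exchanges the two conditions, and 4 e = 2 (2 e) matches the weights.\<close>

lemma sum_divides_weights:
  assumes N: "N > 0"
  shows "(\<Sum>(a, d, e)\<in>triples N. if odd d then e else if even a then 4 * e else 0) =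
    (\<Sum>(a, d, e)\<in>triples N. if odd d then e else if even e then 2 * e else 0 :: nat)"
proof -
  note fin = finite_triples[OF N]
  have split: "(\<Sum>(a, d, e)\<in>triples N. if odd d then e else g a d e) =
      (\<Sum>(a, d, e) | (a, d, e) \<in> triples N \<and> odd d. e) + (\<Sum>(a, d, e) | (a, d, e) \<in> triples N \<and>
          even d. g a d e)"
    for g :: "nat \<Rightarrow> nat \<Rightarrow> nat \<Rightarrow> nat"
  proof -
    have "triples N = {(a, d, e). (a, d, e) \<in> triples N \<and>
        odd d} \<union> {(a, d, e). (a, d, e) \<in> triples N \<and> even d}" by auto
    then have "(\<Sum>(a, d, e)\<in>triples N. if odd d then e else g a d e) =
      (\<Sum>(a, d, e)\<in>{(a, d, e). (a, d, e) \<in> triples N \<and>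
          odd d} \<union> {(a, d, e). (a, d, e) \<in> triples N \<and> even d}.
            if odd d then e else g a d e)" by simp
    also have "\<dots> = (\<Sum>(a, d, e) | (a, d, e) \<in> triples N \<and> odd d. if odd d then e else g a d e) +
      (\<Sum>(a, d, e) | (a, d, e) \<in> triples N \<and> even d. if odd d then e else g a d e)"
      by (rule sum.union_disjoint) (auto intro: rev_finite_subset[OF fin])
    finally show ?thesis by (simp cong: sum.cong) (auto intro!: arg_cong2[where f = "(+)"] sum.cong)
  qed
  have "(\<Sum>(a, d, e) | (a, d, e) \<in> triples N \<and> even d. if even a then 4 * e else 0) =
      (\<Sum>(a, d, e) | (a, d, e) \<in> triples N \<and> even d \<and> even a. 4 * e)"
    by (rule sum.mono_neutral_cong_right) (auto intro: rev_finite_subset[OF fin] split: if_splits)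
  also have "\<dots> = (\<Sum>(a, d, e) | (a, d, e) \<in> triples N \<and> even d \<and> even e. 2 * e)"
    by (rule sum.reindex_bij_witness[where i = "\<lambda>(a, d, e). (2 * a, d, e div 2)"
        and j = "\<lambda>(a, d, e). (a div 2, d, 2 * e)"])
      (auto simp: triples_def elim!: evenE)
  also have "\<dots> = (\<Sum>(a, d, e) | (a, d, e) \<in> triples N \<and> even d. if even e then 2 * e else 0)"
    by (rule sum.mono_neutral_cong_left) (auto intro: rev_finite_subset[OF fin] split: if_splits)
  finally show ?thesis unfolding split by simp
qed

text \<open>The Dirichlet convolution 1 * 1 * id, in which 1 and id combine to
  \<open>sigma1\<close>.\<close>

definition triple_sum :: "nat \<Rightarrow> nat" where
  "triple_sum n = (\<Sum>(a, d, e)\<in>triples n. e)"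

lemma triple_sum_sigma1:
  assumes "n > 0"
  shows "triple_sum n = (\<Sum>l | l dvd n. sigma1 (n div l))"
  unfolding triple_sum_def sum_triples[OF assms] sigma1_def by simp

lemma sum_sigma1_multiples:
  assumes n: "n > 0" and j: "j > 0"
  shows "(\<Sum>k | 0 < k \<and> j * k dvd n. int (sigma1 (n div (j * k)))) =
    (if j dvd n then int (triple_sum (n div j)) else 0)"
proof (cases "j dvd n")
  case True
  then obtain m where m: "n = j * m" by (rule dvdE)
  then have "m > 0" using n by simp
  moreover have "{k. 0 < k \<and> j * k dvd n} = {k. k dvd m}"
    using m j \<open>m > 0\<close> by (auto intro: Nat.gr0I)
  ultimately show ?thesis using True j by (simp add: m triple_sum_sigma1 flip: of_nat_sum)
next
  case False
  then have empty: "{k. 0 < k \<and> j * k dvd n} = {}" using dvd_mult_left by blast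
  show ?thesis unfolding empty using False by simp
qed

lemma sum_triples_even_a:
  assumes "n > 0"
  shows "(\<Sum>(a, d, e) | (a, d, e) \<in> triples n \<and> even a. e) =
      (if even n then triple_sum (n div 2) else 0)"
proof (cases "even n")
  case True
  then obtain N where "n = 2 * N" by blast
  then show ?thesis using sum_triples_even[where N = N and f = "\<lambda>a d e. e"]
      by (simp add: triple_sum_def)
next
  case False
  then have empty: "{(a, d, e). (a, d, e) \<in> triples n \<and> even a} = {}" by (auto simp: triples_def)
  show ?thesis unfolding empty using False by simp
qed

lemma sum_triples_odd_a:
  assumes n: "n > 0"
  shows "int (\<Sum>(a, d, e) | (a, d, e) \<in> triples n \<and> odd a. e) =
    int (triple_sum n) - (if even n then int (triple_sum (n div 2)) else 0)"
proof -
  have "triples n = {(a, d, e). (a, d, e) \<in> triples n \<and>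
      odd a} \<union> {(a, d, e). (a, d, e) \<in> triples n \<and> even a}" by auto
  then have "triple_sum n = (\<Sum>(a, d, e)\<in>{(a, d, e). (a, d, e) \<in> triples n \<and>
      odd a} \<union> {(a, d, e). (a, d, e) \<in> triples n \<and> even a}. e)"
    by (simp add: triple_sum_def)
  also have "\<dots> = (\<Sum>(a, d, e) | (a, d, e) \<in> triples n \<and>
      odd a. e) + (\<Sum>(a, d, e) | (a, d, e) \<in> triples n \<and> even a. e)"
    by (rule sum.union_disjoint) (auto intro: rev_finite_subset[OF finite_triples[OF n]])
  finally show ?thesis using sum_triples_even_a[OF n] by simp
qed

text \<open>The even divisors of 2 m are the doubles of the divisors of \<open>m\<close>. The odd
  divisors of 2 m are those of \<open>m\<close>, and their sum is \<open>sigma1 m\<close> minus the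
  sum of the even divisors of \<open>m\<close>.\<close>

lemma sigma1_double:
  assumes m: "m > 0"
  shows "int (sigma1 (2 * m)) = 3 * int (sigma1 m) - (if even m then 2 * int (sigma1 (m div 2))
      else 0)"
proof -
  have even_sum: "(\<Sum>d | d dvd 2 * k \<and> even d. d) = 2 * sigma1 k" for k :: nat
  proof -
    have "(\<Sum>d | d dvd 2 * k \<and> even d. d) = (\<Sum>d | d dvd k. 2 * d)"
      by (rule sum.reindex_bij_witness[where i = "\<lambda>d. 2 * d"
          and j = "\<lambda>d. d div 2"]) (auto elim!: evenE)
    then show ?thesis by (simp add: sigma1_def sum_distrib_left)
  qed
  have split: "sigma1 k = (\<Sum>d | d dvd k \<and> even d. d) + (\<Sum>d | d dvd k \<and> odd d. d)" if "k > 0"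
      for k :: nat
  proof -
    have "{d. d dvd k} = {d. d dvd k \<and> even d} \<union> {d. d dvd k \<and> odd d}" by auto
    then have "sigma1 k = (\<Sum>d\<in>{d. d dvd k \<and> even d} \<union> {d. d dvd k \<and> odd d}. d)"
      unfolding sigma1_def by (rule sum.cong[OF _ refl])
    also have "\<dots> = (\<Sum>d | d dvd k \<and> even d. d) + (\<Sum>d | d dvd k \<and> odd d. d)"
      by (rule sum.union_disjoint) (use that in auto)
    finally show ?thesis .
  qed
  have "{d. d dvd 2 * m \<and> odd d} = {d. d dvd m \<and> odd d}"
    using coprime_dvd_mult_right_iff[of _ "2 :: nat" m] by (auto simp: coprime_right_2_iff_odd)
  then have 1: "sigma1 (2 * m) = 2 * sigma1 m + (\<Sum>d | d dvd m \<and> odd d. d)"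
    using split[of "2 * m"] even_sum[of m] m by simp
  have "(\<Sum>d | d dvd m \<and> even d. d) = (if even m then 2 * sigma1 (m div 2) else 0)"
  proof (cases "even m")
    case True
    then obtain k where "m = 2 * k" by blast
    then show ?thesis using even_sum[of k] by simp
  next
    case False
    then have empty: "{d. d dvd m \<and> even d} = {}" by (auto dest: dvd_trans)
    show ?thesis unfolding empty using False by simp
  qed
  then show ?thesis using 1 split[OF m] by auto
qed

lemma sum_even_even:
  assumes n: "n > 0"
  shows "(\<Sum>(a, d, e) | (a, d, e) \<in> triples n \<and> odd a \<and> even e. e) =
    (if even n then 2 * (\<Sum>(a, d, e) | (a, d, e) \<in> triples (n div 2) \<and> odd a. e) else 0)"
proof (cases "even n")
  case True
  then obtain N where N: "n = 2 * N" by blast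
  have "(\<Sum>(a, d, e) | (a, d, e) \<in> triples n \<and> odd a \<and> even e. e) =
    (\<Sum>(a, d, e) | (a, d, e) \<in> triples N \<and> odd a. 2 * e)"
    by (rule sum.reindex_bij_witness[where i = "\<lambda>(a, d, e). (a, d, 2 * e)"
        and j = "\<lambda>(a, d, e). (a, d, e div 2)"])
      (auto simp: triples_def N elim!: evenE)
  then show ?thesis using N by (simp add: sum_distrib_left case_prod_beta')
next
  case False
  then have empty: "{(a, d, e). (a, d, e) \<in> triples n \<and> odd a \<and> even e} = {}"
      by (auto simp: triples_def)
  show ?thesis unfolding empty using False by simp
qed

text \<open>Halving the even entry \<open>e\<close> passes from \<open>n\<close> to n / 2 at the
  price of a factor 2; removing the triples with even \<open>a\<close> subtracts the sum that
  belongs to n / 4.\<close>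

lemma count_B1:
  assumes n: "n > 0"
  shows "int (\<Sum>(a, d, e) | (a, d, e) \<in> triples n \<and> odd a \<and> even e. e) =
    2 * ((\<Sum>k | 0 < k \<and> 2 * k dvd n. int (sigma1 (n div (2 * k))))
             - (\<Sum>k | 0 < k \<and> 4 * k dvd n. int (sigma1 (n div (4 * k)))))"
proof (cases "even n")
  case True
  then obtain N where N: "n = 2 * N" by blast
  then have "N > 0" using n by simp
  then show ?thesis
    unfolding sum_even_even[OF n] sum_sigma1_multiples[OF n zero_less_numeral]
    using sum_triples_odd_a[of N] by (auto simp: N)
next
  case False
  then have "\<not> 4 dvd n" by (metis dvd_trans even_numeral)
  then show ?thesis
    unfolding sum_even_even[OF n] sum_sigma1_multiples[OF n zero_less_numeral] using False by simp
qed

text \<open>For even \<open>n\<close> and odd \<open>a\<close> the product of \<open>d\<close> and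
  \<open>e\<close> is even; having equal parity, both are even, so 4 divides \<open>n\<close>. For
  odd \<open>n\<close> all triples qualify.\<close>

lemma count_B2:
  assumes n: "n > 0"
  shows "int (\<Sum>(a, d, e) | (a, d, e) \<in> triples n \<and> odd a \<and> even (int e - int d). e) =
    (if even n
     then \<Sum>k | 0 < k \<and> 4 * k dvd n. int (sigma1 (n div (2 * k))) - int (sigma1 (n div (4 * k)))
     else \<Sum>l | 0 < l \<and> l dvd n. int (sigma1 (n div l)))"
proof (cases "even n")
  case False
  then have "{(a, d, e). (a, d, e) \<in> triples n \<and> odd a \<and> even (int e - int d)} = triples n"
    by (auto simp: triples_def)
  then show ?thesis
    using False sum_sigma1_multiples[OF n, of 1] by (simp add: triple_sum_def)
next
  case True
  show ?thesis
  proof (cases "4 dvd n")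
    case False
    have empty: "{(a, d, e). (a, d, e) \<in> triples n \<and> odd a \<and> even (int e - int d)} = {}"
    proof -
      have False if "odd a" "even (int e - int d)" "a * d * e = n" for a d e
      proof -
        have "even d \<and> even e" using that True by auto
        then have "2 * 2 dvd a * (d * e)" by (intro dvd_mult mult_dvd_mono) auto
        then show False using that False by (simp add: mult.assoc)
      qed
      then show ?thesis by (auto simp: triples_def)
    qed
    have empty': "{k. 0 < k \<and> 4 * k dvd n} = {}" using False dvd_mult_left by blast
    show ?thesis unfolding empty empty' using True by simp
  next
    case four: True
    then obtain M where M: "n = 4 * M" by blast
    then have Mpos: "M > 0" using n by simp
    have "(\<Sum>(a, d, e) | (a, d, e) \<in> triples n \<and> odd a \<and> even (int e - int d). e) =
      (\<Sum>(a, d, e) | (a, d, e) \<in> triples M \<and> odd a. 2 * e)"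
    proof (rule sum.reindex_bij_witness[where i = "\<lambda>(a, d, e). (a, 2 * d, 2 * e)"
        and j = "\<lambda>(a, d, e). (a, d div 2, e div 2)"])
      fix x assume x: "x \<in> {(a, d, e). (a, d, e) \<in> triples n \<and> odd a \<and> even (int e - int d)}"
      then obtain a d e where xe: "x = (a, d, e)" and *: "odd a" "even (int e - int d)"
          "a * d * e = n"
        by (auto simp: triples_def)
      then have "even d \<and> even e" using True by auto
      then obtain d' e' where de: "d = 2 * d'" "e = 2 * e'" by blast
      then have "a * d' * e' = M" using *(3) M by simp
      then show "(case case x of (a, d, e) \<Rightarrow> (a, d div 2, e div 2) of (a, d, e) \<Rightarrow> (a, 2 * d, 2 *
          e)) = x"
        "(case x of (a, d, e) \<Rightarrow> (a, d div 2, e div 2)) \<in> {(a, d, e). (a, d, e) \<in> triples M \<and> odd a}"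
        "(case case x of (a, d, e) \<Rightarrow> (a, d div 2, e div 2) of (a, d, e) \<Rightarrow> 2 * e) =
          (case x of (a, d, e) \<Rightarrow> e)"
        using *(1) by (simp_all add: xe de triples_def)
    qed (auto simp: triples_def M)
    then have "int (\<Sum>(a, d, e) | (a, d, e) \<in> triples n \<and> odd a \<and> even (int e - int d). e) =
        2 * int (\<Sum>(a, d, e) | (a, d, e) \<in> triples M \<and> odd a. e)"
      by (simp add: sum_distrib_left case_prod_beta')
    also have "\<dots> = 2 * int (triple_sum M) - (if even M then 2 * int (triple_sum (M div 2)) else 0)"
      unfolding sum_triples_odd_a[OF Mpos] by simp
    \<comment> \<open>Both triple sums are written as one sum over \<open>k\<close>, to be compared
      term by term with the stated one.\<close>
    also have "\<dots> = (\<Sum>k | k dvd M. 2 * int (sigma1 (M div k)) - (if even (M div k) then 2 * int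
        (sigma1 (M div k div 2)) else 0))"
    proof -
      have "(\<Sum>k | k dvd M. if even (M div k) then 2 * int (sigma1 (M div k div 2)) else 0) =
          (\<Sum>k | 0 < k \<and> 2 * k dvd M. 2 * int (sigma1 (M div (2 * k))))"
      proof (rule sum.mono_neutral_cong_right)
        show "finite {k. k dvd M}" using Mpos by simp
        show "{k. 0 < k \<and> 2 * k dvd M} \<subseteq> {k. k dvd M}" using dvd_mult_right by blast
        have iff: "even (M div k) \<longleftrightarrow> 2 * k dvd M" if k: "k dvd M" for k
        proof -
          obtain j where "M = k * j" using k by blast
          then show ?thesis using Mpos by (auto simp: mult.commute)
        qed
        show "\<forall>k\<in>{k. k dvd M} - {k. 0 < k \<and> 2 * k dvd M}. (if even (M div k) then 2 * int (sigma1
          (M div k div 2)) else 0) = 0"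
        proof
          fix k assume k: "k \<in> {k. k dvd M} - {k. 0 < k \<and> 2 * k dvd M}"
          then have "k dvd M" "k > 0" using Mpos by (auto intro: Nat.gr0I)
          then have "odd (M div k)" using k iff by blast
          then show "(if even (M div k) then 2 * int (sigma1 (M div k div 2)) else 0) = 0" by simp
        qed
        show "(if even (M div k) then 2 * int (sigma1 (M div k div 2)) else 0) =
          2 * int (sigma1 (M div (2 * k)))"
          if k: "k \<in> {k. 0 < k \<and> 2 * k dvd M}" for k
        proof -
          have "k dvd M" using k dvd_mult_right by blast
          then have "even (M div k)" using k iff by blast
          moreover have "M div k div 2 = M div (2 * k)" by (simp only: div_mult2_eq mult.commute)
          ultimately show ?thesis by simp
        qed
      qed
      also have "\<dots> = (if even M then 2 * int (triple_sum (M div 2)) else 0)"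
        using sum_sigma1_multiples[OF Mpos, of 2] by (simp flip: sum_distrib_left)
      finally show ?thesis
        by (simp add: sum_subtractf triple_sum_sigma1[OF Mpos] flip: sum_distrib_left)
    qed
    also have "\<dots> = (\<Sum>k | 0 < k \<and> 4 * k dvd n. int (sigma1 (n div (2 * k))) - int (sigma1 (n div
        (4 * k))))"
    proof (rule sum.cong)
      show "{k. k dvd M} = {k. 0 < k \<and> 4 * k dvd n}" using M Mpos by (auto intro: Nat.gr0I)
      fix k assume k: "k \<in> {k. 0 < k \<and> 4 * k dvd n}"
      then obtain j where j: "M = k * j" using M by auto
      then have "j > 0" "k > 0" using Mpos by auto
      have "n div (4 * k) = j" "n div (2 * k) = 2 * j" "M div k = j"
        using \<open>k > 0\<close> by (simp_all add: M j)
      \<comment> \<open>With j = M / k the stated term is the value of \<open>sigma1\<close> at 2 j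
        minus its value at j, which \<open>sigma1_double\<close> rewrites.\<close>
      then show "2 * int (sigma1 (M div k)) - (if even (M div k) then 2 * int (sigma1 (M div k
          div 2)) else 0) =
          int (sigma1 (n div (2 * k))) - int (sigma1 (n div (4 * k)))"
        using sigma1_double[OF \<open>j > 0\<close>] by simp
    qed
    finally show ?thesis using True by simp
  qed
qed

text \<open>Here l = d, m = e, and n / (2 l m) is half of the first diagonal entry. The square
  counts all subgroups with the given diagonal; the remaining terms, after summation, count those
  invariant under \<open>flip\<close>.\<close>

lemma count_G1:
  assumes n: "n > 0"
  shows "real (card (even_index n) + card (fixed_index n)) =
    (\<Sum>l | 0 < l \<and> 2 * l dvd n. \<Sum>m | m dvd n div (2 * l).
          ((real l)\<^sup>2 + 3 / 2 + 1 / 2 * (- 1) ^ l + (- 1) ^ (n div (2 * l * m))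
             + (- 1) ^ (l + n div (2 * l * m))) * real m)"
proof (cases "even n")
  case False
  then have empty: "{(a, d, e). (a, d, e) \<in> triples n \<and> even a} = {}"
      "{l. 0 < l \<and> 2 * l dvd n} = {}"
    by (auto simp: triples_def dest: dvd_mult_left)
  show ?thesis unfolding card_even_index[OF n] card_fixed_index[OF n] empty by simp
next
  case True
  then obtain N where N: "n = 2 * N" by blast
  then have Npos: "N > 0" using n by simp
  have "card (even_index n) + card (fixed_index n) = (\<Sum>(a, d, e)\<in>triples N. d\<^sup>2 * e) +
      (\<Sum>(a, d, e)\<in>triples N. if odd d then e else if even e then 2 * e else 0)"
    unfolding card_even_index[OF n] card_fixed_index[OF n] unfolding N sum_triples_even ..
  also have "\<dots> = (\<Sum>(a, d, e)\<in>triples N. d\<^sup>2 * e + (if odd d then e else if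
      even a then 4 * e else 0))"
    unfolding sum_divides_weights[OF Npos, symmetric] by (simp add: case_prod_beta' sum.distrib)
  finally have "real (card (even_index n) + card (fixed_index n)) =
      (\<Sum>(a, d, e)\<in>triples N. real (d\<^sup>2 * e + (if odd d then e else if even a then 4 * e else 0)))"
    by (simp add: case_prod_beta')
  \<comment> \<open>The terms besides the square add up to 1 for odd \<open>d\<close>; for even
    \<open>d\<close> they give 4 or 0 as \<open>a\<close> is even or odd.\<close>
  also have "\<dots> = (\<Sum>(a, d, e)\<in>triples N. ((real d)\<^sup>2 + 3 / 2 + 1 / 2 * (- 1) ^ d + (- 1) ^ a +
      (- 1) ^ (d + a)) * real e)"
    by (intro sum.cong refl) (auto simp: algebra_simps)
  also have "\<dots> = (\<Sum>l | l dvd N. \<Sum>m | m dvd N div l.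
      ((real l)\<^sup>2 + 3 / 2 + 1 / 2 * (- 1) ^ l + (- 1) ^ (N div (l * m)) + (- 1) ^ (l +
          N div (l * m))) * real m)"
    by (rule sum_triples[OF Npos])
  also have "{l. l dvd N} = {l. 0 < l \<and> 2 * l dvd n}" using N Npos by (auto intro: Nat.gr0I)
  finally show ?thesis by (simp add: N mult.assoc)
qed

section \<open>The fundamental groups and the main theorem\<close>

lemma group_isomorphisms_image:
  assumes "group G" "group H" and \<phi>: "group_isomorphisms G H \<phi> \<psi>" and K: "subgroup K G"
  shows "subgroup (\<phi> ` K) H" "card (rcosets\<^bsub>H\<^esub> (\<phi> ` K)) = card (rcosets\<^bsub>G\<^esub> K)"
    "H\<lparr>carrier := \<phi> ` K\<rparr> \<cong> G\<lparr>carrier := K\<rparr>"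
proof -
  interpret G: group G by fact
  interpret H: group H by fact
  interpret \<phi>: group_hom G H \<phi>
    using \<phi> by unfold_locales (simp add: group_isomorphisms_def)
  have \<psi>\<phi>: "\<psi> (\<phi> x) = x" if "x \<in> carrier G" for x using \<phi> that by (simp add: group_isomorphisms_def)
  have inj: "inj_on \<phi> (carrier G)" by (rule inj_on_inverseI) (rule \<psi>\<phi>)
  have surj: "\<phi> ` carrier G = carrier H"
  proof
    show "carrier H \<subseteq> \<phi> ` carrier G"
    proof
      fix y assume "y \<in> carrier H"
      then have "y = \<phi> (\<psi> y)" "\<psi> y \<in> carrier G" using \<phi>
          by (auto simp: group_isomorphisms_def hom_def)
      then show "y \<in> \<phi> ` carrier G" by (rule image_eqI)
    qed
  qed auto
  have KG: "K \<subseteq> carrier G" by (rule subgroup.subset[OF K])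
  show "subgroup (\<phi> ` K) H" by (rule \<phi>.subgroup_img_is_subgroup[OF K])
  have coset: "\<phi> ` (K #>\<^bsub>G\<^esub> x) = \<phi> ` K #>\<^bsub>H\<^esub> \<phi> x" if "x \<in> carrier G" for x
  proof -
    have "\<phi> (k \<otimes>\<^bsub>G\<^esub> x) = \<phi> k \<otimes>\<^bsub>H\<^esub> \<phi> x" if "k \<in> K" for k
      using \<open>x \<in> carrier G\<close> KG that by auto
    then show ?thesis by (simp add: r_coset_def image_UN)
  qed
  have "bij_betw (image \<phi>) (rcosets\<^bsub>G\<^esub> K) (rcosets\<^bsub>H\<^esub> (\<phi> ` K))"
  proof (rule bij_betw_imageI)
    have "R \<subseteq> carrier G" if "R \<in> rcosets\<^bsub>G\<^esub> K" for R
      using that G.r_coset_subset_G[OF KG] by (auto simp: RCOSETS_def)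
    then show "inj_on (image \<phi>) (rcosets\<^bsub>G\<^esub> K)"
      using inj_on_image_eq_iff[OF inj] by (auto intro!: inj_onI)
    have "rcosets\<^bsub>G\<^esub> K = (\<lambda>x. K #>\<^bsub>G\<^esub> x) ` carrier G"
      "rcosets\<^bsub>H\<^esub> (\<phi> ` K) = (\<lambda>y. \<phi> ` K #>\<^bsub>H\<^esub> y) ` \<phi> ` carrier G"
      unfolding surj by (auto simp: RCOSETS_def)
    then show "image \<phi> ` (rcosets\<^bsub>G\<^esub> K) = rcosets\<^bsub>H\<^esub> (\<phi> ` K)"
      by (simp add: image_image coset)
  qed
  then show "card (rcosets\<^bsub>H\<^esub> (\<phi> ` K)) = card (rcosets\<^bsub>G\<^esub> K)" by (metis bij_betw_same_card)
  have "\<phi> \<in> hom (G\<lparr>carrier := K\<rparr>) H" using KG by (auto simp: hom_def subset_iff)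
  then show "H\<lparr>carrier := \<phi> ` K\<rparr> \<cong> G\<lparr>carrier := K\<rparr>"
    using hom_image_iso[OF G.subgroup_imp_group[OF K]] inj_on_subset[OF inj KG] by fastforce
qed

lemma conj_rel_hom_image:
  assumes "group G" "group H" and \<phi>: "\<phi> \<in> hom G H" and K: "K \<subseteq> carrier G"
      and KL: "(K, L) \<in> conj_rel G"
  shows "(\<phi> ` K, \<phi> ` L) \<in> conj_rel H"
proof -
  interpret G: group G by fact
  interpret H: group H by fact
  interpret \<phi>: group_hom G H \<phi> by unfold_locales (rule \<phi>)
  obtain g where g: "g \<in> carrier G" "L = (\<lambda>k. g \<otimes>\<^bsub>G\<^esub> k \<otimes>\<^bsub>G\<^esub> inv\<^bsub>G\<^esub> g) ` K"
    using KL unfolding G.conj_rel_iff by blast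
  have "\<phi> (g \<otimes>\<^bsub>G\<^esub> k \<otimes>\<^bsub>G\<^esub> inv\<^bsub>G\<^esub> g) = \<phi> g \<otimes>\<^bsub>H\<^esub> \<phi> k \<otimes>\<^bsub>H\<^esub> inv\<^bsub>H\<^esub> \<phi> g" if "k \<in> K" for k
    using g(1) K that by (simp add: subset_iff)
  then have "\<phi> ` L = (\<lambda>k. \<phi> g \<otimes>\<^bsub>H\<^esub> k \<otimes>\<^bsub>H\<^esub> inv\<^bsub>H\<^esub> \<phi> g) ` \<phi> ` K"
    unfolding g(2) image_image by (rule image_cong[OF refl])
  then show ?thesis unfolding H.conj_rel_iff by (intro bexI[of _ "\<phi> g"]) (use g(1) in auto)
qed

text \<open>Transports the count from the presented groups to the models in coordinates.\<close>

lemma subgroup_classes_iso: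
  assumes "group G" "group G'" "G \<cong> G'" "group H" "group H'" "H \<cong> H'"
  shows "\<exists>h. bij_betw h (subgroup_classes H G n) (subgroup_classes H' G' n)"
proof -
  interpret G: group G by fact
  interpret G': group G' by fact
  interpret H: group H by fact
  interpret H': group H' by fact
  obtain \<phi> \<psi> where \<phi>: "group_isomorphisms G G' \<phi> \<psi>"
    using assms(3) G.iso_iff_group_isomorphisms unfolding is_iso_def by blast
  then have \<psi>: "group_isomorphisms G' G \<psi> \<phi>" by (auto simp: group_isomorphisms_def)
  note imG = group_isomorphisms_image[OF assms(1,2) \<phi>]
      and imG' = group_isomorphisms_image[OF assms(2,1) \<psi>]
  have hom: "\<phi> \<in> hom G G'" "\<psi> \<in> hom G' G" using \<phi> by (simp_all add: group_isomorphisms_def)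
  have \<psi>\<phi>: "\<psi> ` \<phi> ` K = K" if "K \<subseteq> carrier G" for K
    using that \<phi> by (force simp: group_isomorphisms_def image_image)
  have \<phi>\<psi>: "\<phi> ` \<psi> ` L = L" if "L \<subseteq> carrier G'" for L
    using that \<phi> by (force simp: group_isomorphisms_def image_image)
  let ?A = "{K. subgroup K G \<and> card (rcosets\<^bsub>G\<^esub> K) = n \<and> G\<lparr>carrier := K\<rparr> \<cong> H}"
  let ?B = "{K. subgroup K G' \<and> card (rcosets\<^bsub>G'\<^esub> K) = n \<and> G'\<lparr>carrier := K\<rparr> \<cong> H'}"
  have "\<exists>h. bij_betw h (?A // conj_rel G) (?B // conj_rel G')"
  proof (rule quotient_bij_betw[where f = "image \<phi>"])
    show "\<phi> ` K \<in> ?B" if "K \<in> ?A" for K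
      using that imG[of K] iso_trans[OF imG(3)[of K] iso_trans[OF _ assms(6)]] by simp
    show "conj_rel G `` {K} = conj_rel G `` {L} \<longleftrightarrow> conj_rel G' `` {\<phi> ` K} = conj_rel G' `` {\<phi> ` L}"
      if "K \<in> ?A" "L \<in> ?A" for K L
    proof -
      have sub: "K \<subseteq> carrier G" "L \<subseteq> carrier G" using that subgroup.subset by blast+
      then have sub': "\<phi> ` K \<subseteq> carrier G'" "\<phi> ` L \<subseteq> carrier G'" using hom(1) by (auto simp: hom_def)
      have "(K, L) \<in> conj_rel G \<longleftrightarrow> (\<phi> ` K, \<phi> ` L) \<in> conj_rel G'"
        using conj_rel_hom_image[OF assms(1,2) hom(1) sub(1)]
          conj_rel_hom_image[OF assms(2,1) hom(2) sub'(1), of "\<phi> ` L"] \<psi>\<phi>[OF sub(1)] \<psi>\<phi>[OF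
            sub(2)] by auto
      then show ?thesis
        unfolding G.conj_rel_class_eq_iff[OF sub] G'.conj_rel_class_eq_iff[OF sub'] .
    qed
    show "\<exists>K\<in>?A. conj_rel G' `` {\<phi> ` K} = conj_rel G' `` {L}" if L: "L \<in> ?B" for L
    proof
      have L': "subgroup L G'" "card (rcosets\<^bsub>G'\<^esub> L) = n" "G'\<lparr>carrier := L\<rparr> \<cong> H'" using L
          by simp_all
      show "conj_rel G' `` {\<phi> ` \<psi> ` L} = conj_rel G' `` {L}"
        unfolding \<phi>\<psi>[OF subgroup.subset[OF L'(1)]] ..
      have "H' \<cong> H" using H.iso_sym assms(6) unfolding is_iso_def by blast
      then show "\<psi> ` L \<in> ?A"
        using imG'[OF L'(1)] L'(2) iso_trans[OF imG'(3)[OF L'(1)] iso_trans[OF L'(3)]] by simp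
    qed
  qed
  then show ?thesis unfolding subgroup_classes_def conj_rel_def .
qed

lemma group_Z3: "group Z3"
  unfolding Z3_def by (intro DirProd_group group_integer_group)

text \<open>Coverings and subgroups of \<open>pi1_B2\<close> are both matched with the same classes
  in \<open>amphi\<close>. Finiteness is carried along because \<open>card\<close> alone does not
  tell an infinite set from an empty one.\<close>

lemma classes_of_type:
  assumes n: "n > 0" and su: "flat_type s u" and "group H" "H \<cong> flat_group s u"
    and fin: "finite (typed_subgroups s u n // conj_rel amphi)"
  shows "finite (covering_classes n B2 (model_space s u))" "finite (subgroup_classes H pi1_B2 n)"
    "card (covering_classes n B2 (model_space s u)) =
        card (typed_subgroups s u n // conj_rel amphi)"
    "c_classes H pi1_B2 n = card (typed_subgroups s u n // conj_rel amphi)"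
proof -
  have "B2 = amphi.quot (carrier amphi)" by (simp add: B2_eq)
  moreover have "{K. subgroup K amphi \<and> card (rcosets\<^bsub>amphi\<^esub> K) = n \<and>
      amphi.quot K homeomorphic_space model_space s u} =
      typed_subgroups s u n"
    using subgroup_type_iff[OF _ _ n su] unfolding typed_subgroups_def quotient_space_def by blast
  ultimately obtain h where
    h: "bij_betw h (typed_subgroups s u n // conj_rel amphi) (covering_classes n B2 (model_space
        s u))"
    using amphi.covering_classes_bij[OF n, of "model_space s u"] by auto
  show "finite (covering_classes n B2 (model_space s u))"
    "card (covering_classes n B2 (model_space s u)) =
        card (typed_subgroups s u n // conj_rel amphi)"
    using bij_betw_finite[OF h] bij_betw_same_card[OF h] fin by simp_all
  have pi: "group pi1_B2" unfolding pi1_B2_def by (rule group_presented_group)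
  have typed: "subgroup_classes (flat_group s u) amphi n = typed_subgroups s u n // conj_rel amphi"
    unfolding subgroup_classes_def typed_subgroups_def conj_rel_def ..
  obtain k where k: "bij_betw k (subgroup_classes H pi1_B2 n) (typed_subgroups s u n // conj_rel
      amphi)"
    using subgroup_classes_iso[OF pi group_amphi pi1_B2_iso assms(3) group_flat_group[OF su]
        assms(4), where n = n]
    unfolding typed by blast
  show "finite (subgroup_classes H pi1_B2 n)"
    "c_classes H pi1_B2 n = card (typed_subgroups s u n // conj_rel amphi)"
    unfolding c_classes_def using bij_betw_finite[OF k] bij_betw_same_card[OF k] fin by simp_all
qed

text \<open>The points of \<open>N\<close> may have any type here, since lifting identifies
  \<open>N\<close> with a quotient of \<open>E3\<close>.\<close>

lemma covering_space_type:
  fixes N :: "'a topology"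
  assumes n: "n > 0" and cov: "nfold_covering n N B2 p"
  obtains s u where "flat_type s u" "N homeomorphic_space model_space s u" "odd n \<longrightarrow> s = - 1 \<and> u = 1"
proof -
  have "nfold_covering n N (amphi.quot (carrier amphi)) p" using cov by (simp add: B2_eq)
  then obtain K \<eta> where K: "subgroup K amphi" "card (rcosets\<^bsub>amphi\<^esub> K) = n"
      and \<eta>: "homeomorphic_map (amphi.quot K) N \<eta>"
    using amphi.nfold_covering_classification[OF _ n] by metis
  obtain s u where su: "flat_type s u" "quotient_space K homeomorphic_space model_space s u"
      "odd n \<longrightarrow> s = - 1 \<and> u = 1"
    using subgroup_type[OF K n] by metis
  have "N homeomorphic_space quotient_space K"
    unfolding quotient_space_def using \<eta> homeomorphic_space homeomorphic_space_sym by blast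
  then have "N homeomorphic_space model_space s u" using su(2) homeomorphic_space_trans by blast
  then show ?thesis using that su by blast
qed

theorem theorem6:
  fixes n :: nat
  assumes "n > 0"
  shows
    "(\<forall>(N :: 'a topology) p. nfold_covering n N B2 p \<longrightarrow>
        (odd n \<longrightarrow> N homeomorphic_space B2) \<and>
        (even n \<longrightarrow> N homeomorphic_space G1 \<or> N homeomorphic_space B1 \<or> N homeomorphic_space B2))
     \<and>
     (finite (covering_classes n B2 G1) \<and> finite (subgroup_classes Z3 pi1_B2 n) \<and>
      card (covering_classes n B2 G1) = c_classes Z3 pi1_B2 n \<and>
      real (c_classes Z3 pi1_B2 n) =
        1 / 2 * (\<Sum>l | 0 < l \<and> 2 * l dvd n. \<Sum>m | m dvd n div (2 * l).
          ((real l)\<^sup>2 + 3 / 2 + 1 / 2 * (- 1) ^ l + (- 1) ^ (n div (2 * l * m))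
             + (- 1) ^ (l + n div (2 * l * m))) * real m))
     \<and>
     (finite (covering_classes n B2 B2) \<and> finite (subgroup_classes pi1_B2 pi1_B2 n) \<and>
      card (covering_classes n B2 B2) = c_classes pi1_B2 pi1_B2 n \<and>
      int (c_classes pi1_B2 pi1_B2 n) =
        (if even n
         then \<Sum>k | 0 < k \<and> 4 * k dvd n. int (sigma1 (n div (2 * k))) - int (sigma1 (n div (4 * k)))
         else \<Sum>l | 0 < l \<and> l dvd n. int (sigma1 (n div l))))
     \<and>
     (finite (covering_classes n B2 B1) \<and> finite (subgroup_classes pi1_B1 pi1_B2 n) \<and>
      card (covering_classes n B2 B1) = c_classes pi1_B1 pi1_B2 n \<and>
      int (c_classes pi1_B1 pi1_B2 n) =
        2 * ((\<Sum>k | 0 < k \<and> 2 * k dvd n. int (sigma1 (n div (2 * k))))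
             - (\<Sum>k | 0 < k \<and> 4 * k dvd n. int (sigma1 (n div (4 * k))))))"
proof (intro conjI)
  have model: "G1 = model_space 1 0" "B1 = model_space (- 1) 0" "B2 = model_space (- 1) 1"
    by (simp_all add: G1_eq B1_eq B2_eq model_space_def)
  show "\<forall>(N :: 'a topology) p. nfold_covering n N B2 p \<longrightarrow>
        (odd n \<longrightarrow> N homeomorphic_space B2) \<and>
        (even n \<longrightarrow> N homeomorphic_space G1 \<or> N homeomorphic_space B1 \<or> N homeomorphic_space B2)"
  proof (intro allI impI)
    fix N :: "'a topology" and p
    assume "nfold_covering n N B2 p"
    then obtain s u where "flat_type s u" "N homeomorphic_space model_space s u"
        "odd n \<longrightarrow> s = - 1 \<and> u = 1"
      by (rule covering_space_type[OF assms])
    then show "(odd n \<longrightarrow> N homeomorphic_space B2) \<and>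
        (even n \<longrightarrow> N homeomorphic_space G1 \<or> N homeomorphic_space B1 \<or> N homeomorphic_space B2)"
      unfolding model flat_type_def by auto
  qed
  have "Z3 \<cong> flat_group 1 0"
    using group.iso_sym[OF group_flat_group[OF flat_type_simps(1)]] flat_group_1_0_iso_Z3
    unfolding is_iso_def by blast
  note Z = classes_of_type[OF assms flat_type_simps(1) group_Z3 this even_classes(1)[OF assms],
      folded model]
  show "finite (covering_classes n B2 G1)" "finite (subgroup_classes Z3 pi1_B2 n)"
    "card (covering_classes n B2 G1) = c_classes Z3 pi1_B2 n" using Z by simp_all
  \<comment> \<open>The orbit count gives twice the number of classes, whence the factor
    1/2.\<close>
  have "real (2 * c_classes Z3 pi1_B2 n) = real (card (even_index n) + card (fixed_index n))"
    unfolding Z(4) even_classes(2)[OF assms] ..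
  then show "real (c_classes Z3 pi1_B2 n) =
        1 / 2 * (\<Sum>l | 0 < l \<and> 2 * l dvd n. \<Sum>m | m dvd n div (2 * l).
          ((real l)\<^sup>2 + 3 / 2 + 1 / 2 * (- 1) ^ l + (- 1) ^ (n div (2 * l * m))
             + (- 1) ^ (l + n div (2 * l * m))) * real m)"
    unfolding count_G1[OF assms] by simp
  have pi2: "group pi1_B2" and pi1: "group pi1_B1"
    unfolding pi1_B2_def pi1_B1_def by (rule group_presented_group)+
  have 01: "(0 :: int) \<in> {0, 1}" "(1 :: int) \<in> {0, 1}" by simp_all
  note P = classes_of_type[OF assms flat_type_simps(3) pi2 pi1_B2_iso odd_classes(1)[OF assms
      01(2)], folded model]
  show "finite (covering_classes n B2 B2)" "finite (subgroup_classes pi1_B2 pi1_B2 n)"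
    "card (covering_classes n B2 B2) = c_classes pi1_B2 pi1_B2 n" using P by simp_all
  show "int (c_classes pi1_B2 pi1_B2 n) =
        (if even n
         then \<Sum>k | 0 < k \<and> 4 * k dvd n. int (sigma1 (n div (2 * k))) - int (sigma1 (n div (4 * k)))
         else \<Sum>l | 0 < l \<and> l dvd n. int (sigma1 (n div l)))"
    unfolding P(4) odd_classes(2)[OF assms 01(2)] count_B2[OF assms, symmetric] by simp
  note Q = classes_of_type[OF assms flat_type_simps(2) pi1 pi1_B1_iso odd_classes(1)[OF assms
      01(1)], folded model]
  show "finite (covering_classes n B2 B1)" "finite (subgroup_classes pi1_B1 pi1_B2 n)"
    "card (covering_classes n B2 B1) = c_classes pi1_B1 pi1_B2 n" using Q by simp_all
  show "int (c_classes pi1_B1 pi1_B2 n) =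
        2 * ((\<Sum>k | 0 < k \<and> 2 * k dvd n. int (sigma1 (n div (2 * k))))
             - (\<Sum>k | 0 < k \<and> 4 * k dvd n. int (sigma1 (n div (4 * k)))))"
    unfolding Q(4) odd_classes(2)[OF assms 01(1)] count_B1[OF assms, symmetric] by simp
qed

end
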